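(* Let $T>0$ and let $(v,p)$ be an axisymmetric suitable weak solution to the Navier-Stokes equations $v_t+v\cdot\nabla v-\nu\Delta v+\nabla p=0$, $\operatorname{div} v=0$, $v|_{t=0}=v(0)$ in $\mathbb{R}^3$ with axisymmetric initial data $v(0)$ satisfying $\operatorname{div} v(0)=0$. Assume that $$\frac{v_\varphi^2(0)}{r},\quad \frac{\omega_\varphi(0)}{r},\quad \frac{\omega_r(0)}{r},\quad \omega_z(0)\quad\text{belong to } L_2(\mathbb{R}^3),$$ and that, with $u=rv_\varphi$, one has $u(0)\in L_\infty(\mathbb{R}^3)\cap L_s(\mathbb{R}^3)$ for some $s\ge 3$. If $$\int_0^T\int_{\mathbb{R}^3}\frac{\omega_\varphi^2}{r}\,dx\,dt\le c_2<\infty ,$$ then there exists a constant $c_3$ such that $$\int_0^T\int_{\mathbb{R}^3}\frac{v_r^2}{r^3}\,dx\,dt\le c_3\int_0^T\int_{\mathbb{R}^3}\frac{\omega_\varphi^2}{r}\,dx\,dt\le c_3c_2 .$$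
   Context: $\nu>0$ is the constant viscosity, $v=(v_1,v_2,v_3)$ the velocity and $p$ the pressure. Cylindrical coordinates $(r,\varphi,z)$: $x_1=r\cos\varphi$, $x_2=r\sin\varphi$, $x_3=z$, with unit vectors $\bar e_r=(\cos\varphi,\sin\varphi,0)$, $\bar e_\varphi=(-\sin\varphi,\cos\varphi,0)$, $\bar e_z=(0,0,1)$. A vector field is axisymmetric if its cylindrical components do not depend on $\varphi$: $v=v_r(r,z,t)\bar e_r+v_\varphi(r,z,t)\bar e_\varphi+v_z(r,z,t)\bar e_z$. The vorticity $\omega=\operatorname{rot} v=\omega_r\bar e_r+\omega_\varphi\bar e_\varphi+\omega_z\bar e_z$ has components $\omega_r=-\partial_z v_\varphi$, $\omega_\varphi=\partial_z v_r-\partial_r v_z$, $\omega_z=\partial_r v_\varphi+v_\varphi/r$. The notation $f(0)$ means the value of $f$ at $t=0$. Weak solutions belong to $L_\infty(0,T;L_2(\mathbb{R}^3))\cap L_2(0,T;H^1(\mathbb{R}^3))$ and satisfy the energy inequality; suitable weak solutions are understood in the sense of Caffarelli-Kohn-Nirenberg (they also satisfy the local energy inequality). *)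

theory Defs
  imports "HOL-Analysis.Analysis"
begin

section \<open>Test functions and distributional derivatives\<close>

text \<open>The directional derivative comes with the direction first, so that it can be iterated.\<close>

definition dirderiv :: "'a::euclidean_space \<Rightarrow> ('a \<Rightarrow> real) \<Rightarrow> 'a \<Rightarrow> real"
  where "dirderiv d f = (\<lambda>x. frechet_derivative f (at x) d)"

primrec C_order :: "nat \<Rightarrow> ('a::euclidean_space \<Rightarrow> real) \<Rightarrow> bool"
  where
    "C_order 0 f \<longleftrightarrow> continuous_on UNIV f"
  | "C_order (Suc n) f \<longleftrightarrow>
       (\<forall>x. f differentiable (at x)) \<and> (\<forall>b\<in>Basis. C_order n (dirderiv b f))"

definition smooth :: "('a::euclidean_space \<Rightarrow> real) \<Rightarrow> bool"
  where "smooth f \<longleftrightarrow> (\<forall>n. C_order n f)"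

definition test_function :: "'a::euclidean_space set \<Rightarrow> ('a \<Rightarrow> real) \<Rightarrow> bool"
  where "test_function \<Omega> \<phi> \<longleftrightarrow>
    smooth \<phi> \<and> (\<exists>K. compact K \<and> K \<subseteq> \<Omega> \<and> (\<forall>x. x \<notin> K \<longrightarrow> \<phi> x = 0))"

definition grad :: "(real^3 \<Rightarrow> real) \<Rightarrow> real^3 \<Rightarrow> real^3"
  where "grad \<phi> x = (\<chi> j. dirderiv (axis j 1) \<phi> x)"

definition locally_integrable :: "(real^3 \<Rightarrow> 'b::euclidean_space) \<Rightarrow> bool"
  where "locally_integrable f \<longleftrightarrow>
    f \<in> borel_measurable lborel \<and> (\<forall>K. compact K \<longrightarrow> set_integrable lborel K f)"

text \<open>Entry \<open>(i, j)\<close> of \<open>G x\<close> is the weak derivative of the \<open>i\<close>-th component in direction \<open>j\<close>;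
  the norm on \<^typ>\<open>real^3^3\<close> is the Frobenius norm.\<close>

definition weak_gradient :: "(real^3 \<Rightarrow> real^3) \<Rightarrow> (real^3 \<Rightarrow> real^3^3) \<Rightarrow> bool"
  where "weak_gradient f G \<longleftrightarrow>
    locally_integrable f \<and> locally_integrable G \<and>
    (\<forall>\<phi>. test_function UNIV \<phi> \<longrightarrow>
      (\<forall>i j. (LINT x|lborel. f x $ i * grad \<phi> x $ j) = - (LINT x|lborel. G x $ i $ j * \<phi> x)))"

definition weakly_divergence_free :: "(real^3 \<Rightarrow> real^3) \<Rightarrow> bool"
  where "weakly_divergence_free f \<longleftrightarrow>
    locally_integrable f \<and>
    (\<forall>\<phi>. test_function UNIV \<phi> \<longrightarrow> (LINT x|lborel. f x \<bullet> grad \<phi> x) = 0)"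

text \<open>\<open>rot f = w\<close> in the sense of distributions: since \<open>rot (\<phi> f) = \<phi> rot f + grad \<phi> \<times> f\<close> integrates
  to zero, \<open>\<integral> \<phi> w = - \<integral> grad \<phi> \<times> f = \<integral> f \<times> grad \<phi>\<close>.\<close>

definition weak_curl :: "(real^3 \<Rightarrow> real^3) \<Rightarrow> (real^3 \<Rightarrow> real^3) \<Rightarrow> bool"
  where "weak_curl f w \<longleftrightarrow>
    locally_integrable f \<and> locally_integrable w \<and>
    (\<forall>\<phi>. test_function UNIV \<phi> \<longrightarrow>
      (LINT x|lborel. \<phi> x *\<^sub>R w x) = (LINT x|lborel. cross3 (f x) (grad \<phi> x)))"


section \<open>Lebesgue spaces\<close>

text \<open>Elements of Lebesgue spaces are given by Borel measurable representatives.\<close>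

definition in_Lp :: "'a measure \<Rightarrow> real \<Rightarrow> ('a \<Rightarrow> 'b::euclidean_space) \<Rightarrow> bool"
  where "in_Lp M q f \<longleftrightarrow>
    f \<in> borel_measurable M \<and> (\<integral>\<^sup>+x. ennreal (norm (f x) powr q) \<partial>M) < \<infinity>"

definition in_Linfty :: "'a measure \<Rightarrow> ('a \<Rightarrow> 'b::euclidean_space) \<Rightarrow> bool"
  where "in_Linfty M f \<longleftrightarrow>
    f \<in> borel_measurable M \<and> (\<exists>C::real. AE x in M. norm (f x) \<le> C)"


section \<open>Cylindrical coordinates\<close>

text \<open>On the axis, which is a null set, the quotients below are \<open>0\<close>. Off the axis,
  \<open>x$1 / r = cos \<phi>\<close> and \<open>x$2 / r = sin \<phi>\<close>.\<close>

definition cyl_r :: "real^3 \<Rightarrow> real"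
  where "cyl_r x = sqrt ((x$1)\<^sup>2 + (x$2)\<^sup>2)"

definition e_r :: "real^3 \<Rightarrow> real^3"
  where "e_r x = vector [x$1 / cyl_r x, x$2 / cyl_r x, 0]"

definition e_phi :: "real^3 \<Rightarrow> real^3"
  where "e_phi x = vector [- (x$2 / cyl_r x), x$1 / cyl_r x, 0]"

definition e_z :: "real^3"
  where "e_z = vector [0, 0, 1]"

definition comp_r :: "(real^3 \<Rightarrow> real^3) \<Rightarrow> real^3 \<Rightarrow> real"
  where "comp_r f x = f x \<bullet> e_r x"

definition comp_phi :: "(real^3 \<Rightarrow> real^3) \<Rightarrow> real^3 \<Rightarrow> real"
  where "comp_phi f x = f x \<bullet> e_phi x"

definition comp_z :: "(real^3 \<Rightarrow> real^3) \<Rightarrow> real^3 \<Rightarrow> real"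
  where "comp_z f x = f x \<bullet> e_z"

definition axisymmetric :: "(real^3 \<Rightarrow> real^3) \<Rightarrow> bool"
  where "axisymmetric f \<longleftrightarrow>
    (\<exists>f\<^sub>r f\<^sub>\<phi> f\<^sub>z :: real \<Rightarrow> real \<Rightarrow> real. AE x in lborel.
      f x = f\<^sub>r (cyl_r x) (x$3) *\<^sub>R e_r x + f\<^sub>\<phi> (cyl_r x) (x$3) *\<^sub>R e_phi x
        + f\<^sub>z (cyl_r x) (x$3) *\<^sub>R e_z)"


section \<open>Suitable weak solutions of the Navier--Stokes equations\<close>

definition space_time :: "real \<Rightarrow> (real \<times> (real^3)) measure"
  where "space_time T = restrict_space lborel ({0<..<T} \<times> UNIV)"

definition time_deriv :: "(real \<times> (real^3) \<Rightarrow> real) \<Rightarrow> real \<times> (real^3) \<Rightarrow> real"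
  where "time_deriv \<phi> = dirderiv (1, 0) \<phi>"

definition space_grad :: "(real \<times> (real^3) \<Rightarrow> real) \<Rightarrow> real \<times> (real^3) \<Rightarrow> real^3"
  where "space_grad \<phi> z = (\<chi> j. dirderiv (0, axis j 1) \<phi> z)"

definition space_laplacian :: "(real \<times> (real^3) \<Rightarrow> real) \<Rightarrow> real \<times> (real^3) \<Rightarrow> real"
  where "space_laplacian \<phi> z =
    (\<Sum>j\<in>UNIV. dirderiv (0, axis j 1) (dirderiv (0, axis j 1) \<phi>) z)"

text \<open>\<open>v\<close> belongs to \<open>L\<^sub>\<infinity>(0,T;L\<^sub>2) \<inter> L\<^sub>2(0,T;H\<^sup>1)\<close> with weak spatial gradient \<open>G\<close>. As \<open>T\<close> is finite,
  the \<open>L\<^sub>2(0,T;L\<^sub>2)\<close> part of the second norm is controlled by the first space.\<close>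

definition energy_class ::
    "real \<Rightarrow> (real \<Rightarrow> real^3 \<Rightarrow> real^3) \<Rightarrow> (real \<Rightarrow> real^3 \<Rightarrow> real^3^3) \<Rightarrow> bool"
  where "energy_class T v G \<longleftrightarrow>
    (\<lambda>(t, x). v t x) \<in> borel_measurable (space_time T) \<and>
    (\<exists>C::real. AE t\<in>{0<..<T} in lborel.
      (\<integral>\<^sup>+x. ennreal ((norm (v t x))\<^sup>2) \<partial>lborel) \<le> ennreal C) \<and>
    (AE t\<in>{0<..<T} in lborel. weak_gradient (v t) (G t)) \<and>
    in_Lp (space_time T) 2 (\<lambda>(t, x). G t x)"

text \<open>The momentum equation together with the initial condition, tested with functions that need not
  vanish at \<open>t = 0\<close>; \<open>v 0\<close> is the initial velocity. Incompressibility allows one to write the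
  convective term in divergence form.\<close>

definition momentum_equation ::
    "real \<Rightarrow> real \<Rightarrow> (real \<Rightarrow> real^3 \<Rightarrow> real^3) \<Rightarrow> (real \<Rightarrow> real^3 \<Rightarrow> real) \<Rightarrow> bool"
  where "momentum_equation \<nu> T v p \<longleftrightarrow>
    (\<forall>\<phi>. test_function ({..<T} \<times> UNIV) \<phi> \<longrightarrow>
      (LINT (t, x)|space_time T.
          (time_deriv \<phi> (t, x) + v t x \<bullet> space_grad \<phi> (t, x) + \<nu> * space_laplacian \<phi> (t, x)) *\<^sub>R v t x
          + p t x *\<^sub>R space_grad \<phi> (t, x))
      + (LINT x|lborel. \<phi> (0, x) *\<^sub>R v 0 x) = 0)"

definition energy_inequality ::
    "real \<Rightarrow> real \<Rightarrow> (real \<Rightarrow> real^3 \<Rightarrow> real^3) \<Rightarrow> (real \<Rightarrow> real^3 \<Rightarrow> real^3^3) \<Rightarrow> bool"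
  where "energy_inequality \<nu> T v G \<longleftrightarrow>
    (AE t\<in>{0<..<T} in lborel.
      (\<integral>\<^sup>+x. ennreal ((norm (v t x))\<^sup>2) \<partial>lborel)
      + ennreal (2 * \<nu>) * (\<integral>\<^sup>+\<tau>\<in>{0<..<t}. (\<integral>\<^sup>+x. ennreal ((norm (G \<tau> x))\<^sup>2) \<partial>lborel) \<partial>lborel)
      \<le> (\<integral>\<^sup>+x. ennreal ((norm (v 0 x))\<^sup>2) \<partial>lborel))"

definition local_energy_inequality ::
    "real \<Rightarrow> real \<Rightarrow> (real \<Rightarrow> real^3 \<Rightarrow> real^3) \<Rightarrow> (real \<Rightarrow> real^3 \<Rightarrow> real^3^3)
      \<Rightarrow> (real \<Rightarrow> real^3 \<Rightarrow> real) \<Rightarrow> bool"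
  where "local_energy_inequality \<nu> T v G p \<longleftrightarrow>
    (\<forall>\<phi>. test_function ({0<..<T} \<times> UNIV) \<phi> \<and> (\<forall>z. 0 \<le> \<phi> z) \<longrightarrow>
      2 * \<nu> * (LINT (t, x)|space_time T. (norm (G t x))\<^sup>2 * \<phi> (t, x))
      \<le> (LINT (t, x)|space_time T.
          (norm (v t x))\<^sup>2 * (time_deriv \<phi> (t, x) + \<nu> * space_laplacian \<phi> (t, x))
          + ((norm (v t x))\<^sup>2 + 2 * p t x) * (v t x \<bullet> space_grad \<phi> (t, x))))"

text \<open>The integrability exponent of the pressure is the one in the definition of
  Caffarelli, Kohn and Nirenberg.\<close>

definition suitable_weak_solution ::
    "real \<Rightarrow> real \<Rightarrow> (real \<Rightarrow> real^3 \<Rightarrow> real^3) \<Rightarrow> (real \<Rightarrow> real^3 \<Rightarrow> real) \<Rightarrow> bool"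
  where "suitable_weak_solution \<nu> T v p \<longleftrightarrow>
    in_Lp lborel 2 (v 0) \<and>
    in_Lp (space_time T) (5/4) (\<lambda>(t, x). p t x) \<and>
    (AE t\<in>{0<..<T} in lborel. weakly_divergence_free (v t)) \<and>
    momentum_equation \<nu> T v p \<and>
    (\<exists>G. energy_class T v G \<and> energy_inequality \<nu> T v G \<and> local_energy_inequality \<nu> T v G p)"

text \<open>\<open>\<omega> t\<close> is the vorticity of \<open>v t\<close> for \<open>t = 0\<close> and for almost every \<open>t\<close> in \<open>(0,T)\<close>.\<close>

definition vorticity ::
    "real \<Rightarrow> (real \<Rightarrow> real^3 \<Rightarrow> real^3) \<Rightarrow> (real \<Rightarrow> real^3 \<Rightarrow> real^3) \<Rightarrow> bool"
  where "vorticity T v \<omega> \<longleftrightarrow>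
    (\<lambda>(t, x). \<omega> t x) \<in> borel_measurable (space_time T) \<and>
    weak_curl (v 0) (\<omega> 0) \<and>
    (AE t\<in>{0<..<T} in lborel. weak_curl (v t) (\<omega> t))"

end

theory Submission
  imports Defs
begin

text \<open>
  The estimate holds for each time slice separately, and the constant \<open>1\<close> will do. Fix such a time and
  write \<open>r\<close> for the distance to the axis, \<open>s = r\<^sup>2\<close>, \<open>A = r v\<^sub>r\<close>, \<open>P = r \<partial>\<^sub>r A\<close>. Three identities hold almost
  everywhere. The vorticity is \<open>r \<omega>\<^sub>\<phi> = \<partial>\<^sub>z A - r \<partial>\<^sub>r v\<^sub>z\<close>; incompressibility together with axial symmetry
  gives \<open>s \<partial>\<^sub>z v\<^sub>z = - P\<close>; and axial symmetry alone gives \<open>e\<^sub>\<phi> \<bullet> \<nabla>v e\<^sub>\<phi> = v\<^sub>r / r\<close>, so that \<open>v\<^sub>r / r\<close>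
  is square integrable.

  For a formal proof multiply \<open>\<omega>\<^sub>\<phi>\<close> by \<open>\<partial>\<^sub>z v\<^sub>r\<close> and integrate with the weight \<open>1 / r\<close>. The mixed term
  \<open>- \<partial>\<^sub>r v\<^sub>z \<partial>\<^sub>z v\<^sub>r\<close> turns into \<open>- \<partial>\<^sub>z v\<^sub>z \<partial>\<^sub>r v\<^sub>r\<close> under integration by parts, and eliminating \<open>\<partial>\<^sub>z v\<^sub>z\<close> leaves squares:
  in the half plane \<open>(r, z)\<close>, after a positive term has been dropped,
  \<open>\<integral> \<omega>\<^sub>\<phi> \<partial>\<^sub>z v\<^sub>r \<ge> \<integral> \<bar>\<partial>\<^sub>z v\<^sub>r\<bar>\<^sup>2 + 1/2 \<integral> v\<^sub>r\<^sup>2 / r\<^sup>2\<close>.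
  Young's inequality absorbs \<open>\<partial>\<^sub>z v\<^sub>r\<close> and yields \<open>\<integral> v\<^sub>r\<^sup>2 / r\<^sup>2 \<le> 1/2 \<integral> \<omega>\<^sub>\<phi>\<^sup>2\<close>, which is the claim, since the
  volume element is \<open>2 \<pi> r dr dz\<close>.

  A weak solution is only \<open>H\<^sup>1\<close> in space, so the weight \<open>1 / r\<close> is regularized twice and becomes
  \<open>s\<^sup>2 wt e d s\<close>. The parameter \<open>e\<close> makes it bounded; the parameter \<open>d\<close> makes it vanish on the axis to
  such an order that all coefficients are smooth in Cartesian coordinates. By \<open>wt_coercive\<close> this
  costs only an error carried by a neighbourhood of the axis. The two integrations by parts are
  \<open>wedge_identity\<close> and \<open>square_identity\<close>. Both are instances of one product rule,
  \<open>weak_div_product\<close>, which is proved by mollification from the convergence \<open>pairing_tendsto\<close>.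
  In the resulting \<open>localized_estimate\<close> the cutoff and \<open>d\<close> are removed first: the axis error
  is dominated by \<open>v\<^sub>r\<^sup>2 / r\<^sup>2\<close>. Then \<open>e\<close> tends to \<open>0\<close> by Fatou's lemma.
\<close>

section \<open>Calculus of smooth functions\<close>

lemma dirderiv_eq: "(f has_derivative f') (at x) \<Longrightarrow> dirderiv d f x = f' d"
  unfolding dirderiv_def by (metis frechet_derivative_at)

lemma C_order_imp_continuous: "C_order n f \<Longrightarrow> continuous_on UNIV f"
  by (cases n) (auto intro!: differentiable_imp_continuous_on simp: differentiable_on_def)

lemma C_order_SucD: "C_order (Suc n) f \<Longrightarrow> C_order n f"
  by (induction n arbitrary: f)
     (auto intro!: differentiable_imp_continuous_on simp: differentiable_on_def)

lemma C_order_const: "C_order n (\<lambda>x. c)"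
proof (induction n arbitrary: c)
  case (Suc n)
  have "dirderiv b (\<lambda>x. c) = (\<lambda>x. 0)" for b :: 'a
    by (auto simp: dirderiv_def)
  then show ?case using Suc by simp
qed simp

lemma C_order_linear: "bounded_linear f \<Longrightarrow> C_order n f"
proof (cases n)
  case (Suc m)
  assume f: "bounded_linear f"
  have "dirderiv b f = (\<lambda>x. f b)" for b
    using f by (auto intro!: dirderiv_eq bounded_linear_imp_has_derivative)
  then show ?thesis
    using f Suc by (auto simp: C_order_const intro: bounded_linear_imp_differentiable)
qed (simp add: linear_continuous_on)

lemma dirderiv_add:
  assumes "f differentiable at x" "g differentiable at x"
  shows "dirderiv b (\<lambda>x. f x + g x) x = dirderiv b f x + dirderiv b g x"
  using assms unfolding frechet_derivative_works
  by (auto simp: dirderiv_def[of _ f] dirderiv_def[of _ g] intro!: dirderiv_eq derivative_eq_intros)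

lemma dirderiv_mult:
  assumes "f differentiable at x" "g differentiable at x"
  shows "dirderiv b (\<lambda>x. f x * g x) x = f x * dirderiv b g x + dirderiv b f x * g x"
  using assms unfolding frechet_derivative_works
  by (auto simp: dirderiv_def[of _ f] dirderiv_def[of _ g] intro!: dirderiv_eq derivative_eq_intros)

lemma dirderiv_chain:
  assumes "P differentiable at x" "(g has_real_derivative g') (at (P x))"
  shows "dirderiv b (\<lambda>x. g (P x)) x = g' * dirderiv b P x"
proof -
  have "((\<lambda>x. g (P x)) has_derivative (\<lambda>h. g' * frechet_derivative P (at x) h)) (at x)"
    using assms(1) assms(2) unfolding frechet_derivative_works has_field_derivative_def
    by (rule has_derivative_compose)
  then show ?thesis
    by (auto simp: dirderiv_def[of _ P] intro!: dirderiv_eq)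
qed

lemma C_order_add: "C_order n f \<Longrightarrow> C_order n g \<Longrightarrow> C_order n (\<lambda>x. f x + g x)"
proof (induction n arbitrary: f g)
  case (Suc n)
  have "dirderiv b (\<lambda>x. f x + g x) = (\<lambda>x. dirderiv b f x + dirderiv b g x)" for b
    using Suc.prems by (auto simp: dirderiv_add)
  moreover have "C_order n (\<lambda>x. dirderiv b f x + dirderiv b g x)" if "b \<in> Basis" for b
    by (rule Suc.IH) (use Suc.prems that in auto)
  moreover have "(\<lambda>x. f x + g x) differentiable at x" for x
    using Suc.prems by auto
  ultimately show ?case by simp
qed (auto intro: continuous_intros)

lemma C_order_mult: "C_order n f \<Longrightarrow> C_order n g \<Longrightarrow> C_order n (\<lambda>x. f x * g x)"
proof (induction n arbitrary: f g)
  case (Suc n)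
  have "dirderiv b (\<lambda>x. f x * g x) = (\<lambda>x. f x * dirderiv b g x + dirderiv b f x * g x)" for b
    using Suc.prems by (auto simp: dirderiv_mult)
  moreover have "C_order n f" "C_order n g"
    using Suc.prems by (auto simp del: C_order.simps intro: C_order_SucD)
  then have "C_order n (\<lambda>x. f x * dirderiv b g x + dirderiv b f x * g x)" if "b \<in> Basis" for b
    by (intro C_order_add Suc.IH) (use Suc.prems that in auto)
  moreover have "(\<lambda>x. f x * g x) differentiable at x" for x
    using Suc.prems by auto
  ultimately show ?case by simp
qed (auto intro: continuous_intros)

text \<open>All derivatives of \<open>g\<close> have to be given at once, as the sequence \<open>g k\<close>, because
  differentiating the composition replaces \<open>g k\<close> by \<open>g (Suc k)\<close>.\<close>

lemma C_order_compose:
  assumes g: "\<And>k t. t \<in> S \<Longrightarrow> (g k has_real_derivative g (Suc k) t) (at t)"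
    and P: "\<And>n. C_order n P" and S: "\<And>x. P x \<in> S"
  shows "C_order n (\<lambda>x. g k (P x))"
proof (induction n arbitrary: k)
  case 0
  have "continuous_on UNIV P" using P[of 0] by simp
  moreover have "continuous_on S (g k)"
    by (meson DERIV_continuous_on g has_field_derivative_at_within)
  ultimately show ?case
    using S by (auto intro!: continuous_on_compose2[of S "g k" UNIV P])
next
  case (Suc n)
  have P': "P differentiable at x" for x
    using P[of 1] by simp
  have "dirderiv b (\<lambda>x. g k (P x)) = (\<lambda>x. g (Suc k) (P x) * dirderiv b P x)" for b
    by (rule ext, rule dirderiv_chain[OF P' g[OF S]])
  moreover have "(\<lambda>x. g k (P x)) differentiable at x" for x
    using differentiable_chain_at[OF P', of "g k" x] g[OF S, of k x]
    by (auto simp: o_def real_differentiable_def)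
  moreover have "C_order n (dirderiv b P)" if "b \<in> Basis" for b
    using P[of "Suc n"] that by simp
  ultimately show ?case using Suc by (auto intro!: C_order_mult)
qed

lemma dirderiv_affine:
  assumes "f differentiable at (a + c *\<^sub>R x)"
  shows "dirderiv b (\<lambda>x. f (a + c *\<^sub>R x)) x = c * dirderiv b f (a + c *\<^sub>R x)"
proof -
  have lin: "linear (frechet_derivative f (at (a + c *\<^sub>R x)))"
    using assms by (rule linear_frechet_derivative)
  have "((\<lambda>x. f (a + c *\<^sub>R x)) has_derivative
      (\<lambda>h. frechet_derivative f (at (a + c *\<^sub>R x)) (c *\<^sub>R h))) (at x)"
    by (rule has_derivative_compose[of "\<lambda>x. a + c *\<^sub>R x"])
       (use assms in \<open>auto intro!: derivative_eq_intros simp: frechet_derivative_works\<close>)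
  then show ?thesis
    using lin by (auto dest!: dirderiv_eq[of _ _ _ b] simp: dirderiv_def[of _ f] linear_cmul)
qed

lemma C_order_affine: "C_order n f \<Longrightarrow> C_order n (\<lambda>x. f (a + c *\<^sub>R x))"
proof (induction n arbitrary: f)
  case 0
  then show ?case
    by (auto intro!: continuous_on_compose2[of UNIV f] continuous_intros)
next
  case (Suc n)
  have "dirderiv b (\<lambda>x. f (a + c *\<^sub>R x)) = (\<lambda>x. c * dirderiv b f (a + c *\<^sub>R x))" for b
    using Suc.prems by (auto simp: dirderiv_affine)
  moreover have "(\<lambda>x. f (a + c *\<^sub>R x)) differentiable at x" for x
    using Suc.prems differentiable_chain_at[of "\<lambda>x. a + c *\<^sub>R x" x f]
    by (auto simp: o_def intro!: derivative_intros)
  ultimately show ?case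
    using Suc by (auto intro!: C_order_mult C_order_const)
qed

lemma smooth_const [simp]: "smooth (\<lambda>x. c)"
  by (simp add: smooth_def C_order_const)

lemma smooth_add: "smooth f \<Longrightarrow> smooth g \<Longrightarrow> smooth (\<lambda>x. f x + g x)"
  by (simp add: smooth_def C_order_add)

lemma smooth_mult: "smooth f \<Longrightarrow> smooth g \<Longrightarrow> smooth (\<lambda>x. f x * g x)"
  by (simp add: smooth_def C_order_mult)

lemma smooth_diff: "smooth f \<Longrightarrow> smooth g \<Longrightarrow> smooth (\<lambda>x. f x - g x)"
  using smooth_add[of f "\<lambda>x. -1 * g x"] smooth_mult[of "\<lambda>x. -1" g] by simp

lemma smooth_linear: "bounded_linear f \<Longrightarrow> smooth f"
  by (simp add: smooth_def C_order_linear)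

lemma smooth_component [simp]: "smooth (\<lambda>x::real^'n. x $ i)"
  by (intro smooth_linear bounded_linear_vec_nth)

lemma smooth_power: "smooth f \<Longrightarrow> smooth (\<lambda>x. f x ^ n)"
  by (induction n) (auto intro: smooth_mult)

lemma smooth_compose:
  assumes "\<And>k t. t \<in> S \<Longrightarrow> (g k has_real_derivative g (Suc k) t) (at t)"
    and "smooth P" and "\<And>x. P x \<in> S"
  shows "smooth (\<lambda>x. g k (P x))"
  using C_order_compose[of S g P, OF assms(1) _ assms(3)] assms(2) unfolding smooth_def by blast

lemma smooth_affine: "smooth f \<Longrightarrow> smooth (\<lambda>x. f (a + c *\<^sub>R x))"
  by (simp add: smooth_def C_order_affine)

lemma smooth_dirderiv: "smooth f \<Longrightarrow> b \<in> Basis \<Longrightarrow> smooth (dirderiv b f)"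
  unfolding smooth_def by (metis C_order.simps(2))

lemma smooth_differentiable: "smooth f \<Longrightarrow> f differentiable at x"
  unfolding smooth_def by (metis C_order.simps(2))

lemma smooth_continuous: "smooth f \<Longrightarrow> continuous_on A f"
  unfolding smooth_def using C_order_imp_continuous continuous_on_subset by blast

lemma smooth_has_derivative:
  "smooth f \<Longrightarrow> (f has_derivative (\<lambda>d. dirderiv d f x)) (at x)"
  unfolding dirderiv_def using smooth_differentiable frechet_derivative_works by blast

text \<open>The second difference of \<open>f\<close> over a parallelogram with sides \<open>h a\<close> and \<open>h b\<close> is \<open>h\<^sup>2\<close> times a value
  of either mixed derivative, by the mean value theorem in each direction; \<open>h \<rightarrow> 0\<close> gives
  symmetry.\<close>

lemma smooth_second_difference:
  fixes f :: "'a::euclidean_space \<Rightarrow> real"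
  assumes f: "smooth f" and ab: "a \<in> Basis" "b \<in> Basis" and h: "0 < h"
  shows "\<exists>\<xi> \<eta>. 0 < \<xi> \<and> \<xi> < h \<and> 0 < \<eta> \<and> \<eta> < h \<and>
    f (x + h *\<^sub>R a + h *\<^sub>R b) - f (x + h *\<^sub>R a) - f (x + h *\<^sub>R b) + f x
      = h * h * dirderiv b (dirderiv a f) (x + \<xi> *\<^sub>R a + \<eta> *\<^sub>R b)"
proof -
  have D: "((\<lambda>\<sigma>. F (y + \<sigma> *\<^sub>R d)) has_real_derivative dirderiv d F (y + \<sigma> *\<^sub>R d)) (at \<sigma>)"
    if "smooth F" for F :: "'a \<Rightarrow> real" and y d \<sigma>
  proof -
    have "((\<lambda>\<sigma>. F (y + \<sigma> *\<^sub>R d)) has_derivative (\<lambda>\<tau>. dirderiv (\<tau> *\<^sub>R d) F (y + \<sigma> *\<^sub>R d))) (at \<sigma>)"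
      by (rule has_derivative_compose[OF _ smooth_has_derivative[OF that]])
         (auto intro!: derivative_eq_intros)
    moreover have "dirderiv (\<tau> *\<^sub>R d) F z = \<tau> * dirderiv d F z" for \<tau> z
      unfolding dirderiv_def
      using linear_cmul[OF linear_frechet_derivative[OF smooth_differentiable[OF that]], of z \<tau> d]
      by simp
    ultimately show ?thesis
      unfolding has_field_derivative_def by (simp add: mult_commute_abs)
  qed
  define u where "u \<sigma> = f (x + h *\<^sub>R b + \<sigma> *\<^sub>R a) - f (x + \<sigma> *\<^sub>R a)" for \<sigma>
  have "\<exists>\<xi>. 0 < \<xi> \<and> \<xi> < h \<and> u h - u 0 =
    (h - 0) * (dirderiv a f (x + h *\<^sub>R b + \<xi> *\<^sub>R a) - dirderiv a f (x + \<xi> *\<^sub>R a))"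
    unfolding u_def by (rule MVT2[OF h]) (intro DERIV_diff D f)
  then obtain \<xi> where \<xi>: "0 < \<xi>" "\<xi> < h" and 1: "u h - u 0 =
    h * (dirderiv a f (x + h *\<^sub>R b + \<xi> *\<^sub>R a) - dirderiv a f (x + \<xi> *\<^sub>R a))" by auto
  have "\<exists>\<eta>. 0 < \<eta> \<and> \<eta> < h \<and>
      dirderiv a f (x + \<xi> *\<^sub>R a + h *\<^sub>R b) - dirderiv a f (x + \<xi> *\<^sub>R a + 0 *\<^sub>R b)
      = (h - 0) * dirderiv b (dirderiv a f) (x + \<xi> *\<^sub>R a + \<eta> *\<^sub>R b)"
    by (rule MVT2[OF h]) (intro D smooth_dirderiv f ab)
  then obtain \<eta> where "0 < \<eta>" "\<eta> < h" and
    "dirderiv a f (x + \<xi> *\<^sub>R a + h *\<^sub>R b) - dirderiv a f (x + \<xi> *\<^sub>R a)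
      = h * dirderiv b (dirderiv a f) (x + \<xi> *\<^sub>R a + \<eta> *\<^sub>R b)" by auto
  with \<xi> 1 show ?thesis
    by (intro exI[of _ \<xi>] exI[of _ \<eta>]) (auto simp: u_def algebra_simps)
qed

text \<open>Every value of one mixed derivative near \<open>x\<close> that is produced by the second difference equals a
  value of the other one near \<open>x\<close>; continuity concludes.\<close>

lemma dirderiv_commute:
  fixes f :: "'a::euclidean_space \<Rightarrow> real"
  assumes f: "smooth f" and ab: "a \<in> Basis" "b \<in> Basis"
  shows "dirderiv b (dirderiv a f) x = dirderiv a (dirderiv b f) x"
proof -
  have lim: "(\<lambda>n. dirderiv d (dirderiv c f) (x + \<xi> n *\<^sub>R c + \<eta> n *\<^sub>R d))
      \<longlonglongrightarrow> dirderiv d (dirderiv c f) x"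
    if cd: "c \<in> Basis" "d \<in> Basis" and
      le: "\<And>n. 0 < \<xi> n \<and> \<xi> n < 1 / real (Suc n) \<and> 0 < \<eta> n \<and> \<eta> n < 1 / real (Suc n)"
    for c d and \<xi> \<eta> :: "nat \<Rightarrow> real"
  proof -
    have "\<xi> \<longlonglongrightarrow> 0"
      by (rule tendsto_sandwich[OF _ _ tendsto_const LIMSEQ_Suc[OF lim_1_over_n]])
         (use le in \<open>auto intro!: always_eventually less_imp_le\<close>)
    moreover have "\<eta> \<longlonglongrightarrow> 0"
      by (rule tendsto_sandwich[OF _ _ tendsto_const LIMSEQ_Suc[OF lim_1_over_n]])
         (use le in \<open>auto intro!: always_eventually less_imp_le\<close>)
    ultimately have "(\<lambda>n. x + \<xi> n *\<^sub>R c + \<eta> n *\<^sub>R d) \<longlonglongrightarrow> x + 0 *\<^sub>R c + 0 *\<^sub>R d"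
      by (intro tendsto_intros)
    then have "(\<lambda>n. x + \<xi> n *\<^sub>R c + \<eta> n *\<^sub>R d) \<longlonglongrightarrow> x" by simp
    moreover have "isCont (dirderiv d (dirderiv c f)) x"
      using smooth_continuous[OF smooth_dirderiv[OF smooth_dirderiv[OF f cd(1)] cd(2)], of UNIV]
      by (simp add: continuous_on_eq_continuous_at)
    ultimately show ?thesis by (rule isCont_tendsto_compose[rotated])
  qed
  have "\<forall>n. \<exists>\<xi> \<eta>. 0 < \<xi> \<and> \<xi> < 1 / real (Suc n) \<and> 0 < \<eta> \<and> \<eta> < 1 / real (Suc n) \<and>
      (\<exists>\<xi>' \<eta>'. 0 < \<xi>' \<and> \<xi>' < 1 / real (Suc n) \<and> 0 < \<eta>' \<and> \<eta>' < 1 / real (Suc n) \<and>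
      dirderiv b (dirderiv a f) (x + \<xi> *\<^sub>R a + \<eta> *\<^sub>R b)
      = dirderiv a (dirderiv b f) (x + \<xi>' *\<^sub>R b + \<eta>' *\<^sub>R a))"
  proof
    fix n
    have h: "0 < 1 / real (Suc n)" by simp
    obtain \<xi> \<eta> where 1: "0 < \<xi>" "\<xi> < 1 / real (Suc n)" "0 < \<eta>" "\<eta> < 1 / real (Suc n)"
      "f (x + (1 / real (Suc n)) *\<^sub>R a + (1 / real (Suc n)) *\<^sub>R b)
        - f (x + (1 / real (Suc n)) *\<^sub>R a) - f (x + (1 / real (Suc n)) *\<^sub>R b) + f x
      = (1 / real (Suc n)) * (1 / real (Suc n)) * dirderiv b (dirderiv a f) (x + \<xi> *\<^sub>R a + \<eta> *\<^sub>R b)"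
      using smooth_second_difference[OF f ab h, of x] by blast
    obtain \<xi>' \<eta>' where 2: "0 < \<xi>'" "\<xi>' < 1 / real (Suc n)" "0 < \<eta>'" "\<eta>' < 1 / real (Suc n)"
      "f (x + (1 / real (Suc n)) *\<^sub>R b + (1 / real (Suc n)) *\<^sub>R a)
        - f (x + (1 / real (Suc n)) *\<^sub>R b) - f (x + (1 / real (Suc n)) *\<^sub>R a) + f x
      = (1 / real (Suc n)) * (1 / real (Suc n)) * dirderiv a (dirderiv b f) (x + \<xi>' *\<^sub>R b + \<eta>' *\<^sub>R a)"
      using smooth_second_difference[OF f ab(2,1) h, of x] by blast
    have "(1 / real (Suc n)) * (1 / real (Suc n)) * dirderiv b (dirderiv a f) (x + \<xi> *\<^sub>R a + \<eta> *\<^sub>R b)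
      = (1 / real (Suc n)) * (1 / real (Suc n)) * dirderiv a (dirderiv b f) (x + \<xi>' *\<^sub>R b + \<eta>' *\<^sub>R a)"
      unfolding 1(5)[symmetric] 2(5)[symmetric] by (simp add: algebra_simps)
    then have "dirderiv b (dirderiv a f) (x + \<xi> *\<^sub>R a + \<eta> *\<^sub>R b)
      = dirderiv a (dirderiv b f) (x + \<xi>' *\<^sub>R b + \<eta>' *\<^sub>R a)" by simp
    with 1 2 show "\<exists>\<xi> \<eta>. 0 < \<xi> \<and> \<xi> < 1 / real (Suc n) \<and> 0 < \<eta> \<and> \<eta> < 1 / real (Suc n) \<and>
      (\<exists>\<xi>' \<eta>'. 0 < \<xi>' \<and> \<xi>' < 1 / real (Suc n) \<and> 0 < \<eta>' \<and> \<eta>' < 1 / real (Suc n) \<and>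
      dirderiv b (dirderiv a f) (x + \<xi> *\<^sub>R a + \<eta> *\<^sub>R b)
      = dirderiv a (dirderiv b f) (x + \<xi>' *\<^sub>R b + \<eta>' *\<^sub>R a))" by blast
  qed
  then obtain \<xi> \<eta> \<xi>' \<eta>' where
    1: "\<And>n. 0 < \<xi> n \<and> \<xi> n < 1 / real (Suc n) \<and> 0 < \<eta> n \<and> \<eta> n < 1 / real (Suc n)" and
    2: "\<And>n. 0 < \<xi>' n \<and> \<xi>' n < 1 / real (Suc n) \<and> 0 < \<eta>' n \<and> \<eta>' n < 1 / real (Suc n)" and
    eq: "\<And>n. dirderiv b (dirderiv a f) (x + \<xi> n *\<^sub>R a + \<eta> n *\<^sub>R b)
      = dirderiv a (dirderiv b f) (x + \<xi>' n *\<^sub>R b + \<eta>' n *\<^sub>R a)"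
    by metis
  show ?thesis
    using LIMSEQ_unique[OF lim[OF ab 1] lim[OF ab(2,1) 2, folded eq]] .
qed

lemma axis_in_Basis [simp]: "axis j (1::real) \<in> Basis"
  by (auto simp: Basis_vec_def)

lemma grad_nth: "grad f x $ j = dirderiv (axis j 1) f x"
  by (simp add: grad_def)

lemma grad_mult:
  assumes "smooth f" "smooth g"
  shows "grad (\<lambda>x. f x * g x) x = f x *\<^sub>R grad g x + g x *\<^sub>R grad f x"
  using assms by (auto simp: vec_eq_iff grad_nth dirderiv_mult smooth_differentiable)

lemma grad_add:
  assumes "smooth f" "smooth g"
  shows "grad (\<lambda>x. f x + g x) x = grad f x + grad g x"
  using assms by (auto simp: vec_eq_iff grad_nth dirderiv_add smooth_differentiable)

lemma grad_chain:
  assumes "smooth P" "(g has_real_derivative g') (at (P x))"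
  shows "grad (\<lambda>x. g (P x)) x = g' *\<^sub>R grad P x"
  using assms by (auto simp: vec_eq_iff grad_nth dirderiv_chain smooth_differentiable)

lemma grad_component [simp]: "grad (\<lambda>x. x $ i) x = axis i 1"
proof -
  have "dirderiv d (\<lambda>x. x $ i) x = d $ i" for d :: "real^3"
    by (rule dirderiv_eq) (rule bounded_linear_imp_has_derivative[OF bounded_linear_vec_nth])
  then show ?thesis by (simp add: vec_eq_iff grad_nth axis_def)
qed

lemma smooth_grad_nth: "smooth f \<Longrightarrow> smooth (\<lambda>x. grad f x $ j)"
  unfolding grad_nth by (intro smooth_dirderiv) auto

lemma grad_grad_commute:
  "smooth f \<Longrightarrow> grad (\<lambda>x. grad f x $ i) x $ j = grad (\<lambda>x. grad f x $ j) x $ i"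
  unfolding grad_nth by (intro dirderiv_commute) auto

lemma grad_has_derivative:
  assumes "smooth f" shows "(f has_derivative (\<lambda>d. grad f x \<bullet> d)) (at x)"
proof -
  have lin: "linear (\<lambda>d. dirderiv d f x)"
    unfolding dirderiv_def by (intro linear_frechet_derivative smooth_differentiable assms)
  have "dirderiv d f x = grad f x \<bullet> d" for d
  proof -
    have "dirderiv d f x = dirderiv (\<Sum>j\<in>UNIV. d $ j *\<^sub>R axis j 1) f x"
      by (simp add: basis_expansion flip: scalar_mult_eq_scaleR)
    also have "\<dots> = (\<Sum>j\<in>UNIV. d $ j * dirderiv (axis j 1) f x)"
      using linear_sum[OF lin, of "\<lambda>j. d $ j *\<^sub>R axis j 1" UNIV] linear_cmul[OF lin] by simp
    finally show ?thesis by (simp add: inner_vec_def grad_nth mult.commute)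
  qed
  then show ?thesis using smooth_has_derivative[OF assms, of x] by simp
qed

section \<open>Test functions, cutoffs and mollifiers\<close>

abbreviation test_fn :: "(real^3 \<Rightarrow> real) \<Rightarrow> bool" where "test_fn \<equiv> test_function UNIV"

lemma test_fn_smooth: "test_fn f \<Longrightarrow> smooth f"
  by (simp add: test_function_def)

lemma test_fn_support:
  assumes "test_fn f"
  obtains R where "R > 0" "\<And>x. norm x > R \<Longrightarrow> f x = 0"
proof -
  obtain K where K: "compact K" "\<And>x. x \<notin> K \<Longrightarrow> f x = 0"
    using assms by (auto simp: test_function_def)
  then obtain R where R: "R > 0" "\<forall>x\<in>K. norm x \<le> R"
    using compact_imp_bounded bounded_pos by metis
  show ?thesis by (rule that[OF R(1)]) (metis K(2) R(2) not_le)
qed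

lemma test_fnI: "smooth f \<Longrightarrow> (\<And>x. norm x > R \<Longrightarrow> f x = 0) \<Longrightarrow> test_fn f"
  unfolding test_function_def
  by (auto intro!: exI[of _ "cball 0 R"] simp: not_le)

lemma test_fn_mult: "smooth f \<Longrightarrow> test_fn g \<Longrightarrow> test_fn (\<lambda>x. f x * g x)"
  by (auto simp: test_function_def smooth_mult)

lemma test_fn_mult': "test_fn f \<Longrightarrow> smooth g \<Longrightarrow> test_fn (\<lambda>x. f x * g x)"
  by (auto simp: test_function_def smooth_mult)

lemma test_fn_reflect: "test_fn f \<Longrightarrow> test_fn (\<lambda>y. f (x - y))"
proof -
  assume f: "test_fn f"
  obtain R where R: "R > 0" "\<And>x. norm x > R \<Longrightarrow> f x = 0" using test_fn_support[OF f] by blast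
  show ?thesis
  proof (rule test_fnI[of _ "R + norm x"])
    show "smooth (\<lambda>y. f (x - y))" using smooth_affine[OF test_fn_smooth[OF f], of x "-1"] by simp
    show "f (x - y) = 0" if "R + norm x < norm y" for y
      using that norm_triangle_ineq2[of y x] by (intro R) (simp add: norm_minus_commute)
  qed
qed

lemma grad_outside:
  assumes "\<And>x. norm x > R \<Longrightarrow> f x = 0" "norm x > R" shows "grad f x = 0"
proof -
  have "(f has_derivative (\<lambda>d. 0)) (at x)"
  proof (rule has_derivative_transform_within_open)
    show "((\<lambda>x. 0::real) has_derivative (\<lambda>d. 0)) (at x)" by simp
    show "open {x::real^3. norm x > R}" by (intro open_Collect_less continuous_intros)
  qed (use assms in auto)
  then show ?thesis by (simp add: vec_eq_iff grad_nth dirderiv_eq)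
qed

lemma test_fn_grad_nth: "test_fn f \<Longrightarrow> test_fn (\<lambda>x. grad f x $ j)"
proof -
  assume f: "test_fn f"
  obtain R where R: "\<And>x. norm x > R \<Longrightarrow> f x = 0" using test_fn_support[OF f] by blast
  show ?thesis
    by (rule test_fnI[of _ R]) (auto intro: smooth_grad_nth test_fn_smooth f simp: grad_outside[OF R])
qed

lemma grad_reflect: "smooth f \<Longrightarrow> grad (\<lambda>y. f (x - y)) y = - grad f (x - y)"
  using dirderiv_affine[of f x "-1" y] by (simp add: vec_eq_iff grad_nth smooth_differentiable)

lemma grad_shift: "smooth f \<Longrightarrow> grad (\<lambda>x. f (x - y)) x = grad f (x - y)"
  using dirderiv_affine[of f "- y" 1 x] by (simp add: vec_eq_iff grad_nth smooth_differentiable)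

lemma smooth_shift: "smooth f \<Longrightarrow> smooth (\<lambda>x. f (x - y))"
  using smooth_affine[of f "- y" 1] by simp

lemma test_fn_bounded:
  assumes "test_fn f" obtains B where "B > 0" "\<And>x. \<bar>f x\<bar> \<le> B"
proof -
  obtain K where K: "compact K" "\<And>x. x \<notin> K \<Longrightarrow> f x = 0"
    using assms by (auto simp: test_function_def)
  have "compact (f ` K)"
    using K(1) smooth_continuous[OF test_fn_smooth[OF assms]] by (rule compact_continuous_image[rotated])
  then obtain B where "B > 0" "\<forall>y\<in>f ` K. norm y \<le> B"
    using compact_imp_bounded bounded_pos by metis
  then show ?thesis using K(2) by (metis abs_zero image_eqI less_imp_le real_norm_def that)
qed

text \<open>Differentiating \<open>p (1 / t) exp (- 1 / t)\<close> replaces \<open>p\<close> by \<open>y\<^sup>2 (p - p')\<close>, so that \<open>flat k\<close> below is the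
  derivative of order \<open>k\<close> of \<open>exp (- 1 / t)\<close>, extended by \<open>0\<close> to \<open>t \<le> 0\<close>.\<close>

primrec flat_poly :: "nat \<Rightarrow> real poly"
  where "flat_poly 0 = 1"
  | "flat_poly (Suc k) = [:0, 0, 1:] * (flat_poly k - pderiv (flat_poly k))"

definition flat :: "nat \<Rightarrow> real \<Rightarrow> real"
  where "flat k t = (if t \<le> 0 then 0 else poly (flat_poly k) (1 / t) * exp (- (1 / t)))"

lemma poly_exp_decay: "((\<lambda>y. poly p y * exp (- y)) \<longlongrightarrow> 0) (at_top :: real filter)"
proof -
  have "((\<lambda>y. \<Sum>i\<le>degree p. coeff p i * (y ^ i / exp y)) \<longlongrightarrow> (\<Sum>i\<le>degree p. coeff p i * 0)) at_top"
    by (intro tendsto_intros tendsto_power_div_exp_0)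
  then show ?thesis
    by (simp add: poly_altdef exp_minus sum_distrib_left divide_inverse mult_ac)
qed

lemma flat_has_derivative: "(flat k has_real_derivative flat (Suc k) t) (at t)"
proof -
  consider "t < 0" | "t > 0" | "t = 0" by linarith
  then show ?thesis
  proof cases
    case 1
    have "((\<lambda>t. 0) has_real_derivative 0) (at t)" by simp
    then have "(flat k has_real_derivative 0) (at t)"
      by (rule has_field_derivative_transform_within_open[of _ _ _ "{..<0}"])
         (use 1 in \<open>auto simp: flat_def\<close>)
    then show ?thesis using 1 by (simp add: flat_def)
  next
    case 2
    have "((\<lambda>t. poly (flat_poly k) (1 / t) * exp (- (1 / t))) has_real_derivative
        poly (flat_poly (Suc k)) (1 / t) * exp (- (1 / t))) (at t)"
      using 2 by (auto intro!: derivative_eq_intros DERIV_chain2[OF poly_DERIV]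
          simp: field_simps power2_eq_square)
    then have "(flat k has_real_derivative poly (flat_poly (Suc k)) (1 / t) * exp (- (1 / t))) (at t)"
      by (rule has_field_derivative_transform_within_open[of _ _ _ "{0<..}"])
         (use 2 in \<open>auto simp: flat_def\<close>)
    then show ?thesis using 2 by (simp add: flat_def)
  next
    case 3
    have "((\<lambda>h. (flat k (0 + h) - flat k 0) / h) \<longlongrightarrow> 0) (at 0)"
    proof (rule filterlim_split_at_real)
      show "((\<lambda>h. (flat k (0 + h) - flat k 0) / h) \<longlongrightarrow> 0) (at_left 0)"
        by (rule tendsto_eventually) (auto simp: flat_def eventually_at_filter)
      have "((\<lambda>h. poly ([:0, 1:] * flat_poly k) (inverse h) * exp (- (inverse h))) \<longlongrightarrow> 0) (at_right 0)"
        using poly_exp_decay filterlim_inverse_at_top_right by (rule filterlim_compose)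
      then show "((\<lambda>h. (flat k (0 + h) - flat k 0) / h) \<longlongrightarrow> 0) (at_right 0)"
        by (rule Lim_transform_eventually)
           (auto simp: flat_def eventually_at_filter divide_inverse mult_ac)
    qed
    then show ?thesis
      using 3 by (simp add: DERIV_def flat_def)
  qed
qed

lemma flat_zero [simp]: "t \<le> 0 \<Longrightarrow> flat k t = 0"
  by (simp add: flat_def)

lemma continuous_flat: "continuous_on A (flat k)"
  by (meson DERIV_continuous_on flat_has_derivative has_field_derivative_at_within)

text \<open>The factor \<open>exp 1\<close> makes the value at the origin \<open>1\<close>. Large radii serve as cutoffs, small radii,
  after normalization, as mollifiers.\<close>

definition bump :: "real \<Rightarrow> real^3 \<Rightarrow> real"
  where "bump R x = exp 1 * flat 0 (1 - (x \<bullet> x) / R\<^sup>2)"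

lemma smooth_inner_self: "smooth (\<lambda>x::real^3. x \<bullet> x)"
  unfolding inner_vec_def sum_3 by (auto intro!: smooth_add smooth_mult)

lemma grad_inner_self: "grad (\<lambda>x. x \<bullet> x) x = 2 *\<^sub>R x"
proof -
  have "dirderiv d (\<lambda>x. x \<bullet> x) x = 2 * (x \<bullet> d)" for d :: "real^3"
    by (rule dirderiv_eq) (auto intro!: derivative_eq_intros simp: inner_commute)
  then show ?thesis by (simp add: vec_eq_iff grad_nth inner_axis)
qed

lemma smooth_bump: "smooth (bump R)"
proof -
  have "smooth (\<lambda>x::real^3. flat 0 (1 - (x \<bullet> x) / R\<^sup>2))"
    by (rule smooth_compose[where S = UNIV])
       (use smooth_mult[OF smooth_inner_self smooth_const, of "1 / R\<^sup>2"] in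
         \<open>auto intro!: flat_has_derivative smooth_diff\<close>)
  then show ?thesis unfolding bump_def by (auto intro: smooth_mult)
qed

lemma bump_outside: "norm x \<ge> R \<Longrightarrow> R > 0 \<Longrightarrow> bump R x = 0"
  by (auto simp: bump_def field_simps power_mono simp flip: power2_norm_eq_inner intro!: flat_zero)

lemma test_fn_bump: "R > 0 \<Longrightarrow> test_fn (bump R)"
  by (rule test_fnI[of _ R]) (auto simp: smooth_bump bump_outside)

lemma bump_nonneg: "0 \<le> bump R x"
  by (auto simp: bump_def flat_def)

lemma bump_le_1: "bump R x \<le> 1"
proof -
  have "exp 1 * exp (- (1 / t)) \<le> 1" if "0 < t" "t \<le> 1" for t :: real
    using that by (simp flip: exp_add add: field_simps)
  then show ?thesis
    by (auto simp: bump_def flat_def)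
qed

lemma bump_pos: "norm x < R \<Longrightarrow> 0 < bump R x"
proof -
  assume x: "norm x < R"
  then have "R > 0" using norm_ge_zero[of x] by linarith
  moreover have "(norm x)\<^sup>2 < R\<^sup>2" using x by (intro power_strict_mono) auto
  ultimately have "(x \<bullet> x) / R\<^sup>2 < 1" by (simp flip: power2_norm_eq_inner)
  then show ?thesis by (simp add: bump_def flat_def)
qed

lemma bump_tendsto_1: "(\<lambda>n. bump (real (Suc n)) x) \<longlonglongrightarrow> 1"
proof -
  have "(\<lambda>n. 1 - (x \<bullet> x) * (1 / real (Suc n) * (1 / real (Suc n)))) \<longlonglongrightarrow> 1 - (x \<bullet> x) * (0 * 0)"
    by (intro tendsto_intros LIMSEQ_Suc[OF lim_1_over_n])
  then have "(\<lambda>n. flat 0 (1 - (x \<bullet> x) / (real (Suc n))\<^sup>2)) \<longlonglongrightarrow> flat 0 1"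
    by (intro continuous_on_tendsto_compose[OF continuous_flat[of UNIV]])
       (auto simp: power2_eq_square)
  then have "(\<lambda>n. exp 1 * flat 0 (1 - (x \<bullet> x) / (real (Suc n))\<^sup>2)) \<longlonglongrightarrow> exp 1 * flat 0 1"
    by (intro tendsto_intros)
  then show ?thesis by (simp add: bump_def flat_def flip: exp_add)
qed

text \<open>Scaling makes the constant independent of the radius.\<close>

lemma bump_grad_bound:
  obtains C where "C > 0" "\<And>R x. R > 0 \<Longrightarrow> norm (grad (bump R) x) \<le> C / R"
proof -
  have "compact (flat 1 ` {0..1})"
    by (intro compact_continuous_image continuous_flat) auto
  then obtain M where M: "M > 0" "\<forall>y\<in>flat 1 ` {0..1}. norm y \<le> M"
    using compact_imp_bounded bounded_pos by metis
  have M': "\<bar>flat 1 t\<bar> \<le> M" if "t \<le> 1" for t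
    using M that by (cases "t \<ge> 0") auto
  show ?thesis
  proof (rule that[of "2 * exp 1 * M"])
    fix R :: real and x :: "real^3" assume R: "R > 0"
    have "((\<lambda>t. exp 1 * flat 0 (1 - t / R\<^sup>2)) has_real_derivative
        exp 1 * (flat 1 (1 - (x \<bullet> x) / R\<^sup>2) * (0 - 1 / R\<^sup>2))) (at (x \<bullet> x))"
      using flat_has_derivative[of 0 "1 - (x \<bullet> x) / R\<^sup>2"]
      by (intro DERIV_cmult DERIV_chain2[of "flat 0"] DERIV_diff DERIV_cdivide DERIV_const DERIV_ident) simp
    from grad_chain[OF smooth_inner_self, OF this]
    have g: "grad (bump R) x = - ((2 * exp 1 * flat 1 (1 - (x \<bullet> x) / R\<^sup>2) / R\<^sup>2) *\<^sub>R x)"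
      by (simp add: bump_def[abs_def] grad_inner_self mult_ac)
    show "norm (grad (bump R) x) \<le> 2 * exp 1 * M / R"
    proof (cases "norm x \<le> R")
      case True
      have "norm (grad (bump R) x) = (2 * exp 1) * \<bar>flat 1 (1 - (x \<bullet> x) / R\<^sup>2)\<bar> * norm x / R\<^sup>2"
        unfolding g by (simp add: abs_mult)
      also have "\<dots> \<le> (2 * exp 1) * M * R / R\<^sup>2"
        using True M M' R by (intro divide_right_mono mult_mono mult_nonneg_nonneg) auto
      finally show ?thesis using R by (simp add: power2_eq_square)
    next
      case False
      then have "R\<^sup>2 \<le> (norm x)\<^sup>2" using R by (intro power_mono) auto
      then have "flat 1 (1 - (x \<bullet> x) / R\<^sup>2) = 0"
        using R by (intro flat_zero) (auto simp: field_simps simp flip: power2_norm_eq_inner)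
      then show ?thesis unfolding g using M R by simp
    qed
  qed (use M in auto)
qed

lemma test_fn_integrable: "test_fn f \<Longrightarrow> integrable lborel f"
proof -
  assume f: "test_fn f"
  obtain K where K: "compact K" "\<And>x. x \<notin> K \<Longrightarrow> f x = 0"
    using f by (auto simp: test_function_def)
  have "integrable lborel (\<lambda>x. indicator K x *\<^sub>R f x)"
    using K(1) smooth_continuous[OF test_fn_smooth[OF f]] by (intro borel_integrable_compact)
  moreover have "(\<lambda>x. indicator K x *\<^sub>R f x) = f"
    using K(2) by (auto simp: indicator_def fun_eq_iff)
  ultimately show ?thesis by simp
qed

lemma test_fn_measurable [measurable_dest]: "test_fn f \<Longrightarrow> f \<in> borel_measurable borel"
  using test_fn_integrable borel_measurable_integrable by fastforce

definition mollifier :: "nat \<Rightarrow> real^3 \<Rightarrow> real"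
  where "mollifier n x = bump (1 / real (Suc n)) x / (LINT x|lborel. bump (1 / real (Suc n)) x)"

lemma bump_integral_pos: "R > 0 \<Longrightarrow> 0 < (LINT x|lborel. bump R x)"
proof -
  assume R: "R > 0"
  have int: "integrable lborel (bump R)" by (intro test_fn_integrable test_fn_bump R)
  have "\<not> (AE x in lborel. bump R x = 0)"
  proof
    assume "AE x in lborel. bump R x = 0"
    then have "AE x in lborel. x \<notin> ball (0::real^3) R"
      by eventually_elim (use bump_pos in fastforce)
    then have "ball (0::real^3) R \<in> null_sets lborel"
      by (subst (asm) AE_iff_null_sets[symmetric]) auto
    then have "emeasure lborel (ball (0::real^3) R) = 0" by auto
    moreover have "emeasure lborel (ball (0::real^3) R) > 0"
      using R by (metis \<open>ball 0 R \<in> null_sets lborel\<close> ball_eq_empty not_less null_sets_completionI open_ball open_not_negligible negligible_iff_null_sets)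
    ultimately show False by simp
  qed
  moreover have "(LINT x|lborel. bump R x) \<ge> 0"
    by (intro Bochner_Integration.integral_nonneg) (auto simp: bump_nonneg)
  moreover have "(LINT x|lborel. bump R x) = 0 \<longleftrightarrow> (AE x in lborel. bump R x = 0)"
    by (intro integral_nonneg_eq_0_iff_AE int) (auto simp: bump_nonneg)
  ultimately show ?thesis by auto
qed

lemma test_fn_mollifier: "test_fn (mollifier n)"
proof -
  have "test_fn (\<lambda>x. (1 / (LINT x|lborel. bump (1 / real (Suc n)) x)) * bump (1 / real (Suc n)) x)"
    by (intro test_fn_mult test_fn_bump) auto
  then show ?thesis by (simp add: mollifier_def[abs_def])
qed

lemma mollifier_nonneg: "0 \<le> mollifier n x"
  unfolding mollifier_def using bump_integral_pos[of "1 / real (Suc n)"]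
  by (intro divide_nonneg_nonneg bump_nonneg) auto

lemma mollifier_outside: "norm x \<ge> 1 / real (Suc n) \<Longrightarrow> mollifier n x = 0"
  unfolding mollifier_def using bump_outside[of "1 / real (Suc n)" x] by simp

lemma mollifier_integral: "(LINT x|lborel. mollifier n x) = 1"
  unfolding mollifier_def using bump_integral_pos[of "1 / real (Suc n)"] by simp

section \<open>Mollification in the space of square integrable functions\<close>

definition L2 :: "(real^3 \<Rightarrow> real) \<Rightarrow> bool"
  where "L2 f \<longleftrightarrow> f \<in> borel_measurable borel \<and> integrable lborel (\<lambda>x. (f x)\<^sup>2)"

text \<open>Balls around the origin exhaust the compact sets.\<close>

definition locL2 :: "(real^3 \<Rightarrow> real) \<Rightarrow> bool"
  where "locL2 f \<longleftrightarrow> f \<in> borel_measurable borel \<and> (\<forall>R. L2 (\<lambda>x. indicator (cball 0 R) x * f x))"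

lemma L2_measurable [measurable_dest]: "L2 f \<Longrightarrow> f \<in> borel_measurable borel"
  by (simp add: L2_def)

lemma L2_dominated:
  assumes "f \<in> borel_measurable borel" "L2 g" "\<And>x. \<bar>f x\<bar> \<le> c * \<bar>g x\<bar>"
  shows "L2 f"
proof -
  have "integrable lborel (\<lambda>x. (f x)\<^sup>2)"
  proof (rule Bochner_Integration.integrable_bound)
    show "integrable lborel (\<lambda>x. c\<^sup>2 * (g x)\<^sup>2)" using assms(2) by (simp add: L2_def)
    have "(f x)\<^sup>2 \<le> c\<^sup>2 * (g x)\<^sup>2" for x
      using power_mono[OF assms(3)[of x], of 2] by (simp add: power_mult_distrib)
    then show "AE x in lborel. norm ((f x)\<^sup>2) \<le> norm (c\<^sup>2 * (g x)\<^sup>2)" by simp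
  qed (use assms(1) in measurable)
  with assms(1) show ?thesis by (simp add: L2_def)
qed

lemma L2_mult_integrable:
  assumes "L2 f" "L2 g" shows "integrable lborel (\<lambda>x. f x * g x)"
proof (rule Bochner_Integration.integrable_bound)
  show "integrable lborel (\<lambda>x. (f x)\<^sup>2 + (g x)\<^sup>2)" using assms by (auto simp: L2_def)
  have "\<bar>f x * g x\<bar> \<le> (f x)\<^sup>2 + (g x)\<^sup>2" for x
  proof -
    have "2 * (\<bar>f x\<bar> * \<bar>g x\<bar>) \<le> (f x)\<^sup>2 + (g x)\<^sup>2"
      using zero_le_power2[of "\<bar>f x\<bar> - \<bar>g x\<bar>"] by (simp add: power2_diff)
    moreover have "0 \<le> \<bar>f x\<bar> * \<bar>g x\<bar>" by simp
    ultimately show ?thesis unfolding abs_mult by linarith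
  qed
  then show "AE x in lborel. norm (f x * g x) \<le> norm ((f x)\<^sup>2 + (g x)\<^sup>2)" by simp
qed (use assms in \<open>auto dest!: L2_measurable\<close>)

lemma L2_add: assumes "L2 f" "L2 g" shows "L2 (\<lambda>x. f x + g x)"
proof -
  have "integrable lborel (\<lambda>x. (f x)\<^sup>2 + (g x)\<^sup>2 + 2 * (f x * g x))"
    using assms L2_mult_integrable[OF assms] by (auto simp: L2_def)
  then show ?thesis using assms by (auto simp: L2_def power2_sum mult.assoc)
qed

lemma L2_cmult: "L2 f \<Longrightarrow> L2 (\<lambda>x. c * f x)"
  by (rule L2_dominated[of _ f "\<bar>c\<bar>"]) (auto dest: L2_measurable simp: abs_mult)

lemma L2_diff: "L2 f \<Longrightarrow> L2 g \<Longrightarrow> L2 (\<lambda>x. f x - g x)"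
  using L2_add[of f "\<lambda>x. -1 * g x"] L2_cmult[of g "-1"] by simp

definition clip :: "real \<Rightarrow> real \<Rightarrow> real" where "clip c t = max (- c) (min c t)"

text \<open>Truncating \<open>q\<close> in height and support costs little in \<open>L\<^sup>2\<close>; a truncated function is an almost
  everywhere limit of continuous functions, which may be truncated in the same way, and
  dominated convergence applies.\<close>

lemma L2_approx_continuous:
  assumes q: "L2 q" and \<epsilon>: "\<epsilon> > 0"
  obtains g R where "continuous_on UNIV g" "\<And>x. norm x > R \<Longrightarrow> g x = 0" "L2 g"
    "(LINT x|lborel. (q x - g x)\<^sup>2) < \<epsilon>"
proof -
  have [measurable]: "q \<in> borel_measurable borel" using q by (rule L2_measurable)
  have q2: "integrable lborel (\<lambda>x. (q x)\<^sup>2)" using q by (simp add: L2_def)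
  have cont_clip: "continuous_on UNIV (clip c)" for c
    unfolding clip_def by (intro continuous_intros)
  have cut: "continuous_on UNIV (\<lambda>x. clip c (g x) * bump R x)" if "continuous_on UNIV g" for c R and g :: "real^3 \<Rightarrow> real"
    by (intro continuous_intros continuous_on_compose2[OF cont_clip that] smooth_continuous smooth_bump) auto
  let ?b = "\<lambda>n. bump (real (Suc n))"
  have [measurable]: "?b n \<in> borel_measurable borel" for n
    by (rule test_fn_measurable[OF test_fn_bump]) simp
  have clip_le: "\<bar>clip c t\<bar> \<le> \<bar>t\<bar>" if "c \<ge> 0" for c t
    using that by (auto simp: clip_def)
  have [measurable]: "clip c \<in> borel_measurable borel" for c
    by (intro borel_measurable_continuous_onI cont_clip)
  define q' where "q' n x = clip (real n) (q x) * ?b n x" for n x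
  have [measurable]: "q' n \<in> borel_measurable borel" for n unfolding q'_def by measurable
  have q'_le: "\<bar>q' n x\<bar> \<le> \<bar>q x\<bar>" for n x
    using mult_mono[OF clip_le[of "real n" "q x"] bump_le_1[of "real (Suc n)" x]]
    by (simp add: q'_def abs_mult bump_nonneg)
  have "(\<lambda>n. LINT x|lborel. (q x - q' n x)\<^sup>2) \<longlonglongrightarrow> (LINT x::real^3|lborel. 0)"
  proof (rule integral_dominated_convergence)
    show "integrable lborel (\<lambda>x. 4 * (q x)\<^sup>2)" using q2 by simp
    show "AE x in lborel. (\<lambda>n. (q x - q' n x)\<^sup>2) \<longlonglongrightarrow> 0"
    proof (intro AE_I2)
      fix x
      have "(\<lambda>n. clip (real n) (q x)) \<longlonglongrightarrow> q x"
      proof (rule tendsto_eventually)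
        obtain N where "\<bar>q x\<bar> \<le> real N" using real_arch_simple by blast
        then show "\<forall>\<^sub>F n in sequentially. clip (real n) (q x) = q x"
          by (intro eventually_sequentiallyI[of N]) (auto simp: clip_def)
      qed
      then have "(\<lambda>n. (q x - q' n x)\<^sup>2) \<longlonglongrightarrow> (q x - q x * 1)\<^sup>2"
        unfolding q'_def by (intro tendsto_intros bump_tendsto_1)
      then show "(\<lambda>n. (q x - q' n x)\<^sup>2) \<longlonglongrightarrow> 0" by simp
    qed
    have "(q x - q' n x)\<^sup>2 \<le> 4 * (q x)\<^sup>2" for n x
    proof -
      have "\<bar>q x - q' n x\<bar> \<le> 2 * \<bar>q x\<bar>" using q'_le[of n x] by linarith
      from power_mono[OF this, of 2] show ?thesis by (simp add: power_mult_distrib)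
    qed
    then show "AE x in lborel. norm ((q x - q' n x)\<^sup>2) \<le> 4 * (q x)\<^sup>2" for n by simp
  qed measurable
  then have "(\<lambda>n. LINT x|lborel. (q x - q' n x)\<^sup>2) \<longlonglongrightarrow> 0" by simp
  then have "\<forall>\<^sub>F n in sequentially. (LINT x|lborel. (q x - q' n x)\<^sup>2) < \<epsilon> / 4"
    using \<epsilon> by (intro order_tendstoD) auto
  then obtain n where n: "(LINT x|lborel. (q x - q' n x)\<^sup>2) < \<epsilon> / 4"
    by (auto simp: eventually_sequentially)
  have "q measurable_on UNIV"
    by (rule lebesgue_measurable_imp_measurable_on) (auto intro: measurable_completion)
  then obtain N g where N: "negligible N" and g: "\<And>k. continuous_on UNIV (g k)"
    and lim: "\<And>x. x \<notin> N \<Longrightarrow> (\<lambda>k. g k x) \<longlonglongrightarrow> q x"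
    by (auto simp: measurable_on_def)
  define g' where "g' k x = clip (real n) (g k x) * ?b n x" for k x
  have g'_cont: "continuous_on UNIV (g' k)" for k
    unfolding g'_def by (intro cut g)
  then have [measurable]: "g' k \<in> borel_measurable borel" for k
    by (intro borel_measurable_continuous_onI)
  have le: "\<bar>clip (real n) t * ?b n x\<bar> \<le> real n * indicator (cball 0 (real (Suc n))) x" for t and x :: "real^3"
  proof (cases "norm x \<le> real (Suc n)")
    case True
    have "\<bar>clip (real n) t\<bar> * \<bar>?b n x\<bar> \<le> real n * 1"
      by (intro mult_mono) (auto simp: clip_def bump_le_1 bump_nonneg)
    then show ?thesis using True by (simp add: abs_mult)
  next
    case False
    then show ?thesis by (simp add: bump_outside)
  qed
  have dom: "integrable lborel (\<lambda>x. 4 * (real n)\<^sup>2 * indicator (cball (0::real^3) (real (Suc n))) x)"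
    by (intro integrable_mult_right integrable_real_indicator) (use emeasure_lborel_cball_finite[of "0::real^3" "real (Suc n)"] in auto)
  have "(\<lambda>k. LINT x|lborel. (q' n x - g' k x)\<^sup>2) \<longlonglongrightarrow> (LINT x::real^3|lborel. 0)"
  proof (rule integral_dominated_convergence[OF _ _ dom])
    have "AE x in lebesgue. x \<notin> N"
      using N by (metis AE_not_in negligible_iff_null_sets)
    then have "AE x in lborel. x \<notin> N"
      by (simp add: AE_completion_iff)
    then show "AE x in lborel. (\<lambda>k. (q' n x - g' k x)\<^sup>2) \<longlonglongrightarrow> 0"
    proof eventually_elim
      case (elim x)
      have "(\<lambda>k. clip (real n) (g k x)) \<longlonglongrightarrow> clip (real n) (q x)"
        by (rule continuous_on_tendsto_compose[OF cont_clip lim[OF elim]]) auto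
      then have "(\<lambda>k. (q' n x - g' k x)\<^sup>2) \<longlonglongrightarrow> (q' n x - q' n x)\<^sup>2"
        unfolding g'_def q'_def by (intro tendsto_intros)
      then show ?case by simp
    qed
    have "(q' n x - g' k x)\<^sup>2 \<le> 4 * (real n)\<^sup>2 * indicator (cball 0 (real (Suc n))) x" for k x
    proof -
      have "\<bar>q' n x - g' k x\<bar> \<le> 2 * (real n * indicator (cball 0 (real (Suc n))) x)"
        using le[of "q x" x] le[of "g k x" x] unfolding q'_def g'_def by linarith
      from power_mono[OF this, of 2] show ?thesis
        by (cases "x \<in> cball 0 (real (Suc n))") (auto simp: power_mult_distrib)
    qed
    then show "AE x in lborel. norm ((q' n x - g' k x)\<^sup>2)
        \<le> 4 * (real n)\<^sup>2 * indicator (cball 0 (real (Suc n))) x" for k by simp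
  qed measurable
  then have "(\<lambda>k. LINT x|lborel. (q' n x - g' k x)\<^sup>2) \<longlonglongrightarrow> 0" by simp
  then have "\<forall>\<^sub>F k in sequentially. (LINT x|lborel. (q' n x - g' k x)\<^sup>2) < \<epsilon> / 4"
    using \<epsilon> by (intro order_tendstoD) auto
  then obtain k where k: "(LINT x|lborel. (q' n x - g' k x)\<^sup>2) < \<epsilon> / 4"
    by (auto simp: eventually_sequentially)
  have L2q': "L2 (q' n)" by (rule L2_dominated[OF _ q, of _ 1]) (use q'_le in auto)
  have "integrable lborel (\<lambda>x. (g' k x)\<^sup>2)"
  proof (rule Bochner_Integration.integrable_bound[OF dom])
    have "(g' k x)\<^sup>2 \<le> 4 * (real n)\<^sup>2 * indicator (cball 0 (real (Suc n))) x" for x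
    proof -
      have "(g' k x)\<^sup>2 \<le> 1 * (real n)\<^sup>2 * indicator (cball 0 (real (Suc n))) x"
        using power_mono[OF le[of "g k x" x], of 2] unfolding g'_def
        by (cases "x \<in> cball 0 (real (Suc n))") (auto simp: power_mult_distrib)
      also have "\<dots> \<le> 4 * (real n)\<^sup>2 * indicator (cball 0 (real (Suc n))) x"
        by (intro mult_right_mono) auto
      finally show ?thesis .
    qed
    then show "AE x in lborel. norm ((g' k x)\<^sup>2) \<le> norm (4 * (real n)\<^sup>2 * indicator (cball 0 (real (Suc n))) x)"
      by auto
  qed measurable
  then have L2g': "L2 (g' k)" by (simp add: L2_def)
  have i1: "integrable lborel (\<lambda>x. (q x - q' n x)\<^sup>2)" "integrable lborel (\<lambda>x. (q' n x - g' k x)\<^sup>2)"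
      "integrable lborel (\<lambda>x. (q x - g' k x)\<^sup>2)"
    using L2_diff[OF q L2q'] L2_diff[OF L2q' L2g'] L2_diff[OF q L2g'] by (auto simp: L2_def)
  have "(LINT x|lborel. (q x - g' k x)\<^sup>2)
      \<le> (LINT x|lborel. 2 * (q x - q' n x)\<^sup>2 + 2 * (q' n x - g' k x)\<^sup>2)"
  proof (rule integral_mono)
    fix x
    have "(u + w)\<^sup>2 \<le> 2 * u\<^sup>2 + 2 * w\<^sup>2" for u w :: real
      using zero_le_power2[of "u - w"] by (simp add: power2_sum power2_diff)
    from this[of "q x - q' n x" "q' n x - g' k x"]
    show "(q x - g' k x)\<^sup>2 \<le> 2 * (q x - q' n x)\<^sup>2 + 2 * (q' n x - g' k x)\<^sup>2" by simp
  qed (use i1 in auto)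
  also have "\<dots> = 2 * (LINT x|lborel. (q x - q' n x)\<^sup>2) + 2 * (LINT x|lborel. (q' n x - g' k x)\<^sup>2)"
    using i1 by simp
  also have "\<dots> < \<epsilon>" using n k by linarith
  finally show ?thesis
    by (intro that[OF g'_cont _ L2g', of "real (Suc n)"]) (auto simp: g'_def bump_outside)
qed

lemma lborel_reflect:
  fixes k :: "'a::euclidean_space \<Rightarrow> real"
  assumes [measurable]: "k \<in> borel_measurable borel"
  shows "(LINT y|lborel. k (x - y)) = (LINT y|lborel. k y)"
    and "integrable lborel (\<lambda>y. k (x - y)) \<longleftrightarrow> integrable lborel k"
proof -
  have *: "distr lborel borel (\<lambda>y::'a. x - y) = lborel"
    using lborel_affine[of "-1" x] by (simp add: density_1)
  have "integral\<^sup>L (distr lborel borel (\<lambda>y::'a. x - y)) k = (LINT y|lborel. k (x - y))"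
    by (rule integral_distr) auto
  then show "(LINT y|lborel. k (x - y)) = (LINT y|lborel. k y)" using * by simp
  have "integrable (distr lborel borel (\<lambda>y::'a. x - y)) k \<longleftrightarrow> integrable lborel (\<lambda>y. k (x - y))"
    by (rule integrable_distr_eq) auto
  then show "integrable lborel (\<lambda>y. k (x - y)) \<longleftrightarrow> integrable lborel k" using * by simp
qed

lemma integrable_convolution_fst:
  fixes f k :: "real^3 \<Rightarrow> real"
  assumes f: "integrable lborel f" and k: "integrable lborel k"
  shows "integrable (lborel \<Otimes>\<^sub>M lborel) (\<lambda>(x, y). f x * k (x - y))"
    and "(LINT z|(lborel \<Otimes>\<^sub>M lborel). f (fst z) * k (fst z - snd z))
      = (LINT x|lborel. f x) * (LINT x|lborel. k x)"
proof -
  have [measurable]: "f \<in> borel_measurable borel" "k \<in> borel_measurable borel"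
    using f k by (auto dest: borel_measurable_integrable)
  have in1: "(LINT y|lborel. \<bar>f x * k (x - y)\<bar>) = \<bar>f x\<bar> * (LINT y|lborel. \<bar>k y\<bar>)" for x
    using lborel_reflect(1)[of "\<lambda>y. \<bar>k y\<bar>" x] by (simp add: abs_mult)
  show int: "integrable (lborel \<Otimes>\<^sub>M lborel) (\<lambda>(x, y). f x * k (x - y))"
  proof (rule lborel_pair.Fubini_integrable)
    show "integrable lborel (\<lambda>x. LINT y|lborel. norm (case (x, y) of (x, y) \<Rightarrow> f x * k (x - y)))"
      using f by (simp add: in1 del: abs_mult)
    show "AE x in lborel. integrable lborel (\<lambda>y. case (x, y) of (x, y) \<Rightarrow> f x * k (x - y))"
      using k lborel_reflect(2)[of k] by auto
  qed measurable
  have "(LINT z|(lborel \<Otimes>\<^sub>M lborel). f (fst z) * k (fst z - snd z))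
      = (LINT x|lborel. LINT y|lborel. f x * k (x - y))"
    using lborel_pair.integral_fst[OF int] by (simp add: case_prod_beta')
  also have "\<dots> = (LINT x|lborel. f x) * (LINT x|lborel. k x)"
    using lborel_reflect(1)[of k] by simp
  finally show "(LINT z|(lborel \<Otimes>\<^sub>M lborel). f (fst z) * k (fst z - snd z))
      = (LINT x|lborel. f x) * (LINT x|lborel. k x)" .
qed

lemma integrable_convolution_snd:
  fixes f k :: "real^3 \<Rightarrow> real"
  assumes f: "integrable lborel f" and k: "integrable lborel k"
  shows "integrable (lborel \<Otimes>\<^sub>M lborel) (\<lambda>(x, y). f y * k (x - y))"
    and "(LINT z|(lborel \<Otimes>\<^sub>M lborel). f (snd z) * k (fst z - snd z))
      = (LINT x|lborel. f x) * (LINT x|lborel. k x)"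
proof -
  have [measurable]: "f \<in> borel_measurable borel" "k \<in> borel_measurable borel"
    using f k by (auto dest: borel_measurable_integrable)
  define k' where "k' z = k (- z)" for z
  have k': "integrable lborel k'" "(LINT x|lborel. k' x) = (LINT x|lborel. k x)"
    using lborel_reflect[of k 0] k by (auto simp: k'_def[abs_def])
  have *: "integrable (lborel \<Otimes>\<^sub>M lborel) (\<lambda>(x, y). f x * k' (x - y))"
    by (rule integrable_convolution_fst(1)[OF f k'(1)])
  show int: "integrable (lborel \<Otimes>\<^sub>M lborel) (\<lambda>(x, y). f y * k (x - y))"
    using lborel_pair.integrable_product_swap[OF *] by (simp add: k'_def case_prod_beta')
  show "(LINT z|(lborel \<Otimes>\<^sub>M lborel). f (snd z) * k (fst z - snd z))
      = (LINT x|lborel. f x) * (LINT x|lborel. k x)"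
    using lborel_pair.integral_product_swap[of "\<lambda>(x, y). f x * k' (x - y)"] * k'(2)
      integrable_convolution_fst(2)[OF f k'(1)]
    by (auto simp: case_prod_beta' k'_def dest!: borel_measurable_integrable)
qed

text \<open>As \<open>k\<close> approaches a point mass, this bilinear form approaches \<open>\<integral> p q\<close>. Mollified functions
  enter the argument only through it.\<close>

definition pairing :: "(real^3 \<Rightarrow> real) \<Rightarrow> (real^3 \<Rightarrow> real) \<Rightarrow> (real^3 \<Rightarrow> real) \<Rightarrow> real"
  where "pairing k p q = (LINT x|lborel. p x * (LINT y|lborel. q y * k (x - y)))"

lemma young_ineq: "\<bar>a * b * c\<bar> \<le> \<kappa> / 2 * (a\<^sup>2 * \<bar>c\<bar>) + 1 / (2 * \<kappa>) * (b\<^sup>2 * \<bar>c\<bar>)"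
  if "\<kappa> > 0" for a b c \<kappa> :: real
proof -
  have "0 \<le> (\<kappa> * \<bar>a\<bar> - \<bar>b\<bar>)\<^sup>2 / (2 * \<kappa>)" using that by simp
  also have "\<dots> = \<kappa> / 2 * a\<^sup>2 + 1 / (2 * \<kappa>) * b\<^sup>2 - \<bar>a\<bar> * \<bar>b\<bar>"
    using that by (simp add: power2_diff field_simps power2_eq_square)
  finally have "\<bar>a\<bar> * \<bar>b\<bar> \<le> \<kappa> / 2 * a\<^sup>2 + 1 / (2 * \<kappa>) * b\<^sup>2" by simp
  from mult_right_mono[OF this, of "\<bar>c\<bar>"] show ?thesis
    by (simp add: abs_mult algebra_simps)
qed

lemma pairing_integrable:
  assumes "L2 p" "L2 q" "integrable lborel k"
  shows "integrable (lborel \<Otimes>\<^sub>M lborel) (\<lambda>(x, y). p x * q y * k (x - y))"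
proof (rule Bochner_Integration.integrable_bound)
  have [measurable]: "k \<in> borel_measurable borel" "p \<in> borel_measurable borel" "q \<in> borel_measurable borel"
    using assms by (auto dest: borel_measurable_integrable simp: L2_def)
  have "integrable (lborel \<Otimes>\<^sub>M lborel) (\<lambda>(x, y). (p x)\<^sup>2 * \<bar>k (x - y)\<bar>)"
    "integrable (lborel \<Otimes>\<^sub>M lborel) (\<lambda>(x, y). (q y)\<^sup>2 * \<bar>k (x - y)\<bar>)"
    using integrable_convolution_fst(1)[of "\<lambda>x. (p x)\<^sup>2" "\<lambda>x. \<bar>k x\<bar>"]
      integrable_convolution_snd(1)[of "\<lambda>x. (q x)\<^sup>2" "\<lambda>x. \<bar>k x\<bar>"] assms by (auto simp: L2_def)
  then show "integrable (lborel \<Otimes>\<^sub>M lborel)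
      (\<lambda>z. 1 / 2 * ((p (fst z))\<^sup>2 * \<bar>k (fst z - snd z)\<bar>) + 1 / (2 * 1) * ((q (snd z))\<^sup>2 * \<bar>k (fst z - snd z)\<bar>))"
    unfolding case_prod_beta' by (intro Bochner_Integration.integrable_add integrable_mult_right)
  show "AE z in lborel \<Otimes>\<^sub>M lborel. norm (case z of (x, y) \<Rightarrow> p x * q y * k (x - y))
      \<le> norm (1 / 2 * ((p (fst z))\<^sup>2 * \<bar>k (fst z - snd z)\<bar>) + 1 / (2 * 1) * ((q (snd z))\<^sup>2 * \<bar>k (fst z - snd z)\<bar>))"
    using young_ineq[of 1] by (auto simp: case_prod_beta' simp del: times_divide_eq_left intro: order.trans[OF _ abs_ge_self])
  show "(\<lambda>(x, y). p x * q y * k (x - y)) \<in> borel_measurable (lborel \<Otimes>\<^sub>M lborel)" by measurable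
qed

lemma pairing_Fubini:
  assumes "L2 p" "L2 q" "integrable lborel k"
  shows "pairing k p q = (LINT z|(lborel \<Otimes>\<^sub>M lborel). p (fst z) * q (snd z) * k (fst z - snd z))"
    and "pairing k p q = (LINT y|lborel. q y * (LINT x|lborel. p x * k (x - y)))"
proof -
  note int = pairing_integrable[OF assms]
  have 1: "(LINT y|lborel. p x * q y * k (x - y)) = p x * (LINT y|lborel. q y * k (x - y))" for x
    by (simp add: mult.assoc)
  have 2: "(LINT x|lborel. p x * q y * k (x - y)) = q y * (LINT x|lborel. p x * k (x - y))" for y
    by (subst integral_mult_right_zero[symmetric]) (simp only: mult_ac)
  show "pairing k p q = (LINT z|(lborel \<Otimes>\<^sub>M lborel). p (fst z) * q (snd z) * k (fst z - snd z))"
    using lborel_pair.integral_fst[OF int] unfolding pairing_def 1 case_prod_beta' by simp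
  moreover have "(LINT z|(lborel \<Otimes>\<^sub>M lborel). p (fst z) * q (snd z) * k (fst z - snd z))
      = (LINT y|lborel. q y * (LINT x|lborel. p x * k (x - y)))"
    using lborel_pair.integral_snd[of "\<lambda>x y. p x * q y * k (x - y)", OF int]
    unfolding 2 case_prod_beta' by simp
  ultimately show "pairing k p q = (LINT y|lborel. q y * (LINT x|lborel. p x * k (x - y)))" by simp
qed

lemma pairing_diff:
  assumes "L2 p" "L2 q" "L2 r" "integrable lborel k"
  shows "pairing k p (\<lambda>y. q y - r y) = pairing k p q - pairing k p r"
  unfolding pairing_Fubini(1)[OF assms(1) L2_diff[OF assms(2,3)] assms(4)]
    pairing_Fubini(1)[OF assms(1,2,4)] pairing_Fubini(1)[OF assms(1,3,4)]
  using Bochner_Integration.integral_diff[OF pairing_integrable[OF assms(1,2,4)] pairing_integrable[OF assms(1,3,4)]]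
  by (simp add: case_prod_beta' algebra_simps)

text \<open>Young's inequality with a free parameter plays the role of the Cauchy-Schwarz inequality.\<close>

lemma pairing_bound:
  assumes p: "L2 p" and q: "L2 q" and k: "integrable lborel k" "\<And>x. 0 \<le> k x" "(LINT x|lborel. k x) = 1"
    and \<kappa>: "\<kappa> > 0"
  shows "\<bar>pairing k p q\<bar> \<le> \<kappa> / 2 * (LINT x|lborel. (p x)\<^sup>2) + 1 / (2 * \<kappa>) * (LINT x|lborel. (q x)\<^sup>2)"
proof -
  let ?M = "lborel \<Otimes>\<^sub>M (lborel :: (real^3) measure)"
  have p2: "integrable lborel (\<lambda>x. (p x)\<^sup>2)" and q2: "integrable lborel (\<lambda>x. (q x)\<^sup>2)"
    using p q by (auto simp: L2_def)
  have i: "integrable ?M (\<lambda>z. (p (fst z))\<^sup>2 * k (fst z - snd z))"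
      "integrable ?M (\<lambda>z. (q (snd z))\<^sup>2 * k (fst z - snd z))"
    using integrable_convolution_fst(1)[OF p2 k(1)] integrable_convolution_snd(1)[OF q2 k(1)]
    by (auto simp: case_prod_beta')
  have "\<bar>pairing k p q\<bar> \<le> (LINT z|?M. norm (p (fst z) * q (snd z) * k (fst z - snd z)))"
    unfolding pairing_Fubini(1)[OF p q k(1)]
    using integral_norm_bound[of ?M "\<lambda>z. p (fst z) * q (snd z) * k (fst z - snd z)"] by simp
  also have "\<dots> \<le> (LINT z|?M. \<kappa> / 2 * ((p (fst z))\<^sup>2 * k (fst z - snd z))
      + 1 / (2 * \<kappa>) * ((q (snd z))\<^sup>2 * k (fst z - snd z)))"
  proof (rule integral_mono)
    show "integrable ?M (\<lambda>z. norm (p (fst z) * q (snd z) * k (fst z - snd z)))"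
      using pairing_integrable[OF p q k(1)] by (intro integrable_norm) (simp add: case_prod_beta')
    show "norm (p (fst z) * q (snd z) * k (fst z - snd z)) \<le> \<kappa> / 2 * ((p (fst z))\<^sup>2 * k (fst z - snd z))
      + 1 / (2 * \<kappa>) * ((q (snd z))\<^sup>2 * k (fst z - snd z))" for z
      using young_ineq[OF \<kappa>, of "p (fst z)" "q (snd z)" "k (fst z - snd z)"] k(2) by simp
  qed (intro Bochner_Integration.integrable_add integrable_mult_right i)
  also have "\<dots> = \<kappa> / 2 * (LINT x|lborel. (p x)\<^sup>2) + 1 / (2 * \<kappa>) * (LINT x|lborel. (q x)\<^sup>2)"
    using integrable_convolution_fst(2)[OF p2 k(1)] integrable_convolution_snd(2)[OF q2 k(1)] k(3) i
    by (subst Bochner_Integration.integral_add) (simp_all del: times_divide_eq_left)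
  finally show ?thesis .
qed

lemma integral_mult_bound:
  assumes p: "L2 p" and q: "L2 q" and \<kappa>: "\<kappa> > 0"
  shows "\<bar>LINT x|lborel. p x * q x\<bar> \<le> \<kappa> / 2 * (LINT x|lborel. (p x)\<^sup>2) + 1 / (2 * \<kappa>) * (LINT x|lborel. (q x)\<^sup>2)"
proof -
  have i: "integrable lborel (\<lambda>x. (p x)\<^sup>2)" "integrable lborel (\<lambda>x. (q x)\<^sup>2)"
    using p q by (auto simp: L2_def)
  have "\<bar>LINT x|lborel. p x * q x\<bar> \<le> (LINT x|lborel. norm (p x * q x))"
    using integral_norm_bound[of lborel "\<lambda>x. p x * q x"] by simp
  also have "\<dots> \<le> (LINT x|lborel. \<kappa> / 2 * (p x)\<^sup>2 + 1 / (2 * \<kappa>) * (q x)\<^sup>2)"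
    using young_ineq[OF \<kappa>, of _ _ 1] i
    by (intro integral_mono integrable_norm L2_mult_integrable p q
        Bochner_Integration.integrable_add integrable_mult_right) auto
  finally show ?thesis using i by simp
qed

lemma test_fn_L2: assumes f: "test_fn f" shows "L2 f"
proof -
  obtain B where B: "B > 0" "\<And>x. \<bar>f x\<bar> \<le> B" using test_fn_bounded[OF f] by blast
  have [measurable]: "f \<in> borel_measurable borel" using f by (rule test_fn_measurable)
  have "integrable lborel (\<lambda>x. (f x)\<^sup>2)"
  proof (rule Bochner_Integration.integrable_bound)
    show "integrable lborel (\<lambda>x. B * \<bar>f x\<bar>)" using test_fn_integrable[OF f] by simp
    have "(f x)\<^sup>2 \<le> B * \<bar>f x\<bar>" for x
      using mult_right_mono[OF B(2)[of x], of "\<bar>f x\<bar>"] by (simp add: power2_eq_square)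
    then show "AE x in lborel. norm ((f x)\<^sup>2) \<le> norm (B * \<bar>f x\<bar>)" using B by (simp add: abs_mult)
  qed measurable
  then show ?thesis by (simp add: L2_def)
qed

lemma L2_indicator: "L2 (indicator (cball 0 R))"
proof -
  have "integrable lborel (\<lambda>x. (indicator (cball (0::real^3) R) x)::real)"
    by (intro integrable_real_indicator) (use emeasure_lborel_cball_finite[of "0::real^3" R] in auto)
  moreover have eq: "(\<lambda>x. (indicator (cball 0 R) x :: real)\<^sup>2) = (\<lambda>x. indicator (cball (0::real^3) R) x)"
    by (auto simp: indicator_def fun_eq_iff)
  ultimately show ?thesis
    unfolding L2_def eq by (intro conjI borel_measurable_indicator borel_closed closed_cball)
qed

lemma mollifier_outside_1: "norm z \<ge> 1 \<Longrightarrow> mollifier n z = 0"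
  by (rule mollifier_outside) (rule order.trans[of _ 1], auto)

lemma mollifier_conv_le:
  assumes g: "L2 g" and le: "\<And>y. norm (x - y) < 1 / real (Suc n) \<Longrightarrow> \<bar>g y - c\<bar> \<le> M"
  shows "\<bar>(LINT y|lborel. g y * mollifier n (x - y)) - c\<bar> \<le> M"
proof -
  have tfm: "test_fn (\<lambda>y. mollifier n (x - y))" by (intro test_fn_reflect test_fn_mollifier)
  have int: "integrable lborel (\<lambda>y. g y * mollifier n (x - y))"
    by (intro L2_mult_integrable g test_fn_L2 tfm)
  have m: "(LINT y|lborel. mollifier n (x - y)) = 1"
    using lborel_reflect(1)[OF test_fn_measurable[OF test_fn_mollifier[of n]]] by (simp add: mollifier_integral)
  have "(LINT y|lborel. g y * mollifier n (x - y)) - c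
      = (LINT y|lborel. g y * mollifier n (x - y) - c * mollifier n (x - y))"
    using int test_fn_integrable[OF tfm] m by (subst Bochner_Integration.integral_diff) auto
  also have "\<bar>\<dots>\<bar> \<le> (LINT y|lborel. norm (g y * mollifier n (x - y) - c * mollifier n (x - y)))"
    using integral_norm_bound[of lborel "\<lambda>y. g y * mollifier n (x - y) - c * mollifier n (x - y)"] by simp
  also have "\<dots> \<le> (LINT y|lborel. M * mollifier n (x - y))"
  proof (rule integral_mono)
    fix y
    show "norm (g y * mollifier n (x - y) - c * mollifier n (x - y)) \<le> M * mollifier n (x - y)"
    proof (cases "norm (x - y) < 1 / real (Suc n)")
      case True
      have "\<bar>g y - c\<bar> * mollifier n (x - y) \<le> M * mollifier n (x - y)"
        by (intro mult_right_mono le True mollifier_nonneg)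
      then show ?thesis
        by (simp add: abs_mult mollifier_nonneg flip: left_diff_distrib)
    next
      case False
      then have "mollifier n (x - y) = 0" by (intro mollifier_outside) auto
      then show ?thesis by simp
    qed
  qed (use int test_fn_integrable[OF tfm] in auto)
  also have "\<dots> = M" using m by simp
  finally show ?thesis .
qed

lemma mollifier_conv_tendsto:
  assumes g: "L2 g" "continuous_on UNIV g"
  shows "(\<lambda>n. LINT y|lborel. g y * mollifier n (x - y)) \<longlonglongrightarrow> g x"
proof (rule LIMSEQ_I)
  fix e :: real assume e: "e > 0"
  have "isCont g x" using g(2) by (simp add: continuous_on_eq_continuous_at)
  then obtain d where d: "d > 0" "\<And>y. dist y x < d \<Longrightarrow> dist (g y) (g x) < e / 2"
    using e by (force simp: continuous_at_eps_delta dest: spec[of _ "e / 2"])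
  obtain N where N: "1 / real (Suc N) < d" using d(1) nat_approx_posE by blast
  show "\<exists>N. \<forall>n\<ge>N. norm ((LINT y|lborel. g y * mollifier n (x - y)) - g x) < e"
  proof (intro exI[of _ N] allI impI)
    fix n assume n: "n \<ge> N"
    have "1 / real (Suc n) \<le> 1 / real (Suc N)" using n by (simp add: field_simps)
    then have d': "dist y x < d" if "norm (x - y) < 1 / real (Suc n)" for y
      using that N by (simp add: dist_norm norm_minus_commute)
    have "\<bar>(LINT y|lborel. g y * mollifier n (x - y)) - g x\<bar> \<le> e / 2"
      using d(2)[OF d'] by (intro mollifier_conv_le g) (auto simp: dist_real_def less_imp_le)
    then show "norm ((LINT y|lborel. g y * mollifier n (x - y)) - g x) < e" using e by simp
  qed
qed

text \<open>The mollifications of a continuous \<open>g\<close> with bounded support converge pointwise and stay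
  bounded, with supports in a common ball.\<close>

lemma pairing_tendsto_continuous:
  assumes p: "L2 p" and g: "L2 g" "continuous_on UNIV g" "\<And>x. norm x > R \<Longrightarrow> g x = 0"
  shows "(\<lambda>n. pairing (mollifier n) p g) \<longlonglongrightarrow> (LINT x|lborel. p x * g x)"
proof -
  have [measurable]: "p \<in> borel_measurable borel" "g \<in> borel_measurable borel"
    "mollifier n \<in> borel_measurable borel" for n
    using p g(1) test_fn_measurable[OF test_fn_mollifier] by (auto dest: L2_measurable)
  have "compact (g ` cball 0 R)"
    using g(2) by (intro compact_continuous_image) (auto intro: continuous_on_subset)
  then obtain M where M: "M > 0" "\<forall>y\<in>g ` cball 0 R. norm y \<le> M"
    using compact_imp_bounded bounded_pos by metis
  have M': "\<bar>g x\<bar> \<le> M" for x using M g(3)[of x] by (cases "norm x \<le> R") auto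
  show ?thesis unfolding pairing_def
  proof (rule integral_dominated_convergence)
    show "integrable lborel (\<lambda>x. M * \<bar>p x * indicator (cball 0 (R + 1)) x\<bar>)"
      by (intro integrable_mult_right integrable_abs L2_mult_integrable p L2_indicator)
    show "AE x in lborel. (\<lambda>n. p x * (LINT y|lborel. g y * mollifier n (x - y))) \<longlonglongrightarrow> p x * g x"
      by (intro AE_I2 tendsto_intros mollifier_conv_tendsto g)
    have bd: "\<bar>p x * (LINT y|lborel. g y * mollifier n (x - y))\<bar> \<le> M * \<bar>p x * indicator (cball 0 (R + 1)) x\<bar>" for x n
    proof (cases "norm x \<le> R + 1")
      case True
      have "\<bar>(LINT y|lborel. g y * mollifier n (x - y)) - 0\<bar> \<le> M"
        by (rule mollifier_conv_le) (use g M' in auto)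
      then show ?thesis using True
        by (simp add: abs_mult mult.commute[of "\<bar>p x\<bar>"] mult_right_mono)
    next
      case False
      have "g y * mollifier n (x - y) = 0" for y
      proof (cases "norm y > R")
        case y: False
        have "norm (x - y) \<ge> 1" using False y norm_triangle_ineq2[of x y] by linarith
        then show ?thesis by (simp add: mollifier_outside_1)
      qed (use g(3) in simp)
      then have "(LINT y|lborel. g y * mollifier n (x - y)) = (LINT y::real^3|lborel. 0)"
        by (simp only:)
      then show ?thesis using M(1) by simp
    qed
    then show "AE x in lborel. norm (p x * (LINT y|lborel. g y * mollifier n (x - y)))
        \<le> M * \<bar>p x * indicator (cball 0 (R + 1)) x\<bar>" for n by simp
  qed measurable
qed

text \<open>The pairing is bounded on square integrable functions uniformly in the mollifier, so it is
  enough to know the limit for a dense set of \<open>q\<close>.\<close>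

lemma pairing_tendsto:
  assumes p: "L2 p" and q: "L2 q"
  shows "(\<lambda>n. pairing (mollifier n) p q) \<longlonglongrightarrow> (LINT x|lborel. p x * q x)"
proof (rule LIMSEQ_I)
  fix e :: real assume e: "e > 0"
  define P where "P = (LINT x|lborel. (p x)\<^sup>2)"
  have P: "P \<ge> 0" unfolding P_def by simp
  define \<kappa> where "\<kappa> = e / (4 * (P + 1))"
  have \<kappa>: "\<kappa> > 0" "\<kappa> * P \<le> e / 4"
    using e P by (auto simp: \<kappa>_def field_simps)
  obtain g R where g: "continuous_on UNIV g" "\<And>x. norm x > R \<Longrightarrow> g x = 0" "L2 g"
    and qg: "(LINT x|lborel. (q x - g x)\<^sup>2) < \<kappa> * (e / 4)"
    using L2_approx_continuous[OF q, of "\<kappa> * (e / 4)"] \<kappa> e by auto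
  have qg': "1 / \<kappa> * (LINT x|lborel. (q x - g x)\<^sup>2) \<le> e / 4"
    using qg \<kappa>(1) by (simp add: field_simps)
  note L2d = L2_diff[OF q g(3)]
  obtain N where N: "\<And>n. n \<ge> N \<Longrightarrow>
      norm (pairing (mollifier n) p g - (LINT x|lborel. p x * g x)) < e / 2"
    using LIMSEQ_D[OF pairing_tendsto_continuous[OF p g(3,1), of R, OF g(2)], of "e / 2"] e by auto
  show "\<exists>N. \<forall>n\<ge>N. norm (pairing (mollifier n) p q - (LINT x|lborel. p x * q x)) < e"
  proof (intro exI[of _ N] allI impI)
    fix n assume n: "n \<ge> N"
    note k = test_fn_integrable[OF test_fn_mollifier[of n]]
    have 1: "\<bar>pairing (mollifier n) p q - pairing (mollifier n) p g\<bar>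
        \<le> \<kappa> / 2 * P + 1 / (2 * \<kappa>) * (LINT x|lborel. (q x - g x)\<^sup>2)"
      unfolding P_def pairing_diff[OF p q g(3) k, symmetric]
      by (intro pairing_bound p L2d k mollifier_nonneg mollifier_integral \<kappa>)
    have 2: "\<bar>(LINT x|lborel. p x * q x) - (LINT x|lborel. p x * g x)\<bar>
        \<le> \<kappa> / 2 * P + 1 / (2 * \<kappa>) * (LINT x|lborel. (q x - g x)\<^sup>2)"
      using integral_mult_bound[OF p L2d \<kappa>(1)] L2_mult_integrable[OF p q] L2_mult_integrable[OF p g(3)]
      unfolding P_def by (simp add: right_diff_distrib)
    have "\<kappa> / 2 * P + 1 / (2 * \<kappa>) * (LINT x|lborel. (q x - g x)\<^sup>2)
        = (\<kappa> * P + 1 / \<kappa> * (LINT x|lborel. (q x - g x)\<^sup>2)) / 2"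
      by (simp add: field_simps)
    with 1 2 N[OF n] \<kappa> qg' show "norm (pairing (mollifier n) p q - (LINT x|lborel. p x * q x)) < e"
      unfolding real_norm_def by linarith
  qed
qed

lemma locL2_measurable [measurable_dest]: "locL2 f \<Longrightarrow> f \<in> borel_measurable borel"
  by (simp add: locL2_def)

lemma L2_imp_locL2: "L2 f \<Longrightarrow> locL2 f"
  unfolding locL2_def
  by (auto intro!: L2_dominated[of _ f 1] dest: L2_measurable simp: indicator_def)

lemma locL2_add: "locL2 f \<Longrightarrow> locL2 g \<Longrightarrow> locL2 (\<lambda>x. f x + g x)"
  unfolding locL2_def by (auto simp: distrib_left intro: L2_add)

lemma locL2_mult_continuous:
  assumes h: "continuous_on UNIV h" and f: "locL2 f" shows "locL2 (\<lambda>x. h x * f x)"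
  unfolding locL2_def
proof (intro conjI allI)
  have [measurable]: "h \<in> borel_measurable borel" "f \<in> borel_measurable borel"
    using h f by (auto intro: borel_measurable_continuous_onI locL2_measurable)
  show "(\<lambda>x. h x * f x) \<in> borel_measurable borel" by measurable
  fix R
  have "compact (h ` cball 0 R)"
    using h by (intro compact_continuous_image) (auto intro: continuous_on_subset)
  then obtain M where M: "M > 0" "\<forall>y\<in>h ` cball 0 R. norm y \<le> M"
    using compact_imp_bounded bounded_pos by metis
  show "L2 (\<lambda>x. indicator (cball 0 R) x * (h x * f x))"
  proof (rule L2_dominated[of _ "\<lambda>x. indicator (cball 0 R) x * f x" M])
    show "L2 (\<lambda>x. indicator (cball 0 R) x * f x)" using f by (simp add: locL2_def)
    show "\<bar>indicator (cball 0 R) x * (h x * f x)\<bar> \<le> M * \<bar>indicator (cball 0 R) x * f x\<bar>" for x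
      using M(2) by (auto simp: indicator_def abs_mult intro: mult_right_mono)
    show "(\<lambda>x. indicator (cball 0 R) x * (h x * f x)) \<in> borel_measurable borel"
      by (intro borel_measurable_times borel_measurable_indicator borel_closed closed_cball) measurable
  qed
qed

lemma locL2_cmult: "locL2 f \<Longrightarrow> locL2 (\<lambda>x. c * f x)"
  by (rule locL2_mult_continuous) auto

lemma locL2_mult_smooth: "smooth h \<Longrightarrow> locL2 f \<Longrightarrow> locL2 (\<lambda>x. h x * f x)"
  by (intro locL2_mult_continuous smooth_continuous)

lemma locL2_diff: "locL2 f \<Longrightarrow> locL2 g \<Longrightarrow> locL2 (\<lambda>x. f x - g x)"
  using locL2_add[of f "\<lambda>x. -1 * g x"] locL2_cmult[of g "-1"] by simp

lemma test_fn_mult_L2: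
  assumes \<phi>: "test_fn \<phi>" and f: "locL2 f" shows "L2 (\<lambda>x. \<phi> x * f x)"
proof -
  obtain R where R: "\<And>x. norm x > R \<Longrightarrow> \<phi> x = 0" using test_fn_support[OF \<phi>] by blast
  have "L2 (\<lambda>x. indicator (cball 0 R) x * (\<phi> x * f x))"
    using locL2_mult_smooth[OF test_fn_smooth[OF \<phi>] f] by (simp add: locL2_def)
  moreover have "(\<lambda>x. indicator (cball 0 R) x * (\<phi> x * f x)) = (\<lambda>x. \<phi> x * f x)"
    using R by (force simp: indicator_def)
  ultimately show ?thesis by simp
qed

lemma test_fn_mult_integrable:
  assumes \<phi>: "test_fn \<phi>" and f: "locL2 f" and g: "locL2 g"
  shows "integrable lborel (\<lambda>x. \<phi> x * f x * g x)" 
proof -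
  obtain R where R: "\<And>x. norm x > R \<Longrightarrow> \<phi> x = 0" using test_fn_support[OF \<phi>] by blast
  have "integrable lborel (\<lambda>x. (\<phi> x * f x) * (indicator (cball 0 R) x * g x))"
    using g by (intro L2_mult_integrable[OF test_fn_mult_L2[OF \<phi> f]]) (simp add: locL2_def)
  moreover have "(\<lambda>x. (\<phi> x * f x) * (indicator (cball 0 R) x * g x)) = (\<lambda>x. \<phi> x * f x * g x)"
    using R by (force simp: indicator_def)
  ultimately show ?thesis by simp
qed

lemma locL2_1: "locL2 (\<lambda>x. 1)"
  unfolding locL2_def using L2_indicator by simp

lemma test_fn_mult_integrable1: "test_fn \<phi> \<Longrightarrow> locL2 f \<Longrightarrow> integrable lborel (\<lambda>x. \<phi> x * f x)"
  using test_fn_mult_integrable[OF _ _ locL2_1] by simp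

lemma locL2_cutoff: "locL2 f \<Longrightarrow> L2 (\<lambda>x. indicator (cball 0 R) x * f x)"
  by (simp add: locL2_def)

lemma mollifier_conv_cutoff:
  fixes f k :: "real^3 \<Rightarrow> real"
  assumes "norm x \<le> R" "\<And>z. norm z \<ge> 1 \<Longrightarrow> k z = 0"
  shows "(LINT y|lborel. (indicator (cball 0 (R + 1)) y * f y) * k (x - y)) = (LINT y|lborel. f y * k (x - y))"
proof (rule Bochner_Integration.integral_cong)
  fix y :: "real^3"
  show "indicator (cball 0 (R + 1)) y * f y * k (x - y) = f y * k (x - y)"
  proof (cases "norm y \<le> R + 1")
    case False
    then have "norm (x - y) \<ge> 1" using assms(1) norm_triangle_ineq2[of y x] by (simp add: norm_minus_commute)
    then show ?thesis using assms(2) by simp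
  qed simp
qed simp

text \<open>Testing against \<open>y \<mapsto> \<rho> (x - y)\<close> for every \<open>x\<close> gives that all mollifications of \<open>f\<close> vanish.\<close>

lemma fundamental_lemma:
  assumes f: "locL2 f" and zero: "\<And>\<phi>. test_fn \<phi> \<Longrightarrow> (LINT x|lborel. f x * \<phi> x) = 0"
  shows "AE x in lborel. f x = 0"
proof -
  have "AE x in lborel. indicator (cball 0 R) x * f x = 0" for R
  proof -
    let ?f = "\<lambda>R x. indicator (cball 0 R) x * f x"
    note L2f = locL2_cutoff[OF f]
    have "pairing (mollifier n) (?f R) (?f (R + 1)) = 0" for n
    proof -
      have eq: "?f R x * (LINT y|lborel. ?f (R + 1) y * mollifier n (x - y)) = 0" for x
      proof (cases "norm x \<le> R")
        case True
        have "(LINT y|lborel. ?f (R + 1) y * mollifier n (x - y)) = (LINT y|lborel. f y * mollifier n (x - y))"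
          by (rule mollifier_conv_cutoff[OF True mollifier_outside_1])
        also have "\<dots> = 0"
          by (rule zero) (intro test_fn_reflect test_fn_mollifier)
        finally have "(LINT y|lborel. ?f (R + 1) y * mollifier n (x - y)) = 0" .
        then show ?thesis by simp
      qed simp
      show ?thesis unfolding pairing_def by (simp only: eq Bochner_Integration.integral_zero)
    qed
    then have "(LINT x|lborel. ?f R x * ?f (R + 1) x) = 0"
      using pairing_tendsto[OF L2f L2f, of R "R + 1"] LIMSEQ_unique[OF _ tendsto_const[of 0]] by simp
    moreover have "?f R x * ?f (R + 1) x = (?f R x)\<^sup>2" for x
      by (auto simp: indicator_def power2_eq_square)
    ultimately have "(LINT x|lborel. (?f R x)\<^sup>2) = 0" by simp
    then have "AE x in lborel. (?f R x)\<^sup>2 = 0"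
      using L2f[of R] by (subst (asm) integral_nonneg_eq_0_iff_AE) (auto simp: L2_def)
    then show ?thesis by simp
  qed
  then have "AE x in lborel. \<forall>n::nat. indicator (cball 0 (real n)) x * f x = 0"
    unfolding AE_all_countable by blast
  then show ?thesis
  proof eventually_elim
    case (elim x)
    obtain n where "norm x \<le> real n" using real_arch_simple by blast
    with elim[rule_format, of n] show ?case by simp
  qed
qed

section \<open>Weak gradients, weak divergences and their product rule\<close>

text \<open>Local versions for scalar functions: products such as \<open>x\<^sub>1 v\<^sub>1\<close> are only locally square integrable.\<close>

definition weak_grad :: "(real^3 \<Rightarrow> real) \<Rightarrow> (real^3 \<Rightarrow> real^3) \<Rightarrow> bool"
  where "weak_grad a g \<longleftrightarrow> locL2 a \<and> (\<forall>j. locL2 (\<lambda>x. g x $ j)) \<and>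
    (\<forall>\<phi> j. test_fn \<phi> \<longrightarrow> (LINT x|lborel. a x * grad \<phi> x $ j) = - (LINT x|lborel. g x $ j * \<phi> x))"

definition weak_div :: "(real^3 \<Rightarrow> real^3) \<Rightarrow> (real^3 \<Rightarrow> real) \<Rightarrow> bool"
  where "weak_div H d \<longleftrightarrow> (\<forall>j. locL2 (\<lambda>x. H x $ j)) \<and> locL2 d \<and>
    (\<forall>\<phi>. test_fn \<phi> \<longrightarrow> (LINT x|lborel. H x \<bullet> grad \<phi> x) = - (LINT x|lborel. d x * \<phi> x))"

lemma mollifier_grad_outside: "norm z \<ge> 1 \<Longrightarrow> grad (mollifier (Suc n)) z $ j = 0"
proof -
  assume "norm z \<ge> 1"
  moreover have "1 / real (Suc (Suc n)) < 1" by simp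
  ultimately have "norm z > 1 / real (Suc (Suc n))" by linarith
  then have "grad (mollifier (Suc n)) z = 0"
    by (rule grad_outside[rotated]) (simp add: mollifier_outside)
  then show ?thesis by simp
qed

text \<open>The defining identity of the weak divergence extends from test functions to \<open>a \<Psi>\<close>, which has
  only a weak gradient. Test with \<open>x \<mapsto> \<Psi> x \<rho> (x - y)\<close>, multiply by \<open>a y\<close> and integrate
  over \<open>y\<close>: the derivative of \<open>\<rho>\<close> can be moved to \<open>a\<close>, because \<open>\<rho> (x - y)\<close> is also a test function
  of \<open>y\<close>. No mollified function is ever differentiated.\<close>

lemma weak_div_product:
  assumes a: "weak_grad a g" and H: "weak_div H d" and \<Psi>: "test_fn \<Psi>"
  shows "(LINT x|lborel. \<Psi> x * (H x \<bullet> g x))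
    = - (LINT x|lborel. a x * (\<Psi> x * d x + H x \<bullet> grad \<Psi> x))"
proof -
  have aL: "locL2 a" and gL: "locL2 (\<lambda>x. g x $ j)" and
    ag: "test_fn \<phi> \<Longrightarrow> (LINT x|lborel. a x * grad \<phi> x $ j) = - (LINT x|lborel. g x $ j * \<phi> x)" for j \<phi>
    using a by (auto simp: weak_grad_def)
  have HL: "locL2 (\<lambda>x. H x $ j)" and dL: "locL2 d" and
    Hd: "test_fn \<phi> \<Longrightarrow> (LINT x|lborel. H x \<bullet> grad \<phi> x) = - (LINT x|lborel. d x * \<phi> x)" for j \<phi>
    using H by (auto simp: weak_div_def)
  obtain R where R: "\<And>x. norm x > R \<Longrightarrow> \<Psi> x = 0" using test_fn_support[OF \<Psi>] by blast
  have gR: "norm x > R \<Longrightarrow> grad \<Psi> x = 0" for x by (rule grad_outside[OF R])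
  define p where "p j x = \<Psi> x * H x $ j" for j x
  define P where "P x = \<Psi> x * d x + H x \<bullet> grad \<Psi> x" for x
  define a' where "a' x = indicator (cball 0 (R + 1)) x * a x" for x
  define g' where "g' j x = indicator (cball 0 (R + 1)) x * g x $ j" for j x
  have hg: "L2 (\<lambda>x. H x $ i * grad \<Psi> x $ j)" for i j
    using test_fn_mult_L2[OF test_fn_grad_nth[OF \<Psi>] HL] by (simp add: mult.commute)
  have L2: "L2 (p j)" "L2 P" "L2 a'" "L2 (g' j)" for j
    unfolding p_def[abs_def] a'_def[abs_def] g'_def[abs_def] P_def[abs_def] inner_vec_def sum_3
    by (auto intro!: L2_add test_fn_mult_L2[OF \<Psi> HL] test_fn_mult_L2[OF \<Psi> dL] locL2_cutoff aL gL hg)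
  \<comment> \<open>mollifiers with index at least \<open>1\<close> vanish, with their gradients, outside the open unit ball\<close>
  have key: "(\<Sum>j\<in>UNIV. pairing (mollifier (Suc n)) (p j) (g' j)) = - pairing (mollifier (Suc n)) P a'" for n
  proof -
    let ?\<rho> = "mollifier (Suc n)"
    have tfr: "test_fn ?\<rho>" by (rule test_fn_mollifier)
    note int = test_fn_integrable[OF test_fn_grad_nth[OF tfr]] test_fn_integrable[OF tfr]
    have 1: "pairing ?\<rho> (p j) (g' j) = pairing (\<lambda>z. grad ?\<rho> z $ j) (p j) a'" for j
      unfolding pairing_def
    proof (rule Bochner_Integration.integral_cong)
      fix x
      show "p j x * (LINT y|lborel. g' j y * ?\<rho> (x - y))
          = p j x * (LINT y|lborel. a' y * grad ?\<rho> (x - y) $ j)"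
      proof (cases "norm x \<le> R")
        case True
        have "(LINT y|lborel. a y * grad (\<lambda>y. ?\<rho> (x - y)) y $ j) = - (LINT y|lborel. g y $ j * ?\<rho> (x - y))"
          by (intro ag test_fn_reflect tfr)
        then have "(LINT y|lborel. g y $ j * ?\<rho> (x - y)) = (LINT y|lborel. a y * grad ?\<rho> (x - y) $ j)"
          by (simp add: grad_reflect test_fn_smooth[OF tfr])
        moreover have "(LINT y|lborel. g' j y * ?\<rho> (x - y)) = (LINT y|lborel. g y $ j * ?\<rho> (x - y))"
          unfolding g'_def by (rule mollifier_conv_cutoff[OF True mollifier_outside_1])
        moreover have "(LINT y|lborel. a' y * grad ?\<rho> (x - y) $ j) = (LINT y|lborel. a y * grad ?\<rho> (x - y) $ j)"
          unfolding a'_def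
          by (rule mollifier_conv_cutoff[OF True, where k = "\<lambda>z. grad ?\<rho> z $ j"], rule mollifier_grad_outside)
        ultimately show ?thesis by simp
      qed (simp add: p_def R)
    qed simp
    have 2: "(\<Sum>j\<in>UNIV. LINT x|lborel. p j x * grad ?\<rho> (x - y) $ j)
        = - (LINT x|lborel. P x * ?\<rho> (x - y))" for y
    proof -
      have tfy: "test_fn (\<lambda>x. ?\<rho> (x - y))"
        using test_fn_reflect[of "\<lambda>x. ?\<rho> (- x)" y] test_fn_reflect[OF tfr, of 0] by simp
      have tfgy: "test_fn (\<lambda>x. grad ?\<rho> (x - y) $ j)" for j
        using test_fn_grad_nth[OF tfy, of j] by (simp add: grad_shift test_fn_smooth[OF tfr])
      note ints = L2_mult_integrable[OF L2(1) test_fn_L2[OF tfgy]] L2_mult_integrable[OF L2(2) test_fn_L2[OF tfy]]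
        L2_mult_integrable[OF test_fn_mult_L2[OF \<Psi> dL] test_fn_L2[OF tfy]]
      have "(\<Sum>j\<in>UNIV. LINT x|lborel. p j x * grad ?\<rho> (x - y) $ j)
          = (LINT x|lborel. (\<Sum>j\<in>UNIV. p j x * grad ?\<rho> (x - y) $ j))"
        using ints by simp
      also have "\<dots> = (LINT x|lborel. H x \<bullet> grad (\<lambda>x. \<Psi> x * ?\<rho> (x - y)) x - (P x * ?\<rho> (x - y) - \<Psi> x * d x * ?\<rho> (x - y)))"
        by (rule Bochner_Integration.integral_cong)
           (simp_all add: P_def p_def grad_mult grad_shift test_fn_smooth[OF tfr] test_fn_smooth[OF \<Psi>] smooth_shift
             inner_add_right inner_vec_def sum_distrib_left sum_distrib_right sum.distrib algebra_simps)
      also have "\<dots> = (LINT x|lborel. H x \<bullet> grad (\<lambda>x. \<Psi> x * ?\<rho> (x - y)) x)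
          - ((LINT x|lborel. P x * ?\<rho> (x - y)) - (LINT x|lborel. \<Psi> x * d x * ?\<rho> (x - y)))"
      proof -
        have "integrable lborel (\<lambda>x. H x \<bullet> grad (\<lambda>x. \<Psi> x * ?\<rho> (x - y)) x)"
          unfolding inner_vec_def sum_3
          using test_fn_mult_integrable1[OF test_fn_grad_nth[OF test_fn_mult'[OF \<Psi> test_fn_smooth[OF tfy]]] HL]
          by (auto simp: mult.commute)
        then show ?thesis using ints by simp
      qed
      also have "(LINT x|lborel. H x \<bullet> grad (\<lambda>x. \<Psi> x * ?\<rho> (x - y)) x)
          = - (LINT x|lborel. d x * (\<Psi> x * ?\<rho> (x - y)))"
        by (intro Hd test_fn_mult' \<Psi> test_fn_smooth tfy)
      finally show ?thesis by (simp add: mult_ac)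
    qed
    have "(\<Sum>j\<in>UNIV. pairing ?\<rho> (p j) (g' j))
        = (\<Sum>j\<in>UNIV. LINT y|lborel. a' y * (LINT x|lborel. p j x * grad ?\<rho> (x - y) $ j))"
      unfolding 1 using pairing_Fubini(2)[OF L2(1,3) int(1)] by simp
    also have "\<dots> = (LINT y|lborel. (\<Sum>j\<in>UNIV. a' y * (LINT x|lborel. p j x * grad ?\<rho> (x - y) $ j)))"
    proof (rule Bochner_Integration.integral_sum[symmetric])
      fix j
      show "integrable lborel (\<lambda>y. a' y * (LINT x|lborel. p j x * grad ?\<rho> (x - y) $ j))"
        using lborel_pair.integrable_snd[of "\<lambda>x y. p j x * a' y * grad ?\<rho> (x - y) $ j",
            OF pairing_integrable[OF L2(1,3) int(1), of j j]]
        by (simp add: mult.assoc mult.left_commute[of "p j _"])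
    qed
    also have "\<dots> = (LINT y|lborel. - (a' y * (LINT x|lborel. P x * ?\<rho> (x - y))))"
      by (simp flip: sum_distrib_left add: 2)
    also have "\<dots> = - pairing ?\<rho> P a'"
      unfolding pairing_Fubini(2)[OF L2(2,3) int(2)] by simp
    finally show ?thesis .
  qed
  have "(\<lambda>n. \<Sum>j\<in>UNIV. pairing (mollifier (Suc n)) (p j) (g' j))
      \<longlonglongrightarrow> (\<Sum>j\<in>UNIV. LINT x|lborel. p j x * g' j x)"
    by (intro tendsto_sum LIMSEQ_Suc pairing_tendsto L2)
  moreover have "(\<lambda>n. - pairing (mollifier (Suc n)) P a') \<longlonglongrightarrow> - (LINT x|lborel. P x * a' x)"
    by (intro tendsto_minus LIMSEQ_Suc pairing_tendsto L2)
  ultimately have "(\<Sum>j\<in>UNIV. LINT x|lborel. p j x * g' j x) = - (LINT x|lborel. P x * a' x)"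
    unfolding key by (rule LIMSEQ_unique)
  moreover have "(\<Sum>j\<in>UNIV. LINT x|lborel. p j x * g' j x) = (LINT x|lborel. (\<Sum>j\<in>UNIV. p j x * g' j x))"
    by (subst Bochner_Integration.integral_sum) (auto intro: L2_mult_integrable L2)
  moreover have "(\<Sum>j\<in>UNIV. p j x * g' j x) = \<Psi> x * (H x \<bullet> g x)" for x
    using R[of x] by (cases "norm x \<le> R")
      (auto simp: p_def g'_def inner_vec_def sum_distrib_left mult.assoc)
  moreover have "P x * a' x = a x * (\<Psi> x * d x + H x \<bullet> grad \<Psi> x)" for x
    using R[of x] gR[of x] by (cases "norm x \<le> R") (auto simp: P_def a'_def)
  ultimately show ?thesis by simp
qed

section \<open>Axial symmetry\<close>

text \<open>It suffices to compare the measures of boxes, and orthogonal maps preserve volume.\<close>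

lemma lborel_orthogonal_transformation:
  fixes R :: "real^'n::{finite,wellorder} \<Rightarrow> real^'n::_"
  assumes R: "orthogonal_transformation R"
  shows "distr lborel borel R = lborel"
proof (rule lborel_eqI[symmetric])
  have cont: "continuous_on UNIV R"
    using orthogonal_transformation_linear[OF R] by (intro linear_continuous_on) (simp add: linear_conv_bounded_linear)
  then have [measurable]: "R \<in> borel_measurable borel" by (rule borel_measurable_continuous_onI)
  fix l u :: "real^'n::_" assume lu: "\<And>b. b \<in> Basis \<Longrightarrow> l \<bullet> b \<le> u \<bullet> b"
  have bij: "bij R" using R by (rule orthogonal_transformation_bij)
  have op: "open (R -` box l u)" using cont by (intro open_vimage open_box) auto
  have vim: "R -` box l u = inv R ` box l u"
    using bij by (simp add: bij_vimage_eq_inv_image)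
  have ot: "orthogonal_transformation (inv R)" using R by (rule orthogonal_transformation_inv)
  have "emeasure (distr lborel borel R) (box l u) = emeasure lborel (R -` box l u)"
    by (subst emeasure_distr) auto
  also have "\<dots> = emeasure lebesgue (inv R ` box l u)"
    unfolding vim[symmetric] using op by (subst emeasure_completion) auto
  also have "\<dots> = ennreal (measure lebesgue (inv R ` box l u))"
    by (intro emeasure_eq_measure2 measurable_orthogonal_image ot lmeasurable_box)
  also have "\<dots> = ennreal (measure lebesgue (box l u))"
    by (simp add: measure_orthogonal_image ot)
  also have "\<dots> = ennreal (\<Prod>b\<in>Basis. (u - l) \<bullet> b)"
    using lu by (subst emeasure_eq_measure2[OF lmeasurable_box, symmetric]) simp
  finally show "emeasure (distr lborel borel R) (box l u) = ennreal (\<Prod>b\<in>Basis. (u - l) \<bullet> b)" .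
qed simp

text \<open>The Killing field of the rotations about the third axis, that is \<open>r e\<^sub>\<phi>\<close>.\<close>

definition swirl :: "real^3 \<Rightarrow> real^3" where "swirl x = vector [- x$2, x$1, 0]"

definition rotation :: "real \<Rightarrow> real^3 \<Rightarrow> real^3"
  where "rotation \<theta> x = cos \<theta> *\<^sub>R vector [x$1, x$2, 0] + sin \<theta> *\<^sub>R swirl x + x$3 *\<^sub>R axis 3 1"

lemma rotation_nth [simp]: "rotation \<theta> x $ 1 = cos \<theta> * x$1 - sin \<theta> * x$2"
  "rotation \<theta> x $ 2 = cos \<theta> * x$2 + sin \<theta> * x$1" "rotation \<theta> x $ 3 = x$3"
  by (simp_all add: rotation_def swirl_def axis_def)

lemma rotation_horizontal_norm:
  "(rotation \<theta> x $ 1)\<^sup>2 + (rotation \<theta> x $ 2)\<^sup>2 = (x$1)\<^sup>2 + (x$2)\<^sup>2"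
proof -
  have "(rotation \<theta> x $ 1)\<^sup>2 + (rotation \<theta> x $ 2)\<^sup>2 = ((cos \<theta>)\<^sup>2 + (sin \<theta>)\<^sup>2) * ((x$1)\<^sup>2 + (x$2)\<^sup>2)"
    unfolding rotation_nth by algebra
  then show ?thesis by simp
qed

lemma norm_rotation: "norm (rotation \<theta> x) = norm x"
  using rotation_horizontal_norm[of \<theta> x]
  by (simp add: norm_eq_sqrt_inner inner_vec_def sum_3 power2_eq_square del: rotation_nth(1,2))

lemma orthogonal_rotation: "orthogonal_transformation (rotation \<theta>)"
  unfolding orthogonal_transformation
proof
  show "linear (rotation \<theta>)"
    by (rule linearI) (auto simp: vec_eq_iff forall_3 algebra_simps)
qed (auto simp: norm_rotation)

lemma cyl_r_rotation: "cyl_r (rotation \<theta> x) = cyl_r x"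
  unfolding cyl_r_def rotation_horizontal_norm ..

definition swirl_deriv :: "(real^3 \<Rightarrow> real) \<Rightarrow> real^3 \<Rightarrow> real"
  where "swirl_deriv \<phi> x = x$1 * grad \<phi> x $ 2 - x$2 * grad \<phi> x $ 1"

lemma test_fn_diff: "test_fn f \<Longrightarrow> test_fn g \<Longrightarrow> test_fn (\<lambda>x. f x - g x)"
proof -
  assume fg: "test_fn f" "test_fn g"
  obtain R S where "\<And>x. norm x > R \<Longrightarrow> f x = 0" "\<And>x. norm x > S \<Longrightarrow> g x = 0"
    using test_fn_support fg by metis
  then show ?thesis
    using fg by (intro test_fnI[of _ "max R S"]) (auto intro: smooth_diff test_fn_smooth)
qed

lemma test_fn_swirl_deriv: "test_fn \<phi> \<Longrightarrow> test_fn (swirl_deriv \<phi>)"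
  unfolding swirl_deriv_def[abs_def] by (intro test_fn_diff test_fn_mult test_fn_grad_nth smooth_component)

lemma rotation_has_derivative:
  assumes "smooth \<phi>"
  shows "((\<lambda>\<theta>. \<phi> (rotation \<theta> x)) has_real_derivative swirl_deriv \<phi> (rotation \<theta> x)) (at \<theta>)"
proof -
  have "((\<lambda>\<theta>. rotation \<theta> x) has_derivative (\<lambda>t. t *\<^sub>R swirl (rotation \<theta> x))) (at \<theta>)"
    unfolding rotation_def
    by (auto intro!: derivative_eq_intros simp: fun_eq_iff vec_eq_iff forall_3 swirl_def axis_def algebra_simps)
  from has_derivative_compose[OF this grad_has_derivative[OF assms]]
  have "((\<lambda>\<theta>. \<phi> (rotation \<theta> x)) has_derivative
      (\<lambda>t. grad \<phi> (rotation \<theta> x) \<bullet> (t *\<^sub>R swirl (rotation \<theta> x)))) (at \<theta>)" .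
  moreover have "(\<lambda>t. grad \<phi> z \<bullet> (t *\<^sub>R swirl z)) = (*) (swirl_deriv \<phi> z)" for z
    by (simp add: fun_eq_iff swirl_def swirl_deriv_def inner_vec_def sum_3 algebra_simps)
  ultimately show ?thesis unfolding has_field_derivative_def by (simp only:)
qed

lemma lborel_rotation:
  "distr lborel borel (rotation \<theta>) = lborel"
  by (rule lborel_orthogonal_transformation[OF orthogonal_rotation])

lemma rotation_measurable [measurable]: "rotation \<theta> \<in> borel_measurable borel"
  using orthogonal_transformation_linear[OF orthogonal_rotation]
  by (intro borel_measurable_continuous_onI linear_continuous_on) (simp add: linear_conv_bounded_linear)

text \<open>The integral of \<open>B\<close> against the rotated test function does not depend on the angle, since \<open>B\<close> and
  the measure are invariant; differentiate at angle \<open>0\<close>.\<close>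

lemma axisymmetric_swirl_deriv:
  assumes B: "locL2 B" "AE x in lborel. B x = b (cyl_r x) (x $ 3)" and \<phi>: "test_fn \<phi>"
  shows "(LINT x|lborel. B x * swirl_deriv \<phi> x) = 0"
proof -
  have [measurable]: "B \<in> borel_measurable borel" "\<phi> \<in> borel_measurable borel"
    "swirl_deriv \<phi> \<in> borel_measurable borel"
    using B(1) \<phi> test_fn_swirl_deriv[OF \<phi>] by (auto intro: locL2_measurable test_fn_measurable)
  obtain R where R: "\<And>x. norm x > R \<Longrightarrow> \<phi> x = 0" using test_fn_support[OF \<phi>] by blast
  obtain M where M: "M > 0" "\<And>x. \<bar>swirl_deriv \<phi> x\<bar> \<le> M"
    using test_fn_bounded[OF test_fn_swirl_deriv[OF \<phi>]] by blast
  have integ: "integrable lborel (\<lambda>x. B x * \<psi> x)" if "L2 \<psi>" "\<And>x. norm x > R \<Longrightarrow> \<psi> x = 0" for \<psi>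
  proof -
    have "integrable lborel (\<lambda>x. (indicator (cball 0 R) x * B x) * \<psi> x)"
      by (intro L2_mult_integrable locL2_cutoff B that)
    moreover have "(\<lambda>x. (indicator (cball 0 R) x * B x) * \<psi> x) = (\<lambda>x. B x * \<psi> x)"
      using that(2) by (force simp: indicator_def)
    ultimately show ?thesis by simp
  qed
  have "L2 (\<lambda>x. \<phi> (rotation \<theta> x))" for \<theta>
  proof -
    have "integrable (distr lborel borel (rotation \<theta>)) (\<lambda>x. (\<phi> x)\<^sup>2)"
      using test_fn_L2[OF \<phi>] by (simp add: lborel_rotation L2_def)
    then have "integrable lborel (\<lambda>x. (\<phi> (rotation \<theta> x))\<^sup>2)"
      by (subst (asm) integrable_distr_eq) auto
    then show ?thesis by (simp add: L2_def)
  qed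
  note int1 = integ[OF this] and int2 = integ[OF test_fn_L2[OF \<phi>] R]
  have const: "(LINT x|lborel. B x * \<phi> (rotation \<theta> x)) = (LINT x|lborel. B x * \<phi> x)" for \<theta>
  proof -
    have "AE x in lborel. B (rotation \<theta> x) = b (cyl_r (rotation \<theta> x)) (rotation \<theta> x $ 3)"
    proof (rule AE_distrD[of "rotation \<theta>" lborel borel])
      show "AE x in distr lborel borel (rotation \<theta>). B x = b (cyl_r x) (x $ 3)"
        unfolding lborel_rotation by (rule B(2))
    qed simp
    then have ae: "AE x in lborel. B (rotation \<theta> x) = B x"
      using B(2) by eventually_elim (simp add: cyl_r_rotation)
    have "(LINT x|lborel. B x * \<phi> x) = (LINT x|distr lborel borel (rotation \<theta>). B x * \<phi> x)"
      by (simp add: lborel_rotation)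
    also have "\<dots> = (LINT x|lborel. B (rotation \<theta> x) * \<phi> (rotation \<theta> x))"
      by (rule integral_distr) auto
    also have "\<dots> = (LINT x|lborel. B x * \<phi> (rotation \<theta> x))"
      using ae by (intro integral_cong_AE) auto
    finally show ?thesis by simp
  qed
  define \<theta> where "\<theta> n = 1 / real (Suc n)" for n
  have \<theta>: "\<theta> n > 0" for n by (simp add: \<theta>_def)
  \<comment> \<open>difference quotients in the angle\<close>
  define D where "D n x = (\<phi> (rotation (\<theta> n) x) - \<phi> x) / \<theta> n" for n x
  have rot0: "rotation 0 x = x" for x by (simp add: vec_eq_iff forall_3)
  have "(\<lambda>n. LINT x|lborel. B x * D n x) \<longlonglongrightarrow> (LINT x|lborel. B x * swirl_deriv \<phi> x)"
  proof (rule integral_dominated_convergence)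
    show "integrable lborel (\<lambda>x. M * \<bar>B x * indicator (cball 0 R) x\<bar>)"
      by (intro integrable_mult_right integrable_abs integ L2_indicator) auto
    show "AE x in lborel. (\<lambda>n. B x * D n x) \<longlonglongrightarrow> B x * swirl_deriv \<phi> x"
    proof (intro AE_I2 tendsto_intros)
      fix x
      have lim: "((\<lambda>h. (\<phi> (rotation (0 + h) x) - \<phi> (rotation 0 x)) / h) \<longlongrightarrow> swirl_deriv \<phi> x) (at 0)"
        using rotation_has_derivative[OF test_fn_smooth[OF \<phi>], of x 0] unfolding DERIV_def rot0 .
      have "filterlim \<theta> (at 0) sequentially"
        unfolding filterlim_at \<theta>_def using LIMSEQ_Suc[OF lim_1_over_n] by simp
      from filterlim_compose[OF lim this]
      show "(\<lambda>n. D n x) \<longlonglongrightarrow> swirl_deriv \<phi> x"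
        unfolding D_def by (simp add: rot0)
    qed
    have "\<bar>B x * D n x\<bar> \<le> M * \<bar>B x * indicator (cball 0 R) x\<bar>" for n x
    proof (cases "norm x \<le> R")
      case True
      obtain z where "\<phi> (rotation (\<theta> n) x) - \<phi> (rotation 0 x) = (\<theta> n - 0) * swirl_deriv \<phi> (rotation z x)"
        using MVT2[OF \<theta>, of n "\<lambda>\<theta>. \<phi> (rotation \<theta> x)" "\<lambda>\<theta>. swirl_deriv \<phi> (rotation \<theta> x)"]
          rotation_has_derivative[OF test_fn_smooth[OF \<phi>]] by blast
      then have "D n x = swirl_deriv \<phi> (rotation z x)"
        using \<theta>[of n] by (simp add: D_def rot0)
      then show ?thesis
        using True M(2)[of "rotation z x"] by (simp add: abs_mult mult.commute[of M] mult_left_mono)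
    next
      case False
      then show ?thesis using R by (simp add: D_def norm_rotation)
    qed
    then show "AE x in lborel. norm (B x * D n x) \<le> M * \<bar>B x * indicator (cball 0 R) x\<bar>" for n by simp
  qed (auto simp: D_def[abs_def])
  moreover have "(LINT x|lborel. B x * D n x) = 0" for n
  proof -
    have "(LINT x|lborel. B x * D n x) = (LINT x|lborel. (B x * \<phi> (rotation (\<theta> n) x) - B x * \<phi> x) / \<theta> n)"
      by (simp add: D_def right_diff_distrib)
    also have "\<dots> = ((LINT x|lborel. B x * \<phi> (rotation (\<theta> n) x)) - (LINT x|lborel. B x * \<phi> x)) / \<theta> n"
      using int1[of "\<theta> n"] int2 by (simp add: R norm_rotation)
    finally show ?thesis using const by simp
  qed
  ultimately show ?thesis by (simp add: LIMSEQ_const_iff)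
qed

lemma weak_gradI:
  assumes "locL2 a" "\<And>j. locL2 (\<lambda>x. g x $ j)"
    "\<And>\<phi> j. test_fn \<phi> \<Longrightarrow> (LINT x|lborel. a x * grad \<phi> x $ j) = - (LINT x|lborel. g x $ j * \<phi> x)"
  shows "weak_grad a g"
  using assms by (auto simp: weak_grad_def)

lemma weak_gradD:
  assumes "weak_grad a g"
  shows "locL2 a" "locL2 (\<lambda>x. g x $ j)"
    "test_fn \<phi> \<Longrightarrow> (LINT x|lborel. a x * grad \<phi> x $ j) = - (LINT x|lborel. g x $ j * \<phi> x)"
  using assms by (auto simp: weak_grad_def)

lemma test_fn_locL2_integrable: "test_fn \<phi> \<Longrightarrow> locL2 f \<Longrightarrow> integrable lborel (\<lambda>x. f x * \<phi> x)"
  using test_fn_mult_integrable1 by (simp add: mult.commute)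

lemma weak_grad_add:
  assumes "weak_grad a g" "weak_grad b h"
  shows "weak_grad (\<lambda>x. a x + b x) (\<lambda>x. g x + h x)"
proof (rule weak_gradI)
  fix \<phi> j assume \<phi>: "test_fn \<phi>"
  note D = weak_gradD[OF assms(1)] weak_gradD[OF assms(2)]
  show "(LINT x|lborel. (a x + b x) * grad \<phi> x $ j) = - (LINT x|lborel. (g x + h x) $ j * \<phi> x)"
    using D(3)[OF \<phi>, of j] D(6)[OF \<phi>, of j] test_fn_locL2_integrable[OF test_fn_grad_nth[OF \<phi>, of j] D(1)]
      test_fn_locL2_integrable[OF test_fn_grad_nth[OF \<phi>, of j] D(4)]
      test_fn_locL2_integrable[OF \<phi> D(2)[of j]] test_fn_locL2_integrable[OF \<phi> D(5)[of j]]
    by (simp add: distrib_right)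
qed (auto intro: locL2_add weak_gradD[OF assms(1)] weak_gradD[OF assms(2)])

lemma weak_grad_smooth_mult:
  assumes a: "weak_grad a g" and h: "smooth h"
  shows "weak_grad (\<lambda>x. h x * a x) (\<lambda>x. h x *\<^sub>R g x + a x *\<^sub>R grad h x)"
proof (rule weak_gradI)
  note D = weak_gradD[OF a]
  show "locL2 (\<lambda>x. h x * a x)" by (intro locL2_mult_smooth h D)
  have L: "locL2 (\<lambda>x. a x * grad h x $ j)" for j
    using locL2_mult_smooth[OF smooth_grad_nth[OF h] D(1)] by (simp add: mult.commute)
  show "locL2 (\<lambda>x. (h x *\<^sub>R g x + a x *\<^sub>R grad h x) $ j)" for j
    using locL2_add[OF locL2_mult_smooth[OF h D(2)] L] by simp
  fix \<phi> j assume \<phi>: "test_fn \<phi>"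
  have h\<phi>: "test_fn (\<lambda>x. h x * \<phi> x)" by (intro test_fn_mult h \<phi>)
  have i1: "integrable lborel (\<lambda>x. a x * grad (\<lambda>x. h x * \<phi> x) x $ j)"
    by (intro test_fn_locL2_integrable test_fn_grad_nth h\<phi> D)
  have i2: "integrable lborel (\<lambda>x. (a x * grad h x $ j) * \<phi> x)"
    by (intro test_fn_locL2_integrable \<phi> L)
  have i3: "integrable lborel (\<lambda>x. g x $ j * (h x * \<phi> x))"
    by (intro test_fn_locL2_integrable h\<phi> D)
  have "(LINT x|lborel. (h x * a x) * grad \<phi> x $ j)
      = (LINT x|lborel. a x * grad (\<lambda>x. h x * \<phi> x) x $ j - (a x * grad h x $ j) * \<phi> x)"
    by (rule Bochner_Integration.integral_cong)
       (simp_all add: grad_mult h test_fn_smooth[OF \<phi>] algebra_simps)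
  also have "\<dots> = - (LINT x|lborel. g x $ j * (h x * \<phi> x)) - (LINT x|lborel. (a x * grad h x $ j) * \<phi> x)"
    using i1 i2 D(3)[OF h\<phi>, of j] by simp
  also have "\<dots> = - (LINT x|lborel. g x $ j * (h x * \<phi> x) + (a x * grad h x $ j) * \<phi> x)"
    using i2 i3 by simp
  also have "(\<lambda>x. g x $ j * (h x * \<phi> x) + (a x * grad h x $ j) * \<phi> x)
      = (\<lambda>x. (h x *\<^sub>R g x + a x *\<^sub>R grad h x) $ j * \<phi> x)"
    by (simp add: fun_eq_iff algebra_simps)
  finally show "(LINT x|lborel. (h x * a x) * grad \<phi> x $ j)
      = - (LINT x|lborel. (h x *\<^sub>R g x + a x *\<^sub>R grad h x) $ j * \<phi> x)" .
qed

text \<open>The regularity in space of almost every time slice of a weak solution.\<close>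

locale weak_field =
  fixes v :: "real^3 \<Rightarrow> real^3" and G :: "real^3 \<Rightarrow> real^3^3"
  assumes v_L2: "L2 (\<lambda>x. v x $ i)" and G_L2: "L2 (\<lambda>x. G x $ i $ j)"
    and weak_gradient_eq: "test_fn \<phi> \<Longrightarrow> (LINT x|lborel. v x $ i * grad \<phi> x $ j) = - (LINT x|lborel. G x $ i $ j * \<phi> x)"
begin

lemma weak_grad_component: "weak_grad (\<lambda>x. v x $ i) (\<lambda>x. G x $ i)"
  by (intro weak_gradI L2_imp_locL2 v_L2 G_L2 weak_gradient_eq)

lemma trace_zero:
  assumes "\<And>\<phi>. test_fn \<phi> \<Longrightarrow> (LINT x|lborel. v x \<bullet> grad \<phi> x) = 0"
  shows "AE x in lborel. G x $ 1 $ 1 + G x $ 2 $ 2 + G x $ 3 $ 3 = 0"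
proof (rule fundamental_lemma)
  show "locL2 (\<lambda>x. G x $ 1 $ 1 + G x $ 2 $ 2 + G x $ 3 $ 3)"
    by (intro locL2_add L2_imp_locL2 G_L2)
  fix \<phi> assume \<phi>: "test_fn \<phi>"
  note i1 = L2_mult_integrable[OF v_L2 test_fn_L2[OF test_fn_grad_nth[OF \<phi>]]]
  note i2 = L2_mult_integrable[OF G_L2 test_fn_L2[OF \<phi>]]
  have "0 = (LINT x|lborel. v x $ 1 * grad \<phi> x $ 1 + v x $ 2 * grad \<phi> x $ 2 + v x $ 3 * grad \<phi> x $ 3)"
    using assms[OF \<phi>] by (simp add: inner_vec_def sum_3)
  also have "\<dots> = - (LINT x|lborel. (G x $ 1 $ 1 + G x $ 2 $ 2 + G x $ 3 $ 3) * \<phi> x)"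
    using i1 i2 weak_gradient_eq[OF \<phi>] by (simp add: distrib_right)
  finally show "(LINT x|lborel. (G x $ 1 $ 1 + G x $ 2 $ 2 + G x $ 3 $ 3) * \<phi> x) = 0" by simp
qed

text \<open>The swirl \<open>r v\<^sub>\<phi>\<close> does not change under rotations, so its angular derivative vanishes; spelled
  out with the gradient of \<open>v\<close>, this says \<open>e\<^sub>\<phi> \<bullet> G e\<^sub>\<phi> = v\<^sub>r / r\<close>.\<close>

lemma axisymmetric_relation:
  assumes "axisymmetric v"
  shows "AE x in lborel. (x$2)\<^sup>2 * G x $ 1 $ 1 - x$1 * x$2 * (G x $ 1 $ 2 + G x $ 2 $ 1)
    + (x$1)\<^sup>2 * G x $ 2 $ 2 = x$1 * v x $ 1 + x$2 * v x $ 2"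
proof -
  define B where "B x = x$1 * v x $ 2 + (-1 * x$2) * v x $ 1" for x
  define g where "g x = ((x$1) *\<^sub>R G x $ 2 + v x $ 2 *\<^sub>R axis 1 1)
      + ((-1 * x$2) *\<^sub>R G x $ 1 + v x $ 1 *\<^sub>R grad (\<lambda>x. -1 * x$2) x)" for x
  have sm: "smooth (\<lambda>x::real^3. - x$2)"
    using smooth_mult[OF smooth_const[of "-1"] smooth_component[of 2]] by simp
  have "weak_grad B g"
    using weak_grad_add[OF weak_grad_smooth_mult[OF weak_grad_component, of "\<lambda>x. x$1" 2]
        weak_grad_smooth_mult[OF weak_grad_component, of "\<lambda>x. -1 * x$2" 1]]
    unfolding B_def[abs_def] g_def[abs_def] by (simp add: sm)
  note B = weak_gradD[OF this]
  obtain fr fp fz where "AE x in lborel.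
      v x = fr (cyl_r x) (x$3) *\<^sub>R e_r x + fp (cyl_r x) (x$3) *\<^sub>R e_phi x + fz (cyl_r x) (x$3) *\<^sub>R e_z"
    using assms unfolding axisymmetric_def by blast
  then have Bb: "AE x in lborel. B x = (\<lambda>r z. r * fp r z) (cyl_r x) (x$3)"
  proof eventually_elim
    case (elim x)
    have sq: "x$1 * x$1 + x$2 * x$2 = cyl_r x * cyl_r x"
      by (simp add: cyl_r_def power2_eq_square)
    have "B x = fp (cyl_r x) (x$3) * ((x$1 * x$1 + x$2 * x$2) / cyl_r x)"
      by (subst (1 2) elim | simp add: B_def)+
         (simp add: B_def elim e_r_def e_phi_def e_z_def algebra_simps add_divide_distrib)
    then show ?case by (simp add: sq)
  qed
  have gg: "grad (\<lambda>x. - x$2) x = - axis 2 1" for x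
    using grad_mult[of "\<lambda>x. -1" "\<lambda>x. x$2" x] grad_chain[of "\<lambda>x. x$2" "\<lambda>t. -1" 0 x] by simp
  have "AE x in lborel. x$1 * g x $ 2 - x$2 * g x $ 1 = 0"
  proof (rule fundamental_lemma)
    show "locL2 (\<lambda>x. x$1 * g x $ 2 - x$2 * g x $ 1)"
      by (intro locL2_diff locL2_mult_smooth smooth_component B)
    fix \<phi> assume \<phi>: "test_fn \<phi>"
    have x\<phi>: "test_fn (\<lambda>x. x$i * \<phi> x)" for i by (intro test_fn_mult \<phi> smooth_component)
    note i1 = test_fn_locL2_integrable[OF test_fn_grad_nth[OF x\<phi>] B(1)] and i2 = test_fn_locL2_integrable[OF x\<phi> B(2)]
    have "(LINT x|lborel. (x$1 * g x $ 2 - x$2 * g x $ 1) * \<phi> x)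
        = (LINT x|lborel. g x $ 2 * (x$1 * \<phi> x) - g x $ 1 * (x$2 * \<phi> x))"
      by (simp add: algebra_simps)
    also have "\<dots> = - (LINT x|lborel. B x * grad (\<lambda>x. x$1 * \<phi> x) x $ 2 - B x * grad (\<lambda>x. x$2 * \<phi> x) x $ 1)"
      using i1 i2 B(3)[OF x\<phi>] by simp
    also have "\<dots> = - (LINT x|lborel. B x * swirl_deriv \<phi> x)"
      by (simp add: grad_mult test_fn_smooth[OF \<phi>] swirl_deriv_def axis_def algebra_simps)
    also have "\<dots> = 0" using axisymmetric_swirl_deriv[OF B(1) Bb \<phi>] by simp
    finally show "(LINT x|lborel. (x$1 * g x $ 2 - x$2 * g x $ 1) * \<phi> x) = 0" .
  qed
  then show ?thesis
    by eventually_elim (simp add: g_def gg axis_def power2_eq_square algebra_simps)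
qed

text \<open>Only \<open>r\<close> times the azimuthal vorticity is compared, because the remaining components of \<open>w\<close>
  need not be locally square integrable.\<close>

lemma curl_relation:
  assumes w: "weak_curl v w" and Z: "locL2 (\<lambda>x. x$1 * w x $ 2 - x$2 * w x $ 1)"
  shows "AE x in lborel. x$1 * w x $ 2 - x$2 * w x $ 1
    = (x$1 * G x $ 1 $ 3 + x$2 * G x $ 2 $ 3) - (x$1 * G x $ 3 $ 1 + x$2 * G x $ 3 $ 2)"
proof -
  have iw: "integrable lborel (\<lambda>x. \<phi> x *\<^sub>R w x)" if \<phi>: "test_fn \<phi>" for \<phi>
  proof -
    obtain R where R: "\<And>x. norm x > R \<Longrightarrow> \<phi> x = 0" using test_fn_support[OF \<phi>] by blast
    obtain M where M: "M > 0" "\<And>x. \<bar>\<phi> x\<bar> \<le> M" using test_fn_bounded[OF \<phi>] by blast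
    have int: "integrable lborel (\<lambda>x. indicator (cball 0 R) x *\<^sub>R w x)" and [measurable]: "w \<in> borel_measurable borel"
      using w by (auto simp: weak_curl_def locally_integrable_def set_integrable_def)
    have [measurable]: "\<phi> \<in> borel_measurable borel" using \<phi> by (rule test_fn_measurable)
    show ?thesis
    proof (rule Bochner_Integration.integrable_bound)
      show "integrable lborel (\<lambda>x. M *\<^sub>R (indicator (cball 0 R) x *\<^sub>R w x))" by (intro integrable_scaleR_right int)
      have "norm (\<phi> x *\<^sub>R w x) \<le> norm (M *\<^sub>R (indicator (cball 0 R) x *\<^sub>R w x))" for x
        using R[of x] M by (cases "norm x \<le> R") (auto intro: mult_right_mono)
      then show "AE x in lborel. norm (\<phi> x *\<^sub>R w x) \<le> norm (M *\<^sub>R (indicator (cball 0 R) x *\<^sub>R w x))" by simp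
    qed measurable
  qed
  have curl: "(LINT x|lborel. w x $ 1 * \<phi> x) = (LINT x|lborel. (G x $ 3 $ 2 - G x $ 2 $ 3) * \<phi> x)" (is ?c1)
    "(LINT x|lborel. w x $ 2 * \<phi> x) = (LINT x|lborel. (G x $ 1 $ 3 - G x $ 3 $ 1) * \<phi> x)" (is ?c2)
    "integrable lborel (\<lambda>x. w x $ k * \<phi> x)"
    if \<phi>: "test_fn \<phi>" for \<phi> k
  proof -
    note i1 = L2_mult_integrable[OF v_L2 test_fn_L2[OF test_fn_grad_nth[OF \<phi>]]]
    note i2 = L2_mult_integrable[OF G_L2 test_fn_L2[OF \<phi>]]
    let ?c = "\<lambda>x. cross3 (v x) (grad \<phi> x)"
    have ci: "integrable lborel (\<lambda>x. ?c x $ k)" for k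
      using i1 exhaust_3[of k] by (auto simp: cross3_def)
    have "integrable lborel (\<lambda>x. \<Sum>k\<in>UNIV. (?c x $ k) *\<^sub>R axis k (1::real))"
      using ci by (intro Bochner_Integration.integrable_sum integrable_scaleR_left)
    then have ic: "integrable lborel ?c"
      by (simp add: basis_expansion flip: scalar_mult_eq_scaleR)
    have eq: "(LINT x|lborel. \<phi> x *\<^sub>R w x) = (LINT x|lborel. ?c x)"
      using w \<phi> by (simp add: weak_curl_def)
    have "(LINT x|lborel. (\<phi> x *\<^sub>R w x) $ k) = (LINT x|lborel. ?c x $ k)" for k
      using arg_cong[OF eq, of "\<lambda>u. u $ k"]
        integral_bounded_linear[OF bounded_linear_vec_nth iw[OF \<phi>], of k]
        integral_bounded_linear[OF bounded_linear_vec_nth ic, of k] by simp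
    then have *: "(LINT x|lborel. w x $ k * \<phi> x) = (LINT x|lborel. ?c x $ k)" for k
      by (simp add: mult.commute)
    show ?c1 ?c2
      using *[of 1] *[of 2] i1 i2 weak_gradient_eq[OF \<phi>]
      by (simp_all add: cross3_def left_diff_distrib)
    show "integrable lborel (\<lambda>x. w x $ k * \<phi> x)"
      using integrable_bounded_linear[OF bounded_linear_vec_nth iw[OF \<phi>], of k] by (simp add: mult.commute)
  qed
  have "AE x in lborel. (x$1 * w x $ 2 - x$2 * w x $ 1)
    - ((x$1 * G x $ 1 $ 3 + x$2 * G x $ 2 $ 3) - (x$1 * G x $ 3 $ 1 + x$2 * G x $ 3 $ 2)) = 0"
  proof (rule fundamental_lemma)
    show "locL2 (\<lambda>x. (x$1 * w x $ 2 - x$2 * w x $ 1)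
      - ((x$1 * G x $ 1 $ 3 + x$2 * G x $ 2 $ 3) - (x$1 * G x $ 3 $ 1 + x$2 * G x $ 3 $ 2)))"
      by (intro Z locL2_add locL2_diff locL2_mult_smooth smooth_component L2_imp_locL2 G_L2)
    fix \<phi> assume \<phi>: "test_fn \<phi>"
    have x\<phi>: "test_fn (\<lambda>x. x$i * \<phi> x)" for i by (intro test_fn_mult \<phi> smooth_component)
    note i = L2_mult_integrable[OF G_L2 test_fn_L2[OF x\<phi>]] curl(3)[OF x\<phi>]
    have "(LINT x|lborel. ((x$1 * w x $ 2 - x$2 * w x $ 1)
      - ((x$1 * G x $ 1 $ 3 + x$2 * G x $ 2 $ 3) - (x$1 * G x $ 3 $ 1 + x$2 * G x $ 3 $ 2))) * \<phi> x)
      = (LINT x|lborel. (w x $ 2 * (x$1 * \<phi> x) - w x $ 1 * (x$2 * \<phi> x))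
        - ((G x $ 1 $ 3 - G x $ 3 $ 1) * (x$1 * \<phi> x) - (G x $ 3 $ 2 - G x $ 2 $ 3) * (x$2 * \<phi> x)))"
      by (rule Bochner_Integration.integral_cong) (simp_all add: algebra_simps)
    also have "\<dots> = 0"
      using i curl(1)[OF x\<phi>, of 2] curl(2)[OF x\<phi>, of 1] by (simp add: left_diff_distrib)
    finally show "(LINT x|lborel. ((x$1 * w x $ 2 - x$2 * w x $ 1)
      - ((x$1 * G x $ 1 $ 3 + x$2 * G x $ 2 $ 3) - (x$1 * G x $ 3 $ 1 + x$2 * G x $ 3 $ 2))) * \<phi> x) = 0" .
  qed
  then show ?thesis by simp
qed

end

section \<open>Integration by parts for weak gradients\<close>

text \<open>Both sides equal \<open>- \<integral> c \<partial>\<^sub>i \<partial>\<^sub>j \<phi>\<close>.\<close>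

lemma weak_grad_curl_free:
  assumes c: "weak_grad c h" and \<phi>: "test_fn \<phi>"
  shows "(LINT x|lborel. h x $ i * grad \<phi> x $ j) = (LINT x|lborel. h x $ j * grad \<phi> x $ i)"
  using weak_gradD(3)[OF c test_fn_grad_nth[OF \<phi>, of j], of i] weak_gradD(3)[OF c test_fn_grad_nth[OF \<phi>, of i], of j]
  by (simp add: grad_grad_commute[OF test_fn_smooth[OF \<phi>], where i = i and j = j])

lemma weak_div_product_integral:
  assumes a: "weak_grad a g" and H: "weak_div H d" and \<Psi>: "test_fn \<Psi>"
  shows "has_bochner_integral lborel
    (\<lambda>x. \<Psi> x * (H x \<bullet> g x) + a x * (\<Psi> x * d x + H x \<bullet> grad \<Psi> x)) 0"
proof -
  note aL = weak_gradD(1)[OF a] and gL = weak_gradD(2)[OF a]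
  have HL: "locL2 (\<lambda>x. H x $ j)" and dL: "locL2 d" for j using H by (auto simp: weak_div_def)
  have "integrable lborel (\<lambda>x. \<Psi> x * (H x \<bullet> g x))"
    using test_fn_mult_integrable[OF \<Psi> HL gL] by (simp add: inner_vec_def sum_3 algebra_simps)
  moreover have "integrable lborel (\<lambda>x. a x * (\<Psi> x * d x + H x \<bullet> grad \<Psi> x))"
    using test_fn_mult_integrable[OF \<Psi> aL dL] test_fn_mult_integrable[OF test_fn_grad_nth[OF \<Psi>] aL HL]
    by (simp add: inner_vec_def sum_3 algebra_simps)
  ultimately show ?thesis
    using weak_div_product[OF a H \<Psi>] by (simp add: has_bochner_integral_iff)
qed

text \<open>The Jacobian \<open>\<partial>\<^sub>i a \<partial>\<^sub>j c - \<partial>\<^sub>j a \<partial>\<^sub>i c\<close> is a divergence. This is the product rule for \<open>a\<close> and the field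
  \<open>\<Phi> (\<partial>\<^sub>j c e\<^sub>i - \<partial>\<^sub>i c e\<^sub>j)\<close>, whose divergence contains no second derivatives of \<open>c\<close>.\<close>

lemma weak_grad_wedge:
  assumes a: "weak_grad a g" and c: "weak_grad c h" and \<Phi>: "smooth \<Phi>" and \<eta>: "test_fn \<eta>"
  shows "has_bochner_integral lborel (\<lambda>x. \<eta> x * (\<Phi> x * (h x $ j * g x $ i - h x $ i * g x $ j))
    + a x * (\<eta> x * (h x $ j * grad \<Phi> x $ i - h x $ i * grad \<Phi> x $ j)
        + \<Phi> x * (h x $ j * grad \<eta> x $ i - h x $ i * grad \<eta> x $ j))) 0"
proof -
  note hL = weak_gradD(2)[OF c]
  define H where "H x = (\<Phi> x * h x $ j) *\<^sub>R axis i 1 - (\<Phi> x * h x $ i) *\<^sub>R axis j (1::real)" for x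
  define d where "d x = grad \<Phi> x $ i * h x $ j - grad \<Phi> x $ j * h x $ i" for x
  have inner_H: "H x \<bullet> u = \<Phi> x * (h x $ j * u $ i - h x $ i * u $ j)" for x u
    by (simp add: H_def inner_diff_left inner_axis' right_diff_distrib mult.assoc)
  have "weak_div H d"
    unfolding weak_div_def
  proof (intro conjI allI impI)
    show "locL2 (\<lambda>x. H x $ k)" for k
    proof -
      have "locL2 (\<lambda>x. axis i 1 $ k * (\<Phi> x * h x $ j) - axis j 1 $ k * (\<Phi> x * h x $ i))"
        by (intro locL2_diff locL2_cmult locL2_mult_smooth \<Phi> hL)
      then show ?thesis by (simp add: H_def mult.commute)
    qed
    show "locL2 d"
      unfolding d_def[abs_def] by (intro locL2_diff locL2_mult_smooth smooth_grad_nth \<Phi> hL)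
    fix \<phi> assume \<phi>: "test_fn \<phi>"
    have \<Phi>\<phi>: "test_fn (\<lambda>x. \<Phi> x * \<phi> x)" by (intro test_fn_mult \<Phi> \<phi>)
    note i1 = test_fn_locL2_integrable[OF test_fn_grad_nth[OF \<Phi>\<phi>] hL] and i2 = test_fn_locL2_integrable[OF \<phi>, of d]
    have "(LINT x|lborel. H x \<bullet> grad \<phi> x) = (LINT x|lborel.
        (h x $ j * grad (\<lambda>x. \<Phi> x * \<phi> x) x $ i - h x $ i * grad (\<lambda>x. \<Phi> x * \<phi> x) x $ j) - d x * \<phi> x)"
      by (rule Bochner_Integration.integral_cong)
         (simp_all add: inner_H d_def grad_mult \<Phi> test_fn_smooth[OF \<phi>] algebra_simps)
    also have "\<dots> = - (LINT x|lborel. d x * \<phi> x)"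
      using i1 i2 \<open>locL2 d\<close> weak_grad_curl_free[OF c \<Phi>\<phi>, of i j] by simp
    finally show "(LINT x|lborel. H x \<bullet> grad \<phi> x) = - (LINT x|lborel. d x * \<phi> x)" .
  qed
  from weak_div_product_integral[OF a this \<eta>] show ?thesis
    by (simp add: inner_H d_def mult.commute)
qed

text \<open>The product rule for \<open>a\<close> and the field \<open>\<Phi> a e\<^sub>j\<close>, which integrates \<open>\<Phi> \<partial>\<^sub>j (a\<^sup>2) / 2\<close> by parts.\<close>

lemma weak_grad_square:
  assumes a: "weak_grad a g" and \<Phi>: "smooth \<Phi>" and \<eta>: "test_fn \<eta>"
  shows "has_bochner_integral lborel (\<lambda>x. \<eta> x * (\<Phi> x * (a x * g x $ j))
    + a x * (\<eta> x * (\<Phi> x * g x $ j + a x * grad \<Phi> x $ j) + \<Phi> x * (a x * grad \<eta> x $ j))) 0"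
proof -
  note b = weak_gradD[OF weak_grad_smooth_mult[OF a \<Phi>]]
  define H where "H x = (\<Phi> x * a x) *\<^sub>R axis j (1::real)" for x
  have inner_H: "H x \<bullet> u = \<Phi> x * a x * u $ j" for x u
    by (simp add: H_def inner_axis')
  have "weak_div H (\<lambda>x. (\<Phi> x *\<^sub>R g x + a x *\<^sub>R grad \<Phi> x) $ j)"
    unfolding weak_div_def
  proof (intro conjI allI impI)
    show "locL2 (\<lambda>x. H x $ k)" for k
      using locL2_cmult[OF b(1), of "axis j 1 $ k"] by (simp add: H_def mult.commute)
    show "locL2 (\<lambda>x. (\<Phi> x *\<^sub>R g x + a x *\<^sub>R grad \<Phi> x) $ j)" by (rule b)
    fix \<phi> assume "test_fn \<phi>"
    then show "(LINT x|lborel. H x \<bullet> grad \<phi> x) = - (LINT x|lborel. (\<Phi> x *\<^sub>R g x + a x *\<^sub>R grad \<Phi> x) $ j * \<phi> x)"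
      unfolding inner_H by (rule b)
  qed
  from weak_div_product_integral[OF a this \<eta>] show ?thesis
    by (simp add: inner_H mult.assoc)
qed

section \<open>A regularized weight\<close>

text \<open>Smooth functions of the squared distance to the axis are smooth in space, unlike those of
  the distance.\<close>

definition hsq :: "real^3 \<Rightarrow> real" where "hsq x = (x$1)\<^sup>2 + (x$2)\<^sup>2"

lemma hsq_nonneg [simp]: "hsq x \<ge> 0" by (simp add: hsq_def)

lemma smooth_hsq: "smooth hsq"
  unfolding hsq_def[abs_def] by (intro smooth_add smooth_power smooth_component)

lemma grad_hsq: "grad hsq x = (2 * x$1) *\<^sub>R axis 1 1 + (2 * x$2) *\<^sub>R axis 2 1"
  unfolding hsq_def[abs_def]
  by (simp add: grad_add grad_mult smooth_mult power2_eq_square flip: scaleR_2) 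

lemma grad_radial:
  assumes F: "smooth (\<lambda>x. F (hsq x))" "(F has_real_derivative F') (at (hsq x))"
  shows "grad (\<lambda>x. x$j * F (hsq x)) x = F (hsq x) *\<^sub>R axis j 1 + (x$j * F') *\<^sub>R grad hsq x"
  using grad_mult[OF smooth_component F(1), of j x] grad_chain[OF smooth_hsq F(2)] by simp

lemma smooth_powr:
  assumes P: "smooth P" "\<And>x. P x > 0" shows "smooth (\<lambda>x. P x powr p)"
proof -
  define g where "g k t = (\<Prod>i<k. p - real i) * t powr (p - real k)" for k t
  have "smooth (\<lambda>x. g 0 (P x))"
  proof (rule smooth_compose[where S = "{0<..}" and g = g])
    fix k :: nat and t :: real assume "t \<in> {0<..}"
    then have t: "t > 0" by simp
    have "((\<lambda>t. t powr (p - real k)) has_real_derivative (p - real k) * t powr (p - real k - 1)) (at t)"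
      using t by (rule has_real_derivative_powr)
    from DERIV_cmult[OF this, of "\<Prod>i<k. p - real i"]
    show "(g k has_real_derivative g (Suc k) t) (at t)"
      unfolding g_def[abs_def] by (simp add: algebra_simps)
  qed (use P in auto)
  then show ?thesis by (simp add: g_def)
qed

lemma smooth_inverse:
  assumes P: "smooth P" "\<And>x. P x > 0" shows "smooth (\<lambda>x. 1 / P x)"
proof -
  have "P x powr (-1) = 1 / P x" for x using P(2)[of x] by (simp add: powr_minus divide_inverse)
  then show ?thesis using smooth_powr[OF P, of "-1"] by simp
qed

text \<open>For \<open>e = d = 0\<close> this is \<open>t\<close> to the power \<open>-5/2\<close>, so that \<open>t\<^sup>2 wt e d t\<close> at \<open>t = r\<^sup>2\<close> is a regularization of the weight
  \<open>1 / r\<close>. The functions \<open>wt1\<close> and \<open>wt2\<close> are its first two derivatives.\<close>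

definition wt :: "real \<Rightarrow> real \<Rightarrow> real \<Rightarrow> real"
  where "wt e d t = (t + e) powr (-1/2) * (t + d) powr (-2)"

definition wt1 :: "real \<Rightarrow> real \<Rightarrow> real \<Rightarrow> real"
  where "wt1 e d t = wt e d t * (- (1/2) * (1 / (t + e)) - 2 * (1 / (t + d)))"

definition wt2 :: "real \<Rightarrow> real \<Rightarrow> real \<Rightarrow> real"
  where "wt2 e d t = wt e d t *
    (3/4 * (1 / (t + e))\<^sup>2 + 2 * (1 / (t + e)) * (1 / (t + d)) + 6 * (1 / (t + d))\<^sup>2)"

lemma wt_deriv:
  assumes "t + e > 0" "t + d > 0"
  shows "(wt e d has_real_derivative wt1 e d t) (at t)" "(wt1 e d has_real_derivative wt2 e d t) (at t)"
proof -
  have p: "((\<lambda>t. (t + c) powr q) has_real_derivative q * ((t + c) powr q * (1 / (t + c)))) (at t)"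
    if "t + c > 0" for c q
    using DERIV_chain2[where f = "\<lambda>z. z powr q" and g = "\<lambda>t. t + c" and x = t and Db = 1,
        OF has_real_derivative_powr[OF that, of q]] that
    by (auto intro!: derivative_eq_intros simp: powr_diff)
  have i: "((\<lambda>t. 1 / (t + c)) has_real_derivative - ((1 / (t + c))\<^sup>2)) (at t)" if "t + c > 0" for c
    using that by (auto intro!: derivative_eq_intros simp: power2_eq_square)
  have "((\<lambda>t. (t + e) powr (-1/2) * (t + d) powr (-2)) has_real_derivative
    (-1/2) * ((t + e) powr (-1/2) * (1 / (t + e))) * (t + d) powr (-2) +
    (-2) * ((t + d) powr (-2) * (1 / (t + d))) * (t + e) powr (-1/2)) (at t)"
    by (rule DERIV_mult'[OF p[OF assms(1)] p[OF assms(2)], THEN DERIV_cong]) (simp add: algebra_simps)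
  then show 1: "(wt e d has_real_derivative wt1 e d t) (at t)"
    unfolding wt_def[abs_def] wt1_def by (rule DERIV_cong) (simp add: algebra_simps)
  have "((\<lambda>t. - (1/2) * (1 / (t + e)) - 2 * (1 / (t + d))) has_real_derivative
      - (1/2) * (- ((1 / (t + e))\<^sup>2)) - 2 * (- ((1 / (t + d))\<^sup>2))) (at t)"
    by (intro DERIV_diff DERIV_cmult i assms)
  from DERIV_mult'[OF 1 this] show "(wt1 e d has_real_derivative wt2 e d t) (at t)"
    unfolding wt1_def[abs_def] wt2_def wt1_def
  proof (rule DERIV_cong)
    have "w * (- (1/2) * (- (I\<^sup>2)) - 2 * (- (J\<^sup>2))) + w * (- (1/2) * I - 2 * J) * (- (1/2) * I - 2 * J)
      = w * (3/4 * I\<^sup>2 + 2 * I * J + 6 * J\<^sup>2)" for w I J :: real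
      by (simp add: field_simps power2_eq_square)
    then show "wt e d t * (- (1/2) * (- ((1 / (t + e))\<^sup>2)) - 2 * (- ((1 / (t + d))\<^sup>2)))
      + wt e d t * (- (1/2) * (1 / (t + e)) - 2 * (1 / (t + d))) * (- (1/2) * (1 / (t + e)) - 2 * (1 / (t + d)))
      = wt e d t * (3/4 * (1 / (t + e))\<^sup>2 + 2 * (1 / (t + e)) * (1 / (t + d)) + 6 * (1 / (t + d))\<^sup>2)" .
  qed
qed

lemma wt_nonneg: "0 \<le> wt e d t" by (simp add: wt_def)

lemma wt_smooth:
  assumes "e > 0" "d > 0"
  shows "smooth (\<lambda>x. wt e d (hsq x))" "smooth (\<lambda>x. wt1 e d (hsq x))"
proof -
  have *: "smooth (\<lambda>x. hsq x + c)" for c by (intro smooth_add smooth_hsq smooth_const)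
  have pos: "hsq x + e > 0" "hsq x + d > 0" for x
    using assms hsq_nonneg[of x] by (auto intro: add_nonneg_pos)
  show 1: "smooth (\<lambda>x. wt e d (hsq x))"
    unfolding wt_def by (intro smooth_mult smooth_powr * pos)
  show "smooth (\<lambda>x. wt1 e d (hsq x))"
    unfolding wt1_def by (intro smooth_mult smooth_diff smooth_inverse smooth_const 1 * pos)
qed

lemma wt_square_le:
  assumes "e > 0" "d > 0" "t \<ge> 0" shows "t\<^sup>2 * wt e d t \<le> (t + e) powr (-1/2)"
proof -
  have "t\<^sup>2 * (t + d) powr (-2) \<le> 1"
    using assms by (simp add: powr_minus powr_numeral field_simps power_mono)
  then have "(t + e) powr (-1/2) * (t\<^sup>2 * (t + d) powr (-2)) \<le> (t + e) powr (-1/2) * 1"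
    by (intro mult_left_mono) auto
  then show ?thesis by (simp add: wt_def mult_ac)
qed

lemma powr_half_antimono: "e > 0 \<Longrightarrow> t \<ge> 0 \<Longrightarrow> (t + e) powr (-1/2) \<le> e powr (-1/2)" for e t :: real
  by (rule powr_mono2') auto

lemma wt_coefficient_le:
  assumes "e > 0" "d > 0" "t \<ge> 0"
  shows "\<bar>3 * wt e d t + t * wt1 e d t\<bar> \<le> 3 * wt e d t"
proof -
  define a b where "a = t * (1 / (t + e))" and "b = t * (1 / (t + d))"
  have ab: "0 \<le> a" "a \<le> 1" "0 \<le> b" "b \<le> 1" using assms by (auto simp: a_def b_def)
  have "3 * wt e d t + t * wt1 e d t = wt e d t * (3 - a / 2 - 2 * b)"
    by (simp add: wt1_def a_def b_def algebra_simps)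
  also have "\<bar>\<dots>\<bar> \<le> wt e d t * 3"
    unfolding abs_mult using ab wt_nonneg[of e d t] by (intro mult_mono) auto
  finally show ?thesis by simp
qed

text \<open>The right-hand side is the coefficient of \<open>(r v\<^sub>r)\<^sup>2\<close> that the integrations by parts produce. With
  \<open>a = t / (t + e)\<close> and \<open>b = t / (t + d)\<close> it is \<open>wt e d t\<close> times a polynomial in \<open>a\<close>, \<open>b\<close>. Away from the
  axis \<open>b\<close> is close to \<open>1\<close>, and at \<open>b = 1\<close> this polynomial is \<open>1 + a - 3 a\<^sup>2 / 2 \<ge> 1 / 2\<close>.\<close>

lemma wt_coercive:
  assumes "e > 0" "d > 0" "t \<ge> 0"
  shows "wt e d t * (1/2 - 8 * (d / (t + d)))
    \<le> - 7 * wt e d t - 10 * t * wt1 e d t - 2 * t\<^sup>2 * wt2 e d t"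
proof -
  define a b where "a = t * (1 / (t + e))" and "b = t * (1 / (t + d))"
  have ab: "0 \<le> a" "a \<le> 1" "0 \<le> b" "b \<le> 1" using assms by (auto simp: a_def b_def)
  have d: "d / (t + d) = 1 - b" using assms by (simp add: b_def field_simps)
  have "- 7 * wt e d t - 10 * t * wt1 e d t - 2 * t\<^sup>2 * wt2 e d t
      = wt e d t * (- 7 + 5 * a + 20 * b - 3/2 * a\<^sup>2 - 4 * a * b - 12 * b\<^sup>2)"
  proof -
    have "- 7 * w - 10 * t * (w * (- (1/2) * I - 2 * J))
        - 2 * t\<^sup>2 * (w * (3/4 * I\<^sup>2 + 2 * I * J + 6 * J\<^sup>2))
      = w * (- 7 + 5 * (t * I) + 20 * (t * J) - 3/2 * (t * I)\<^sup>2 - 4 * (t * I) * (t * J) - 12 * (t * J)\<^sup>2)"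
      for w I J :: real
      by (simp add: algebra_simps power2_eq_square)
    then show ?thesis unfolding wt1_def wt2_def a_def b_def .
  qed
  moreover have "wt e d t * (1/2 - 8 * (1 - b))
      \<le> wt e d t * (- 7 + 5 * a + 20 * b - 3/2 * a\<^sup>2 - 4 * a * b - 12 * b\<^sup>2)"
  proof (intro mult_left_mono wt_nonneg)
    have "1/2 - 8 * (1 - b) + ((1 - a) * (1 + 3 * a) / 2 + (1 - b) * (4 * a + 12 * b))
        = - 7 + 5 * a + 20 * b - 3/2 * a\<^sup>2 - 4 * a * b - 12 * b\<^sup>2"
      by (simp add: field_simps power2_eq_square)
    moreover have "0 \<le> (1 - a) * (1 + 3 * a) / 2 + (1 - b) * (4 * a + 12 * b)"
      using ab by (intro add_nonneg_nonneg mult_nonneg_nonneg divide_nonneg_nonneg) auto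
    ultimately show "1/2 - 8 * (1 - b) \<le> - 7 + 5 * a + 20 * b - 3/2 * a\<^sup>2 - 4 * a * b - 12 * b\<^sup>2"
      by linarith
  qed
  ultimately show ?thesis unfolding d by simp
qed

text \<open>Here \<open>s\<close> is the squared distance to the axis, \<open>m\<close>, \<open>m1\<close>, \<open>m2\<close> are the weight and its
  derivatives, \<open>A = r v\<^sub>r\<close>, \<open>P = r \<partial>\<^sub>r A\<close>, \<open>Q = \<partial>\<^sub>z A\<close>, \<open>E = r \<partial>\<^sub>r v\<^sub>z\<close>, \<open>c = \<partial>\<^sub>z v\<^sub>z\<close>, and \<open>\<eta>\<close>, \<open>X3\<close>, \<open>XX\<close> are the cutoff and its derivatives
  \<open>\<partial>\<^sub>z \<eta>\<close>, \<open>r \<partial>\<^sub>r \<eta>\<close>. The two brackets on the right are the integrands of the two integrations by parts and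
  have integral zero. After elimination of \<open>c\<close> the two sides differ by two squares: one absorbs \<open>Q\<close> by
  Young's inequality, the other is \<open>(P - A)\<^sup>2\<close>, the square of \<open>r\<^sup>2 \<partial>\<^sub>r v\<^sub>r\<close>.\<close>

lemma pointwise_inequality:
  fixes s m m1 m2 \<eta> A Q E c P X3 XX :: real
  assumes P: "P = - (s * c)" and "s \<ge> 0" "m \<ge> 0" "\<eta> \<ge> 0"
  defines "k \<equiv> 3 * m + s * m1" and "k1 \<equiv> 4 * m1 + s * m2"
  shows "\<eta> * ((- 7 * m - 10 * s * m1 - 2 * s\<^sup>2 * m2) * A\<^sup>2 - s * m * (Q - E)\<^sup>2 / 4)
      - A * (s * m) * (c * XX - E * X3) - A\<^sup>2 * k * XX
    \<le> (\<eta> * (s * m * (E * Q - c * P)) - A * (\<eta> * (c * (4 * (s * m) + 2 * (s * (s * m1)))) - s * m * (E * X3 - c * XX)))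
      - (2 * (\<eta> * (k * (A * P))) + A\<^sup>2 * (\<eta> * (2 * k + 2 * s * k1) + k * XX))"
proof -
  define z where "z = (Q - E) / 2"
  have E: "E = Q - 2 * z" and z: "s * m * (Q - E)\<^sup>2 / 4 = s * m * z\<^sup>2"
    by (simp add: z_def field_simps, simp add: z_def power_divide)
  have "0 \<le> \<eta> * (s * m * (Q - z)\<^sup>2 + m * (P - A)\<^sup>2)"
    using assms(2-4) by (intro mult_nonneg_nonneg add_nonneg_nonneg) auto
  also have "\<dots> = ((\<eta> * (s * m * (E * Q - c * P)) - A * (\<eta> * (c * (4 * (s * m) + 2 * (s * (s * m1)))) - s * m * (E * X3 - c * XX)))
      - (2 * (\<eta> * (k * (A * P))) + A\<^sup>2 * (\<eta> * (2 * k + 2 * s * k1) + k * XX)))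
     - (\<eta> * ((- 7 * m - 10 * s * m1 - 2 * s\<^sup>2 * m2) * A\<^sup>2 - s * m * (Q - E)\<^sup>2 / 4)
      - A * (s * m) * (c * XX - E * X3) - A\<^sup>2 * k * XX)"
    unfolding z unfolding E k_def k1_def P by (simp add: algebra_simps power2_eq_square)
  finally show ?thesis by simp
qed

context weak_field
begin

text \<open>The functions \<open>r v\<^sub>r\<close>, its weak gradient, \<open>r \<partial>\<^sub>r (r v\<^sub>r)\<close>, \<open>\<partial>\<^sub>z (r v\<^sub>r)\<close>, \<open>r \<partial>\<^sub>r v\<^sub>z\<close> and \<open>r \<partial>\<^sub>r \<eta>\<close>, all written
  without division by \<open>r\<close>.\<close>

definition rvr :: "real^3 \<Rightarrow> real" where "rvr x = x$1 * v x $ 1 + x$2 * v x $ 2"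

definition rvr_grad :: "real^3 \<Rightarrow> real^3"
  where "rvr_grad x = (x$1 *\<^sub>R G x $ 1 + v x $ 1 *\<^sub>R axis 1 1) + (x$2 *\<^sub>R G x $ 2 + v x $ 2 *\<^sub>R axis 2 1)"

lemma weak_grad_rvr: "weak_grad rvr rvr_grad"
  using weak_grad_add[OF weak_grad_smooth_mult[OF weak_grad_component[of 1] smooth_component[of 1]]
      weak_grad_smooth_mult[OF weak_grad_component[of 2] smooth_component[of 2]]]
  unfolding rvr_def[abs_def] rvr_grad_def[abs_def] by simp

definition radial_rvr :: "real^3 \<Rightarrow> real"
  where "radial_rvr x = x$1 * rvr_grad x $ 1 + x$2 * rvr_grad x $ 2"

definition dz_rvr :: "real^3 \<Rightarrow> real" where "dz_rvr x = rvr_grad x $ 3"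

definition radial_vz :: "real^3 \<Rightarrow> real" where "radial_vz x = x$1 * G x $ 3 $ 1 + x$2 * G x $ 3 $ 2"

definition radial :: "(real^3 \<Rightarrow> real) \<Rightarrow> real^3 \<Rightarrow> real"
  where "radial \<eta> x = x$1 * grad \<eta> x $ 1 + x$2 * grad \<eta> x $ 2"

lemma grad_x_radial:
  assumes "smooth (\<lambda>x. F (hsq x))" "(F has_real_derivative F') (at (hsq x))"
  shows "grad (\<lambda>x. x$j * F (hsq x)) x $ 3 = (if j = 3 then F (hsq x) else 0)"
    "grad (\<lambda>x. x$1 * F (hsq x)) x $ 1 = F (hsq x) + 2 * (x$1)\<^sup>2 * F'"
    "grad (\<lambda>x. x$2 * F (hsq x)) x $ 2 = F (hsq x) + 2 * (x$2)\<^sup>2 * F'"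
  using grad_radial[OF assms] by (auto simp: grad_hsq axis_def power2_eq_square)

text \<open>The Jacobian identity for \<open>r v\<^sub>r\<close> and \<open>v\<^sub>z\<close> in the planes spanned by the axis and each of the two
  horizontal directions, with coefficients \<open>x\<^sub>j F (r\<^sup>2)\<close>. The sum of \<open>\<partial>\<^sub>j (x\<^sub>j F (r\<^sup>2))\<close> over the horizontal
  directions is \<open>2 F + 2 r\<^sup>2 F'\<close>.\<close>

lemma wedge_identity:
  assumes \<eta>: "test_fn \<eta>" and F: "smooth (\<lambda>x. F (hsq x))"
    and F': "\<And>x. (F has_real_derivative F' (hsq x)) (at (hsq x))"
  shows "has_bochner_integral lborel (\<lambda>x.
    \<eta> x * (F (hsq x) * (radial_vz x * dz_rvr x - G x $ 3 $ 3 * radial_rvr x))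
    - rvr x * (\<eta> x * (G x $ 3 $ 3 * (2 * F (hsq x) + 2 * hsq x * F' (hsq x)))
      - F (hsq x) * (radial_vz x * grad \<eta> x $ 3 - G x $ 3 $ 3 * radial \<eta> x))) 0"
proof -
  have \<Phi>: "smooth (\<lambda>x. x$j * F (hsq x))" for j
    by (intro smooth_mult smooth_component F)
  from has_bochner_integral_add[OF
      weak_grad_wedge[OF weak_grad_rvr weak_grad_component[of 3] \<Phi>[of 1] \<eta>, where i = 3 and j = 1]
      weak_grad_wedge[OF weak_grad_rvr weak_grad_component[of 3] \<Phi>[of 2] \<eta>, where i = 3 and j = 2]]
  have "has_bochner_integral lborel (\<lambda>x.
      (\<eta> x * (x$1 * F (hsq x) * (G x $ 3 $ 1 * rvr_grad x $ 3 - G x $ 3 $ 3 * rvr_grad x $ 1))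
    + rvr x * (\<eta> x * (G x $ 3 $ 1 * 0 - G x $ 3 $ 3 * (F (hsq x) + 2 * (x$1)\<^sup>2 * F' (hsq x)))
        + x$1 * F (hsq x) * (G x $ 3 $ 1 * grad \<eta> x $ 3 - G x $ 3 $ 3 * grad \<eta> x $ 1)))
      + (\<eta> x * (x$2 * F (hsq x) * (G x $ 3 $ 2 * rvr_grad x $ 3 - G x $ 3 $ 3 * rvr_grad x $ 2))
    + rvr x * (\<eta> x * (G x $ 3 $ 2 * 0 - G x $ 3 $ 3 * (F (hsq x) + 2 * (x$2)\<^sup>2 * F' (hsq x)))
        + x$2 * F (hsq x) * (G x $ 3 $ 2 * grad \<eta> x $ 3 - G x $ 3 $ 3 * grad \<eta> x $ 2)))) 0"
    by (simp add: grad_x_radial[OF F F'])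
  then show ?thesis
    by (rule has_bochner_integral_cong[THEN iffD1, rotated 3])
       (simp_all add: radial_vz_def dz_rvr_def radial_rvr_def radial_def hsq_def algebra_simps)
qed

text \<open>Integration by parts of \<open>F (r\<^sup>2) r \<partial>\<^sub>r (A\<^sup>2)\<close> for \<open>A = r v\<^sub>r\<close>.\<close>

lemma square_identity:
  assumes \<eta>: "test_fn \<eta>" and F: "smooth (\<lambda>x. F (hsq x))"
    and F': "\<And>x. (F has_real_derivative F' (hsq x)) (at (hsq x))"
  shows "has_bochner_integral lborel (\<lambda>x.
    2 * (\<eta> x * (F (hsq x) * (rvr x * radial_rvr x)))
    + (rvr x)\<^sup>2 * (\<eta> x * (2 * F (hsq x) + 2 * hsq x * F' (hsq x)) + F (hsq x) * radial \<eta> x)) 0"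
proof -
  have \<Phi>: "smooth (\<lambda>x. x$j * F (hsq x))" for j
    by (intro smooth_mult smooth_component F)
  from has_bochner_integral_add[OF
      weak_grad_square[OF weak_grad_rvr \<Phi>[of 1] \<eta>, where j = 1]
      weak_grad_square[OF weak_grad_rvr \<Phi>[of 2] \<eta>, where j = 2]]
  have "has_bochner_integral lborel (\<lambda>x.
      (\<eta> x * (x$1 * F (hsq x) * (rvr x * rvr_grad x $ 1))
    + rvr x * (\<eta> x * (x$1 * F (hsq x) * rvr_grad x $ 1 + rvr x * (F (hsq x) + 2 * (x$1)\<^sup>2 * F' (hsq x)))
        + x$1 * F (hsq x) * (rvr x * grad \<eta> x $ 1)))
      + (\<eta> x * (x$2 * F (hsq x) * (rvr x * rvr_grad x $ 2))
    + rvr x * (\<eta> x * (x$2 * F (hsq x) * rvr_grad x $ 2 + rvr x * (F (hsq x) + 2 * (x$2)\<^sup>2 * F' (hsq x)))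
        + x$2 * F (hsq x) * (rvr x * grad \<eta> x $ 2)))) 0"
    by (simp add: grad_x_radial[OF F F'])
  then show ?thesis
    by (rule has_bochner_integral_cong[THEN iffD1, rotated 3])
       (simp_all add: radial_rvr_def radial_def hsq_def algebra_simps power2_eq_square)
qed

definition energy :: "real^3 \<Rightarrow> real"
  where "energy x = (\<Sum>i\<in>UNIV. (v x $ i)\<^sup>2) + (\<Sum>i\<in>UNIV. \<Sum>j\<in>UNIV. (G x $ i $ j)\<^sup>2)"

lemma energy_integrable: "integrable lborel energy"
  unfolding energy_def[abs_def] using v_L2 G_L2
  by (intro Bochner_Integration.integrable_add Bochner_Integration.integrable_sum) (auto simp: L2_def)

lemma energy_nonneg: "0 \<le> energy x"
  unfolding energy_def by (intro add_nonneg_nonneg sum_nonneg) auto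

end

lemma plane_cauchy_schwarz: "(a * b + c * d)\<^sup>2 \<le> (a\<^sup>2 + c\<^sup>2) * (b\<^sup>2 + d\<^sup>2)" for a b c d :: real
proof -
  have "0 \<le> (a * d - c * b)\<^sup>2" by simp
  also have "\<dots> = (a\<^sup>2 + c\<^sup>2) * (b\<^sup>2 + d\<^sup>2) - (a * b + c * d)\<^sup>2"
    by (simp add: algebra_simps power2_eq_square)
  finally show ?thesis by simp
qed

text \<open>Estimating \<open>\<bar>A\<bar>\<close> once by \<open>r \<bar>v\<bar>\<close> and once by \<open>r\<^sup>2 \<bar>\<nabla>v\<bar>\<close> leaves the factor \<open>s\<^sup>2 m\<close>, which for
  \<open>m = wt e d s\<close> is bounded uniformly in \<open>d\<close>. Using the first bound twice would leave a factor that
  blows up near the axis as \<open>d\<close> tends to \<open>0\<close>.\<close>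

lemma error_bound:
  fixes s m k A c E XX X3 a b g Ce :: real
  assumes "0 \<le> s" "0 \<le> m" "\<bar>k\<bar> \<le> 3 * m" "s\<^sup>2 * m \<le> Ce" "0 \<le> a" "0 \<le> b" "0 \<le> g"
    and "\<bar>A\<bar> \<le> sqrt s * a" "\<bar>A\<bar> \<le> s * b" "\<bar>E\<bar> \<le> sqrt s * b" "\<bar>c\<bar> \<le> b" "\<bar>XX\<bar> \<le> sqrt s * g" "\<bar>X3\<bar> \<le> g"
  shows "\<bar>A * (s * m) * (c * XX - E * X3) + A\<^sup>2 * k * XX\<bar> \<le> 5 * Ce * g * (a\<^sup>2 + b\<^sup>2)"
proof -
  have ss: "sqrt s * sqrt s = s" using assms(1) by simp
  have "\<bar>A * (s * m) * (c * XX)\<bar> = \<bar>A\<bar> * (s * m) * (\<bar>c\<bar> * \<bar>XX\<bar>)"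
    using assms(1,2) by (simp add: abs_mult)
  also have "\<dots> \<le> (sqrt s * a) * (s * m) * (b * (sqrt s * g))"
    by (intro mult_mono mult_nonneg_nonneg assms abs_ge_zero real_sqrt_ge_zero order_refl)
  also have "\<dots> = (sqrt s * sqrt s) * s * m * (a * b * g)" by (simp add: mult_ac)
  finally have 1: "\<bar>A * (s * m) * (c * XX)\<bar> \<le> s\<^sup>2 * m * (a * b * g)" unfolding ss by (simp add: power2_eq_square)
  have "\<bar>A * (s * m) * (E * X3)\<bar> = \<bar>A\<bar> * (s * m) * (\<bar>E\<bar> * \<bar>X3\<bar>)"
    using assms(1,2) by (simp add: abs_mult)
  also have "\<dots> \<le> (sqrt s * a) * (s * m) * ((sqrt s * b) * g)"
    by (intro mult_mono mult_nonneg_nonneg assms abs_ge_zero real_sqrt_ge_zero order_refl)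
  also have "\<dots> = (sqrt s * sqrt s) * s * m * (a * b * g)" by (simp add: mult_ac)
  finally have 2: "\<bar>A * (s * m) * (E * X3)\<bar> \<le> s\<^sup>2 * m * (a * b * g)" unfolding ss by (simp add: power2_eq_square)
  have "\<bar>A\<^sup>2 * k * XX\<bar> = (\<bar>A\<bar> * \<bar>A\<bar>) * \<bar>k\<bar> * \<bar>XX\<bar>" by (simp add: abs_mult power2_eq_square)
  also have "\<dots> \<le> ((sqrt s * a) * (s * b)) * (3 * m) * (sqrt s * g)"
    by (intro mult_mono mult_nonneg_nonneg assms abs_ge_zero real_sqrt_ge_zero zero_le_numeral order_refl)
  also have "\<dots> = (sqrt s * sqrt s) * s * m * (a * b * g) * 3" by (simp add: mult_ac)
  finally have 3: "\<bar>A\<^sup>2 * k * XX\<bar> \<le> s\<^sup>2 * m * (a * b * g) * 3" unfolding ss by (simp add: power2_eq_square)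
  have ab: "a * b \<le> a\<^sup>2 + b\<^sup>2"
    using assms(5,6) sum_squares_bound[of a b] mult_nonneg_nonneg[of a b] by linarith
  have Ce: "0 \<le> Ce" using assms(2,4) by (intro order.trans[OF _ assms(4)]) simp
  have "s\<^sup>2 * m * (a * b * g) \<le> Ce * ((a\<^sup>2 + b\<^sup>2) * g)"
    by (intro mult_mono mult_right_mono mult_nonneg_nonneg add_nonneg_nonneg zero_le_power2 ab assms Ce)
  moreover have "\<bar>A * (s * m) * (c * XX - E * X3) + A\<^sup>2 * k * XX\<bar>
      \<le> \<bar>A * (s * m) * (c * XX)\<bar> + \<bar>A * (s * m) * (E * X3)\<bar> + \<bar>A\<^sup>2 * k * XX\<bar>"
    unfolding right_diff_distrib by linarith
  moreover have "5 * Ce * g * (a\<^sup>2 + b\<^sup>2) = 5 * (Ce * ((a\<^sup>2 + b\<^sup>2) * g))" by simp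
  ultimately show ?thesis using 1 2 3 by linarith
qed

lemma abs_le_sqrt_mult:
  fixes y s z :: real
  assumes "y\<^sup>2 \<le> s * z\<^sup>2" "0 \<le> z" shows "\<bar>y\<bar> \<le> sqrt s * z"
  using real_sqrt_le_mono[OF assms(1)] assms(2) by (simp add: real_sqrt_mult)

lemma norm_square_3: "(norm x)\<^sup>2 = (x $ 1)\<^sup>2 + (x $ 2)\<^sup>2 + (x $ 3)\<^sup>2" for x :: "real^3"
  unfolding power2_norm_eq_inner inner_vec_def sum_3 by (simp add: power2_eq_square)

lemma regularization_fraction:
  fixes d s :: real
  assumes "0 < d" "0 \<le> s" shows "0 \<le> d / (s + d)" "d / (s + d) \<le> 1"
proof -
  have "0 < s + d" using assms by simp
  then show "0 \<le> d / (s + d)" "d / (s + d) \<le> 1" using assms by simp_all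
qed

lemma abs_le_of_square: "y\<^sup>2 \<le> z\<^sup>2 \<Longrightarrow> 0 \<le> z \<Longrightarrow> \<bar>y\<bar> \<le> z" for y z :: real
  using abs_le_square_iff[of y z] by simp

context weak_field
begin

text \<open>Everything that incompressibility and axial symmetry contribute at a single point; \<open>a\<close> and
  \<open>b\<close> are the Euclidean norms of \<open>v\<close> and of its gradient.\<close>

lemma rvr_bounds:
  assumes tr: "G x $ 1 $ 1 + G x $ 2 $ 2 + G x $ 3 $ 3 = 0"
    and rel: "(x$2)\<^sup>2 * G x $ 1 $ 1 - x$1 * x$2 * (G x $ 1 $ 2 + G x $ 2 $ 1) + (x$1)\<^sup>2 * G x $ 2 $ 2
      = x$1 * v x $ 1 + x$2 * v x $ 2"
  obtains a b where "0 \<le> a" "0 \<le> b" "a\<^sup>2 + b\<^sup>2 = energy x" "radial_rvr x = - (hsq x * G x $ 3 $ 3)"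
    "\<bar>rvr x\<bar> \<le> sqrt (hsq x) * a" "\<bar>rvr x\<bar> \<le> hsq x * b" "\<bar>radial_vz x\<bar> \<le> sqrt (hsq x) * b" "\<bar>G x $ 3 $ 3\<bar> \<le> b"
proof -
  define a2 b2 where "a2 = (\<Sum>i\<in>UNIV. (v x $ i)\<^sup>2)" and "b2 = (\<Sum>i\<in>UNIV. \<Sum>j\<in>UNIV. (G x $ i $ j)\<^sup>2)"
  have nn: "0 \<le> a2" "0 \<le> b2" by (auto simp: a2_def b2_def intro!: sum_nonneg)
  have a2: "(v x $ 1)\<^sup>2 + (v x $ 2)\<^sup>2 \<le> a2" by (simp add: a2_def sum_3)
  have b2: "((G x $ 1 $ 1)\<^sup>2 + (G x $ 1 $ 2)\<^sup>2) + ((G x $ 2 $ 1)\<^sup>2 + (G x $ 2 $ 2)\<^sup>2) \<le> b2"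
      "(G x $ 3 $ 1)\<^sup>2 + (G x $ 3 $ 2)\<^sup>2 \<le> b2" "(G x $ 3 $ 3)\<^sup>2 \<le> b2"
    by (auto simp: b2_def sum_3 intro!: add_nonneg_nonneg add_increasing add_increasing2)
  show ?thesis
  proof (rule that[of "sqrt a2" "sqrt b2"])
    show "(sqrt a2)\<^sup>2 + (sqrt b2)\<^sup>2 = energy x" using nn by (simp add: energy_def a2_def b2_def)
    have G33: "G x $ 3 $ 3 = - (G x $ 1 $ 1 + G x $ 2 $ 2)" using tr by linarith
    show "radial_rvr x = - (hsq x * G x $ 3 $ 3)"
      using rel by (simp add: radial_rvr_def rvr_grad_def hsq_def G33 axis_def algebra_simps power2_eq_square)
    have "(rvr x)\<^sup>2 \<le> hsq x * ((v x $ 1)\<^sup>2 + (v x $ 2)\<^sup>2)"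
      unfolding rvr_def hsq_def by (rule plane_cauchy_schwarz)
    also have "\<dots> \<le> hsq x * a2" by (intro mult_left_mono a2) simp
    finally show "\<bar>rvr x\<bar> \<le> sqrt (hsq x) * sqrt a2" using nn by (intro abs_le_sqrt_mult) auto
    have "rvr x = x$1 * (x$1 * G x $ 2 $ 2 + x$2 * (- G x $ 2 $ 1)) + x$2 * (x$1 * (- G x $ 1 $ 2) + x$2 * G x $ 1 $ 1)"
      using rel by (simp add: rvr_def algebra_simps power2_eq_square)
    then have "(rvr x)\<^sup>2 \<le> hsq x * ((x$1 * G x $ 2 $ 2 + x$2 * (- G x $ 2 $ 1))\<^sup>2 + (x$1 * (- G x $ 1 $ 2) + x$2 * G x $ 1 $ 1)\<^sup>2)"
      unfolding hsq_def using plane_cauchy_schwarz by simp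
    also have "\<dots> \<le> hsq x * (hsq x * ((G x $ 2 $ 2)\<^sup>2 + (- G x $ 2 $ 1)\<^sup>2) + hsq x * ((- G x $ 1 $ 2)\<^sup>2 + (G x $ 1 $ 1)\<^sup>2))"
      unfolding hsq_def by (intro mult_left_mono add_mono plane_cauchy_schwarz) auto
    also have "\<dots> = (hsq x)\<^sup>2 * (((G x $ 1 $ 1)\<^sup>2 + (G x $ 1 $ 2)\<^sup>2) + ((G x $ 2 $ 1)\<^sup>2 + (G x $ 2 $ 2)\<^sup>2))"
      by (simp add: algebra_simps power2_eq_square)
    also have "\<dots> \<le> (hsq x)\<^sup>2 * b2" by (intro mult_left_mono b2) simp
    also have "\<dots> = (hsq x * sqrt b2)\<^sup>2" using nn by (simp add: power_mult_distrib)
    finally show "\<bar>rvr x\<bar> \<le> hsq x * sqrt b2" using nn by (intro abs_le_of_square) auto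
    have "(radial_vz x)\<^sup>2 \<le> hsq x * ((G x $ 3 $ 1)\<^sup>2 + (G x $ 3 $ 2)\<^sup>2)"
      unfolding radial_vz_def hsq_def by (rule plane_cauchy_schwarz)
    also have "\<dots> \<le> hsq x * b2" by (intro mult_left_mono b2) simp
    finally show "\<bar>radial_vz x\<bar> \<le> sqrt (hsq x) * sqrt b2" using nn by (intro abs_le_sqrt_mult) auto
    show "\<bar>G x $ 3 $ 3\<bar> \<le> sqrt b2" using b2(3) nn by (intro abs_le_of_square) auto
  qed (use nn in auto)
qed

lemma rvr_measurable [measurable]: "rvr \<in> borel_measurable borel"
  using weak_gradD(1)[OF weak_grad_rvr] by (rule locL2_measurable)

lemma wt_measurable [measurable]: "e > 0 \<Longrightarrow> d > 0 \<Longrightarrow> (\<lambda>x. wt e d (hsq x)) \<in> borel_measurable borel"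
  by (intro borel_measurable_continuous_onI smooth_continuous wt_smooth)

lemma hsq_measurable [measurable]: "hsq \<in> borel_measurable borel"
  by (intro borel_measurable_continuous_onI smooth_continuous smooth_hsq)

text \<open>The cutoff error decays with the radius \<open>R\<close>, and the error of the axis regularization is \<open>energy\<close>
  times a factor that tends to \<open>0\<close> off the axis as \<open>d \<rightarrow> 0\<close>.\<close>

lemma localized_estimate:
  assumes tr: "AE x in lborel. G x $ 1 $ 1 + G x $ 2 $ 2 + G x $ 3 $ 3 = 0"
    and rel: "AE x in lborel. (x$2)\<^sup>2 * G x $ 1 $ 1 - x$1 * x$2 * (G x $ 1 $ 2 + G x $ 2 $ 1)
      + (x$1)\<^sup>2 * G x $ 2 $ 2 = x$1 * v x $ 1 + x$2 * v x $ 2"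
    and W: "integrable lborel W"
      "AE x in lborel. hsq x * wt e d (hsq x) * (dz_rvr x - radial_vz x)\<^sup>2 \<le> W x"
    and C: "\<And>x. norm (grad (bump R) x) \<le> C / R"
    and pos: "e > 0" "d > 0" "R > 0"
  shows "(\<integral>\<^sup>+x. ennreal (bump R x * wt e d (hsq x) * (rvr x)\<^sup>2 / 2) \<partial>lborel)
    \<le> ennreal ((LINT x|lborel. W x) / 4
        + (8 * e powr (-1/2) * (LINT x|lborel. energy x * (d / (hsq x + d)))
          + 5 * e powr (-1/2) * (C / R) * (LINT x|lborel. energy x)))"
proof -
  let ?m = "\<lambda>x. wt e d (hsq x)" and ?m1 = "\<lambda>x. wt1 e d (hsq x)" and ?m2 = "\<lambda>x. wt2 e d (hsq x)"
  let ?\<eta> = "bump R" and ?C = "e powr (-1/2)"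
  let ?k = "\<lambda>x. 3 * ?m x + hsq x * ?m1 x"
  have tf\<eta>: "test_fn ?\<eta>" by (rule test_fn_bump[OF pos(3)])
  have d: "(wt e d has_real_derivative ?m1 x) (at (hsq x))" "(wt1 e d has_real_derivative ?m2 x) (at (hsq x))" for x
    using pos hsq_nonneg[of x] by (auto intro!: wt_deriv add_nonneg_pos)
  define J where "J \<eta> x = \<eta> x * (hsq x * ?m x * (radial_vz x * dz_rvr x - G x $ 3 $ 3 * radial_rvr x))
    - rvr x * (\<eta> x * (G x $ 3 $ 3 * (4 * (hsq x * ?m x) + 2 * (hsq x * (hsq x * ?m1 x))))
      - hsq x * ?m x * (radial_vz x * grad \<eta> x $ 3 - G x $ 3 $ 3 * radial \<eta> x))" for \<eta> x
  define K where "K \<eta> x = 2 * (\<eta> x * (?k x * (rvr x * radial_rvr x)))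
    + (rvr x)\<^sup>2 * (\<eta> x * (2 * ?k x + 2 * hsq x * (4 * ?m1 x + hsq x * ?m2 x)) + ?k x * radial \<eta> x)" for \<eta> x
  have J: "has_bochner_integral lborel (J ?\<eta>) 0"
  proof -
    have "has_bochner_integral lborel (\<lambda>x.
      ?\<eta> x * (hsq x * ?m x * (radial_vz x * dz_rvr x - G x $ 3 $ 3 * radial_rvr x))
      - rvr x * (?\<eta> x * (G x $ 3 $ 3 * (2 * (hsq x * ?m x) + 2 * hsq x * (hsq x * ?m1 x + ?m x)))
        - hsq x * ?m x * (radial_vz x * grad ?\<eta> x $ 3 - G x $ 3 $ 3 * radial ?\<eta> x))) 0"
      by (rule wedge_identity[OF tf\<eta>, of "\<lambda>t. t * wt e d t" "\<lambda>t. t * wt1 e d t + wt e d t"])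
         (auto intro!: smooth_mult smooth_hsq wt_smooth pos derivative_eq_intros d)
    then show ?thesis
      by (rule has_bochner_integral_cong[THEN iffD1, rotated 3]) (simp_all add: J_def algebra_simps)
  qed
  have K: "has_bochner_integral lborel (K ?\<eta>) 0"
    unfolding K_def[abs_def]
    by (rule square_identity[OF tf\<eta>, of "\<lambda>t. 3 * wt e d t + t * wt1 e d t" "\<lambda>t. 4 * wt1 e d t + t * wt2 e d t"])
       (auto intro!: smooth_add smooth_mult smooth_hsq wt_smooth pos derivative_eq_intros d)
  define D where "D x = energy x * (d / (hsq x + d))" for x
  have D_int: "integrable lborel D"
  proof (rule Bochner_Integration.integrable_bound[OF energy_integrable])
    have "\<bar>D x\<bar> \<le> energy x" for x
    proof -
      note fr = regularization_fraction[OF pos(2) hsq_nonneg[of x]]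
      show ?thesis using mult_left_mono[OF fr(2) energy_nonneg[of x]] mult_nonneg_nonneg[OF energy_nonneg[of x] fr(1)]
        unfolding D_def by (simp only: abs_of_nonneg mult_1_right)
    qed
    then show "AE x in lborel. norm (D x) \<le> norm (energy x)" using energy_nonneg by simp
  qed (use energy_integrable in \<open>auto simp: D_def[abs_def] dest!: borel_measurable_integrable\<close>)
  define H where "H x = J ?\<eta> x - K ?\<eta> x + W x / 4 + (8 * ?C * D x + 5 * ?C * (C / R) * energy x)" for x
  have H: "has_bochner_integral lborel H (0 - 0 + (LINT x|lborel. W x) / 4
      + (8 * ?C * (LINT x|lborel. D x) + 5 * ?C * (C / R) * (LINT x|lborel. energy x)))"
    unfolding H_def[abs_def]
    by (intro has_bochner_integral_add has_bochner_integral_diff J K has_bochner_integral_divide_zero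
        has_bochner_integral_mult_right has_bochner_integral_integrable W D_int energy_integrable)
  have ae: "AE x in lborel. ?\<eta> x * ?m x * (rvr x)\<^sup>2 / 2 \<le> H x"
    using tr rel W(2)
  proof eventually_elim
    case (elim x)
    obtain a b where ab: "0 \<le> a" "0 \<le> b" "a\<^sup>2 + b\<^sup>2 = energy x" "radial_rvr x = - (hsq x * G x $ 3 $ 3)"
      "\<bar>rvr x\<bar> \<le> sqrt (hsq x) * a" "\<bar>rvr x\<bar> \<le> hsq x * b" "\<bar>radial_vz x\<bar> \<le> sqrt (hsq x) * b" "\<bar>G x $ 3 $ 3\<bar> \<le> b"
      using rvr_bounds[OF elim(1,2)] by metis
    have \<eta>: "0 \<le> ?\<eta> x" "?\<eta> x \<le> 1" by (simp_all add: bump_nonneg bump_le_1)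
    have m: "0 \<le> ?m x" by (rule wt_nonneg)
    have sm: "(hsq x)\<^sup>2 * ?m x \<le> ?C"
      using wt_square_le[OF pos(1,2) hsq_nonneg[of x]] powr_half_antimono[OF pos(1) hsq_nonneg[of x]] by linarith
    have g: "0 \<le> C / R" using C[of 0] norm_ge_zero order_trans by blast
    have g2: "(norm (grad ?\<eta> x))\<^sup>2 \<le> (C / R)\<^sup>2" using C by (intro power_mono) auto
    have ng: "(norm (grad ?\<eta> x))\<^sup>2 = (grad ?\<eta> x $ 1)\<^sup>2 + (grad ?\<eta> x $ 2)\<^sup>2 + (grad ?\<eta> x $ 3)\<^sup>2"
      by (rule norm_square_3)
    have "(radial ?\<eta> x)\<^sup>2 \<le> hsq x * ((grad ?\<eta> x $ 1)\<^sup>2 + (grad ?\<eta> x $ 2)\<^sup>2)"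
      unfolding radial_def hsq_def by (rule plane_cauchy_schwarz)
    also have "\<dots> \<le> hsq x * (C / R)\<^sup>2"
      using g2 ng zero_le_power2[of "grad ?\<eta> x $ 3"] by (intro mult_left_mono) (linarith, simp)
    finally have XX: "\<bar>radial ?\<eta> x\<bar> \<le> sqrt (hsq x) * (C / R)" using g by (rule abs_le_sqrt_mult)
    have X3: "\<bar>grad ?\<eta> x $ 3\<bar> \<le> C / R" using C[of x] component_le_norm_cart[of "grad ?\<eta> x" 3] by linarith
    have err: "\<bar>rvr x * (hsq x * ?m x) * (G x $ 3 $ 3 * radial ?\<eta> x - radial_vz x * grad ?\<eta> x $ 3)
        + (rvr x)\<^sup>2 * ?k x * radial ?\<eta> x\<bar> \<le> 5 * ?C * (C / R) * (a\<^sup>2 + b\<^sup>2)"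
      by (rule error_bound[OF hsq_nonneg m wt_coefficient_le[OF pos(1,2) hsq_nonneg] sm ab(1,2) g ab(5-8) XX X3])
    have pw: "?\<eta> x * ((- 7 * ?m x - 10 * hsq x * ?m1 x - 2 * (hsq x)\<^sup>2 * ?m2 x) * (rvr x)\<^sup>2
          - hsq x * ?m x * (dz_rvr x - radial_vz x)\<^sup>2 / 4)
        - rvr x * (hsq x * ?m x) * (G x $ 3 $ 3 * radial ?\<eta> x - radial_vz x * grad ?\<eta> x $ 3)
        - (rvr x)\<^sup>2 * ?k x * radial ?\<eta> x \<le> J ?\<eta> x - K ?\<eta> x"
      unfolding J_def K_def by (rule pointwise_inequality[OF ab(4) hsq_nonneg m \<eta>(1)])
    have frac: "0 \<le> d / (hsq x + d)" using pos by simp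
    have A2: "(rvr x)\<^sup>2 \<le> (hsq x)\<^sup>2 * energy x"
    proof -
      have "(rvr x)\<^sup>2 \<le> (hsq x * b)\<^sup>2" using power_mono[OF ab(6), of 2] by simp
      also have "\<dots> \<le> (hsq x)\<^sup>2 * energy x" unfolding power_mult_distrib ab(3)[symmetric] by (intro mult_left_mono) auto
      finally show ?thesis .
    qed
    have "?m x * (rvr x)\<^sup>2 \<le> ?m x * ((hsq x)\<^sup>2 * energy x)" by (intro mult_left_mono A2 m)
    also have "\<dots> = (hsq x)\<^sup>2 * ?m x * energy x" by simp
    also have "\<dots> \<le> ?C * energy x" by (intro mult_right_mono sm energy_nonneg)
    finally have mA: "?m x * (rvr x)\<^sup>2 \<le> ?C * energy x" .
    have "?\<eta> x * (?m x * (rvr x)\<^sup>2) \<le> 1 * (?C * energy x)"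
      using m by (intro mult_mono \<eta> mA) auto
    from mult_right_mono[OF this frac]
    \<comment> \<open>the contribution of the term \<open>8 d / (t + d)\<close> in the coercivity bound\<close>
    have near_axis: "8 * (?\<eta> x * (?m x * (rvr x)\<^sup>2) * (d / (hsq x + d))) \<le> 8 * ?C * D x"
      by (simp add: D_def)
    have "?\<eta> x * (hsq x * ?m x * (dz_rvr x - radial_vz x)\<^sup>2) \<le> 1 * (hsq x * ?m x * (dz_rvr x - radial_vz x)\<^sup>2)"
      using m by (intro mult_right_mono \<eta> mult_nonneg_nonneg) auto
    then have Z: "?\<eta> x * (hsq x * ?m x * (dz_rvr x - radial_vz x)\<^sup>2 / 4) \<le> W x / 4"
      using elim(3) by simp
    have "?\<eta> x * ((?m x * (1/2 - 8 * (d / (hsq x + d)))) * (rvr x)\<^sup>2)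
        \<le> ?\<eta> x * ((- 7 * ?m x - 10 * hsq x * ?m1 x - 2 * (hsq x)\<^sup>2 * ?m2 x) * (rvr x)\<^sup>2)"
      using wt_coercive[OF pos(1,2) hsq_nonneg[of x]] \<eta> by (intro mult_left_mono mult_right_mono) auto
    moreover have "?\<eta> x * ((?m x * (1/2 - 8 * (d / (hsq x + d)))) * (rvr x)\<^sup>2)
        = ?\<eta> x * ?m x * (rvr x)\<^sup>2 / 2 - 8 * (?\<eta> x * (?m x * (rvr x)\<^sup>2) * (d / (hsq x + d)))"
    proof -
      have "\<eta> * ((m * (1/2 - 8 * q)) * A) = \<eta> * m * A / 2 - 8 * (\<eta> * (m * A) * q)" for \<eta> m q A :: real
        by (simp add: field_simps)
      then show ?thesis .
    qed
    moreover have "h \<le> j + w + (n' + E')"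
      if "p \<le> q" "p = h - n" "q - z - e1 - e2 \<le> j" "\<bar>e1 + e2\<bar> \<le> E'" "z \<le> w" "n \<le> n'"
      for h j w n n' E' p q z e1 e2 :: real
      using that by linarith
    ultimately show ?case
      unfolding H_def using pw err Z near_axis unfolding ab(3) right_diff_distrib[of "?\<eta> x"] by blast
  qed
  have H0: "AE x in lborel. 0 \<le> H x"
    using ae
  proof eventually_elim
    case (elim x)
    have "0 \<le> ?\<eta> x * ?m x * (rvr x)\<^sup>2 / 2" by (simp add: bump_nonneg wt_nonneg)
    then show ?case using elim by linarith
  qed
  have "(\<integral>\<^sup>+x. ennreal (?\<eta> x * ?m x * (rvr x)\<^sup>2 / 2) \<partial>lborel) \<le> (\<integral>\<^sup>+x. ennreal (H x) \<partial>lborel)"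
  proof (rule nn_integral_mono_AE)
    show "AE x in lborel. ennreal (?\<eta> x * ?m x * (rvr x)\<^sup>2 / 2) \<le> ennreal (H x)"
      using ae by eventually_elim (rule ennreal_leI)
  qed
  also have "\<dots> = ennreal (LINT x|lborel. H x)"
    using H H0 by (intro nn_integral_eq_integral) (auto simp: has_bochner_integral_iff)
  finally show ?thesis
    using has_bochner_integral_integral_eq[OF H] by (simp add: D_def)
qed

end

section \<open>Removing the regularization\<close>

text \<open>The axis lies in a plane.\<close>

lemma AE_hsq_pos: "AE x in lborel. hsq x > 0"
proof -
  have "negligible {x::real^3. axis 1 1 \<bullet> x = 0}"
    by (intro negligible_hyperplane) (auto simp: axis_eq_0_iff)
  then have "AE x in lebesgue. x \<notin> {x::real^3. axis 1 1 \<bullet> x = 0}"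
    by (metis AE_not_in negligible_iff_null_sets)
  then have "AE x in lborel. x \<notin> {x::real^3. axis 1 1 \<bullet> x = 0}"
    by (simp add: AE_completion_iff)
  then show ?thesis
    by eventually_elim (auto simp: hsq_def inner_axis' intro!: add_pos_nonneg)
qed

lemma nn_integral_Fatou_limit:
  fixes u :: "nat \<Rightarrow> 'a \<Rightarrow> real"
  assumes meas: "\<And>n. u n \<in> borel_measurable M"
    and lim: "AE x in M. (\<lambda>n. u n x) \<longlonglongrightarrow> f x"
    and bound: "\<And>n. (\<integral>\<^sup>+x. ennreal (u n x) \<partial>M) \<le> ennreal (b n)" and b: "b \<longlonglongrightarrow> c"
  shows "(\<integral>\<^sup>+x. ennreal (f x) \<partial>M) \<le> ennreal c"
proof -
  have "(\<integral>\<^sup>+x. ennreal (f x) \<partial>M) = (\<integral>\<^sup>+x. liminf (\<lambda>n. ennreal (u n x)) \<partial>M)"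
  proof (rule nn_integral_cong_AE)
    show "AE x in M. ennreal (f x) = liminf (\<lambda>n. ennreal (u n x))"
      using lim by eventually_elim (auto intro!: lim_imp_Liminf[symmetric] tendsto_ennrealI)
  qed
  also have "\<dots> \<le> liminf (\<lambda>n. \<integral>\<^sup>+x. ennreal (u n x) \<partial>M)"
    by (rule nn_integral_liminf) (use meas in measurable)
  also have "\<dots> \<le> liminf (\<lambda>n. ennreal (b n))"
    by (intro Liminf_mono always_eventually allI bound)
  also have "\<dots> = ennreal c"
    by (intro lim_imp_Liminf tendsto_ennrealI b) simp
  finally show ?thesis .
qed

context weak_field
begin

text \<open>The radius and \<open>1 / d\<close> tend to infinity together.\<close>

lemma regularized_estimate:
  assumes tr: "AE x in lborel. G x $ 1 $ 1 + G x $ 2 $ 2 + G x $ 3 $ 3 = 0"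
    and rel: "AE x in lborel. (x$2)\<^sup>2 * G x $ 1 $ 1 - x$1 * x$2 * (G x $ 1 $ 2 + G x $ 2 $ 1)
      + (x$1)\<^sup>2 * G x $ 2 $ 2 = x$1 * v x $ 1 + x$2 * v x $ 2"
    and W: "integrable lborel W"
      "AE x in lborel. (dz_rvr x - radial_vz x)\<^sup>2 \<le> W x * hsq x * sqrt (hsq x)"
    and e: "e > 0"
  shows "(\<integral>\<^sup>+x. ennreal (((hsq x + e) powr (-1/2) * (hsq x) powr (-2)) * (rvr x)\<^sup>2 / 2) \<partial>lborel)
    \<le> ennreal ((LINT x|lborel. W x) / 4)"
proof -
  obtain C where C: "\<And>R x. R > 0 \<Longrightarrow> norm (grad (bump R) x) \<le> C / R"
    by (rule bump_grad_bound) (rule that)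
  define d where "d n = 1 / real (Suc n)" for n
  have d: "d n > 0" for n by (simp add: d_def)
  have d0: "d \<longlonglongrightarrow> 0" unfolding d_def by (rule LIMSEQ_Suc[OF lim_1_over_n])
  have [measurable]: "bump (real (Suc n)) \<in> borel_measurable borel" for n
    by (rule test_fn_measurable[OF test_fn_bump]) simp
  have [measurable]: "energy \<in> borel_measurable borel"
    using energy_integrable by (auto dest: borel_measurable_integrable)
  note [measurable] = wt_measurable[OF e d]
  have "(\<integral>\<^sup>+x. ennreal (1 * ((hsq x + e) powr (-1/2) * (hsq x) powr (-2)) * (rvr x)\<^sup>2 / 2) \<partial>lborel)
      \<le> ennreal ((LINT x|lborel. W x) / 4 + (8 * e powr (-1/2) * 0 + 5 * e powr (-1/2) * 0 * (LINT x|lborel. energy x)))"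
  proof (rule nn_integral_Fatou_limit[where
        u = "\<lambda>n x. bump (real (Suc n)) x * wt e (d n) (hsq x) * (rvr x)\<^sup>2 / 2"])
    show "AE x in lborel. (\<lambda>n. bump (real (Suc n)) x * wt e (d n) (hsq x) * (rvr x)\<^sup>2 / 2)
        \<longlonglongrightarrow> 1 * ((hsq x + e) powr (-1/2) * (hsq x) powr (-2)) * (rvr x)\<^sup>2 / 2"
      using AE_hsq_pos
    proof eventually_elim
      case (elim x)
      have "(\<lambda>n. hsq x + d n) \<longlonglongrightarrow> hsq x + 0" by (intro tendsto_intros d0)
      then have lim: "(\<lambda>n. (hsq x + d n) powr (-2)) \<longlonglongrightarrow> (hsq x) powr (-2)"
        using tendsto_powr[OF _ tendsto_const, of _ "hsq x + 0" sequentially "-2"] elim by simp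
      show ?case
        unfolding wt_def by (intro tendsto_divide tendsto_mult lim bump_tendsto_1 tendsto_const) simp
    qed
    show "(\<integral>\<^sup>+x. ennreal (bump (real (Suc n)) x * wt e (d n) (hsq x) * (rvr x)\<^sup>2 / 2) \<partial>lborel)
      \<le> ennreal ((LINT x|lborel. W x) / 4
        + (8 * e powr (-1/2) * (LINT x|lborel. energy x * (d n / (hsq x + d n)))
          + 5 * e powr (-1/2) * (C / real (Suc n)) * (LINT x|lborel. energy x)))" for n
    proof (rule localized_estimate[OF tr rel W(1) _ C e d])
      show "AE x in lborel. hsq x * wt e (d n) (hsq x) * (dz_rvr x - radial_vz x)\<^sup>2 \<le> W x"
        using W(2) AE_hsq_pos
      proof eventually_elim
        case (elim x)
        have W0: "0 \<le> W x"
        proof (rule ccontr)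
          assume "\<not> 0 \<le> W x"
          then have "W x * (hsq x * sqrt (hsq x)) < 0" using elim(2) by (intro mult_neg_pos) auto
          then show False using elim(1) zero_le_power2[of "dz_rvr x - radial_vz x"] by (simp add: mult.assoc)
        qed
        have "(hsq x)\<^sup>2 * wt e (d n) (hsq x) \<le> (hsq x + e) powr (-1/2)"
          by (intro wt_square_le e d) simp
        also have "\<dots> \<le> (hsq x) powr (-1/2)" using elim(2) e by (intro powr_mono2') auto
        also have "\<dots> = 1 / sqrt (hsq x)"
          using powr_minus_divide[of "hsq x" "1/2"] powr_half_sqrt[of "hsq x"] by simp
        finally have 1: "(hsq x)\<^sup>2 * wt e (d n) (hsq x) * sqrt (hsq x) \<le> 1"
          using elim(2) by (simp add: field_simps)
        have "hsq x * wt e (d n) (hsq x) * (dz_rvr x - radial_vz x)\<^sup>2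
            \<le> hsq x * wt e (d n) (hsq x) * (W x * hsq x * sqrt (hsq x))"
          by (intro mult_left_mono elim(1) mult_nonneg_nonneg wt_nonneg hsq_nonneg)
        also have "\<dots> = (hsq x)\<^sup>2 * wt e (d n) (hsq x) * sqrt (hsq x) * W x"
          by (simp add: power2_eq_square)
        also have "\<dots> \<le> 1 * W x" by (intro mult_right_mono 1 W0)
        finally show ?case by simp
      qed
    qed simp_all
    have "(\<lambda>n. LINT x|lborel. energy x * (d n / (hsq x + d n))) \<longlonglongrightarrow> (LINT x::real^3|lborel. 0)"
    proof (rule integral_dominated_convergence[OF _ _ energy_integrable])
      show "AE x in lborel. (\<lambda>n. energy x * (d n / (hsq x + d n))) \<longlonglongrightarrow> 0"
        using AE_hsq_pos
      proof eventually_elim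
        case (elim x)
        have "(\<lambda>n. energy x * (d n / (hsq x + d n))) \<longlonglongrightarrow> energy x * (0 / (hsq x + 0))"
          using elim by (intro tendsto_intros d0) auto
        then show ?case by simp
      qed
      have "\<bar>energy x * (d n / (hsq x + d n))\<bar> \<le> energy x" for n x
      proof -
        note fr = regularization_fraction[OF d[of n] hsq_nonneg[of x]]
        show ?thesis using mult_left_mono[OF fr(2) energy_nonneg[of x]] mult_nonneg_nonneg[OF energy_nonneg[of x] fr(1)]
          by (simp only: abs_of_nonneg mult_1_right)
      qed
      then show "AE x in lborel. norm (energy x * (d n / (hsq x + d n))) \<le> energy x" for n by simp
    qed measurable
    moreover have "(\<lambda>n. C / real (Suc n)) \<longlonglongrightarrow> 0"
      using tendsto_mult_right[OF d0, of C] by (simp add: d_def)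
    ultimately show "(\<lambda>n. (LINT x|lborel. W x) / 4
        + (8 * e powr (-1/2) * (LINT x|lborel. energy x * (d n / (hsq x + d n)))
          + 5 * e powr (-1/2) * (C / real (Suc n)) * (LINT x|lborel. energy x)))
      \<longlonglongrightarrow> (LINT x|lborel. W x) / 4
        + (8 * e powr (-1/2) * 0 + 5 * e powr (-1/2) * 0 * (LINT x|lborel. energy x))"
      by (intro tendsto_intros) simp_all
  qed measurable
  then show ?thesis by simp
qed

lemma singular_estimate:
  assumes tr: "AE x in lborel. G x $ 1 $ 1 + G x $ 2 $ 2 + G x $ 3 $ 3 = 0"
    and rel: "AE x in lborel. (x$2)\<^sup>2 * G x $ 1 $ 1 - x$1 * x$2 * (G x $ 1 $ 2 + G x $ 2 $ 1)
      + (x$1)\<^sup>2 * G x $ 2 $ 2 = x$1 * v x $ 1 + x$2 * v x $ 2"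
    and W: "integrable lborel W"
      "AE x in lborel. (dz_rvr x - radial_vz x)\<^sup>2 \<le> W x * hsq x * sqrt (hsq x)"
  shows "(\<integral>\<^sup>+x. ennreal ((hsq x powr (-1/2) * (hsq x) powr (-2)) * (rvr x)\<^sup>2 / 2) \<partial>lborel)
    \<le> ennreal ((LINT x|lborel. W x) / 4)"
proof (rule nn_integral_Fatou_limit[where
      u = "\<lambda>n x. ((hsq x + 1 / real (Suc n)) powr (-1/2) * (hsq x) powr (-2)) * (rvr x)\<^sup>2 / 2"])
  show "AE x in lborel. (\<lambda>n. ((hsq x + 1 / real (Suc n)) powr (-1/2) * (hsq x) powr (-2)) * (rvr x)\<^sup>2 / 2)
      \<longlonglongrightarrow> (hsq x powr (-1/2) * (hsq x) powr (-2)) * (rvr x)\<^sup>2 / 2"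
    using AE_hsq_pos
  proof eventually_elim
    case (elim x)
    have "(\<lambda>n. hsq x + 1 / real (Suc n)) \<longlonglongrightarrow> hsq x + 0"
      by (intro tendsto_intros LIMSEQ_Suc[OF lim_1_over_n])
    then have lim: "(\<lambda>n. (hsq x + 1 / real (Suc n)) powr (-1/2)) \<longlonglongrightarrow> (hsq x) powr (-1/2)"
      using tendsto_powr[OF _ tendsto_const, of _ "hsq x + 0" sequentially "-1/2"] elim by simp
    show ?case
      by (intro tendsto_divide tendsto_mult lim tendsto_const) simp
  qed
  show "(\<integral>\<^sup>+x. ennreal (((hsq x + 1 / real (Suc n)) powr (-1/2) * (hsq x) powr (-2)) * (rvr x)\<^sup>2 / 2) \<partial>lborel)
    \<le> ennreal ((LINT x|lborel. W x) / 4)" for n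
    by (rule regularized_estimate[OF assms]) simp
qed (auto intro!: tendsto_const)

text \<open>If the right-hand side is infinite there is nothing to prove. Otherwise it bounds the square of
  \<open>r \<omega>\<^sub>\<phi>\<close> locally, which is what the comparison with the weak gradient needs.\<close>

lemma static_estimate:
  assumes div: "\<And>\<phi>. test_fn \<phi> \<Longrightarrow> (LINT x|lborel. v x \<bullet> grad \<phi> x) = 0"
    and axi: "axisymmetric v" and curl: "weak_curl v w"
  shows "(\<integral>\<^sup>+x. ennreal ((comp_r v x)\<^sup>2 / (cyl_r x) ^ 3) \<partial>lborel)
    \<le> (\<integral>\<^sup>+x. ennreal ((comp_phi w x)\<^sup>2 / cyl_r x) \<partial>lborel)"
proof (cases "(\<integral>\<^sup>+x. ennreal ((comp_phi w x)\<^sup>2 / cyl_r x) \<partial>lborel) < \<infinity>")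
  case False
  then show ?thesis by (simp add: not_less top_unique)
next
  case True
  define W where "W x = (comp_phi w x)\<^sup>2 / cyl_r x" for x
  define Z where "Z x = x$1 * w x $ 2 - x$2 * w x $ 1" for x
  have r: "cyl_r x = sqrt (hsq x)" for x by (simp add: cyl_r_def hsq_def)
  have [measurable]: "w \<in> borel_measurable borel"
    using curl by (auto simp: weak_curl_def locally_integrable_def)
  have [measurable]: "(\<lambda>x. x $ i) \<in> borel_measurable borel" for i :: 3
    by (intro borel_measurable_continuous_onI continuous_intros)
  have comp_phi: "comp_phi w x = Z x / cyl_r x" for x
    by (simp add: comp_phi_def e_phi_def inner_vec_def sum_3 Z_def diff_divide_distrib algebra_simps)
  have comp_r: "comp_r v x = rvr x / cyl_r x" for x
    by (simp add: comp_r_def e_r_def inner_vec_def sum_3 rvr_def add_divide_distrib algebra_simps)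
  have [measurable]: "Z \<in> borel_measurable borel"
    unfolding Z_def[abs_def] by measurable
  have W_meas [measurable]: "W \<in> borel_measurable borel"
    unfolding W_def[abs_def] comp_phi r by measurable
  have W0: "0 \<le> W x" for x by (simp add: W_def r)
  have W: "integrable lborel W"
    using True W0 by (intro integrableI_nonneg) (auto simp: W_def)
  have Z2: "(Z x)\<^sup>2 = W x * hsq x * sqrt (hsq x)" for x
  proof (cases "hsq x = 0")
    case True
    then have "x$1 = 0" "x$2 = 0" by (simp_all add: hsq_def)
    then show ?thesis using True by (simp add: Z_def)
  next
    case False
    then have "hsq x > 0" using hsq_nonneg[of x] by linarith
    then show ?thesis by (simp add: W_def comp_phi r power_divide)
  qed
  have "locL2 Z"
    unfolding locL2_def
  proof (intro conjI allI)
    fix R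
    show "L2 (\<lambda>x. indicator (cball 0 R) x * Z x)"
      unfolding L2_def
    proof
      show m: "(\<lambda>x. indicator (cball 0 R) x * Z x) \<in> borel_measurable borel"
        by (intro borel_measurable_times borel_measurable_indicator borel_closed closed_cball) measurable
      show "integrable lborel (\<lambda>x. (indicator (cball 0 R) x * Z x)\<^sup>2)"
      proof (rule Bochner_Integration.integrable_bound)
        show "integrable lborel (\<lambda>x. \<bar>R\<bar> ^ 3 * W x)" using W by simp
        have "(indicator (cball 0 R) x * Z x)\<^sup>2 \<le> \<bar>R\<bar> ^ 3 * W x" for x
        proof (cases "norm x \<le> R")
          case True
          have "hsq x \<le> (norm x)\<^sup>2"
            by (simp add: norm_square_3 hsq_def)
          then have s: "sqrt (hsq x) \<le> \<bar>R\<bar>"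
            using True real_sqrt_le_mono[of "hsq x" "(norm x)\<^sup>2"] by simp
          have "hsq x * sqrt (hsq x) = sqrt (hsq x) ^ 3"
            by (simp add: power3_eq_cube)
          also have "\<dots> \<le> \<bar>R\<bar> ^ 3" using s by (intro power_mono) auto
          finally have "W x * (hsq x * sqrt (hsq x)) \<le> W x * \<bar>R\<bar> ^ 3" using W0 by (intro mult_left_mono)
          then show ?thesis using True by (simp add: Z2 mult_ac)
        qed (use W0 in simp)
        then show "AE x in lborel. norm ((indicator (cball 0 R) x * Z x)\<^sup>2) \<le> norm (\<bar>R\<bar> ^ 3 * W x)"
          using W0 by (simp add: abs_mult)
      qed (use m in measurable)
    qed
  qed measurable
  then have "AE x in lborel. Z x = (x$1 * G x $ 1 $ 3 + x$2 * G x $ 2 $ 3) - (x$1 * G x $ 3 $ 1 + x$2 * G x $ 3 $ 2)"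
    unfolding Z_def[abs_def] by (rule curl_relation[OF curl])
  then have WZ: "AE x in lborel. (dz_rvr x - radial_vz x)\<^sup>2 \<le> W x * hsq x * sqrt (hsq x)"
    by eventually_elim (simp flip: Z2 add: dz_rvr_def rvr_grad_def radial_vz_def axis_def)
  have "(\<integral>\<^sup>+x. ennreal ((comp_r v x)\<^sup>2 / (cyl_r x) ^ 3) \<partial>lborel)
      = (\<integral>\<^sup>+x. 2 * ennreal ((hsq x powr (-1/2) * (hsq x) powr (-2)) * (rvr x)\<^sup>2 / 2) \<partial>lborel)"
  proof (rule nn_integral_cong_AE)
    show "AE x in lborel. ennreal ((comp_r v x)\<^sup>2 / (cyl_r x) ^ 3)
      = 2 * ennreal ((hsq x powr (-1/2) * (hsq x) powr (-2)) * (rvr x)\<^sup>2 / 2)"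
      using AE_hsq_pos
    proof eventually_elim
      case (elim x)
      define y where "y = sqrt (hsq x)"
      have y: "y > 0" "hsq x = y\<^sup>2" using elim by (simp_all add: y_def)
      have "hsq x powr (-1/2) = 1 / y"
        using powr_minus_divide[of "hsq x" "1/2"] powr_half_sqrt[of "hsq x"] by (simp add: y_def)
      moreover have "hsq x powr (-2) = 1 / (y\<^sup>2)\<^sup>2"
        using powr_minus_divide[of "hsq x" 2] elim by (simp add: powr_numeral y(2))
      moreover have "(a / y)\<^sup>2 / y ^ 3 = 2 * ((1 / y * (1 / (y\<^sup>2)\<^sup>2)) * a\<^sup>2 / 2)" for a
        by (simp add: power_divide power2_eq_square power3_eq_cube)
      ultimately have eq: "(comp_r v x)\<^sup>2 / (cyl_r x) ^ 3 = 2 * ((hsq x powr (-1/2) * (hsq x) powr (-2)) * (rvr x)\<^sup>2 / 2)"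
        unfolding comp_r unfolding r y_def[symmetric] by simp
      have two: "ennreal (2 * q) = 2 * ennreal q" if "q \<ge> 0" for q
        using ennreal_mult[of 2 q] that by simp
      show ?case unfolding eq by (rule two) simp
    qed
  qed
  also have "\<dots> = 2 * (\<integral>\<^sup>+x. ennreal ((hsq x powr (-1/2) * (hsq x) powr (-2)) * (rvr x)\<^sup>2 / 2) \<partial>lborel)"
    by (rule nn_integral_cmult) measurable
  also have "\<dots> \<le> 2 * ennreal ((LINT x|lborel. W x) / 4)"
    by (intro mult_left_mono singular_estimate[OF trace_zero[OF div] axisymmetric_relation[OF axi] W WZ]) simp_all
  also have "\<dots> = ennreal (2 * ((LINT x|lborel. W x) / 4))"
    using ennreal_mult[of 2 "(LINT x|lborel. W x) / 4"] W0
    by (simp add: Bochner_Integration.integral_nonneg)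
  also have "\<dots> \<le> ennreal (LINT x|lborel. W x)"
    using W0 by (intro ennreal_leI) (simp add: Bochner_Integration.integral_nonneg)
  also have "\<dots> = (\<integral>\<^sup>+x. ennreal ((comp_phi w x)\<^sup>2 / cyl_r x) \<partial>lborel)"
    using nn_integral_eq_integral[OF W] W0 unfolding W_def[symmetric] by simp
  finally show ?thesis .
qed

end

section \<open>From time slices to the solution\<close>

lemma L2I:
  fixes F :: "real^3 \<Rightarrow> 'b::euclidean_space"
  assumes F: "F \<in> borel_measurable lborel" "(\<integral>\<^sup>+x. ennreal ((norm (F x))\<^sup>2) \<partial>lborel) < \<infinity>"
    and f: "f \<in> borel_measurable borel" "\<And>x. \<bar>f x\<bar> \<le> norm (F x)"
  shows "L2 f"
  unfolding L2_def
proof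
  show "integrable lborel (\<lambda>x. (f x)\<^sup>2)"
  proof (rule Bochner_Integration.integrable_bound)
    show "integrable lborel (\<lambda>x. (norm (F x))\<^sup>2)"
      using F by (intro integrableI_nonneg) auto
    have "(f x)\<^sup>2 \<le> (norm (F x))\<^sup>2" for x using power_mono[OF f(2)[of x], of 2] by simp
    then show "AE x in lborel. norm ((f x)\<^sup>2) \<le> norm ((norm (F x))\<^sup>2)" by simp
  qed (use f in measurable)
qed (rule f)

lemma borel_measurable_vec_nth': "(\<lambda>y::'a::euclidean_space^'n. y $ i) \<in> borel_measurable borel"
  by (intro borel_measurable_continuous_onI continuous_intros)

lemma weak_fieldI:
  assumes w: "weak_gradient v G"
    and v: "(\<integral>\<^sup>+x. ennreal ((norm (v x))\<^sup>2) \<partial>lborel) < \<infinity>"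
    and G: "(\<integral>\<^sup>+x. ennreal ((norm (G x))\<^sup>2) \<partial>lborel) < \<infinity>"
  shows "weak_field v G"
proof
  have m: "v \<in> borel_measurable lborel" "G \<in> borel_measurable lborel"
    using w by (auto simp: weak_gradient_def locally_integrable_def)
  have m': "v \<in> borel_measurable borel" "G \<in> borel_measurable borel" using m by simp_all
  show "L2 (\<lambda>x. v x $ i)" for i
    by (rule L2I[OF m(1) v])
       (auto intro: measurable_compose[OF m'(1) borel_measurable_vec_nth'] component_le_norm_cart)
  show "L2 (\<lambda>x. G x $ i $ j)" for i j
  proof (rule L2I[OF m(2) G])
    show "(\<lambda>x. G x $ i $ j) \<in> borel_measurable borel"
      by (rule measurable_compose[OF measurable_compose[OF m'(2) borel_measurable_vec_nth'] borel_measurable_vec_nth'])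
    show "\<bar>G x $ i $ j\<bar> \<le> norm (G x)" for x
      using component_le_norm_cart[of "G x $ i" j] Finite_Cartesian_Product.norm_nth_le[of "G x" i] by linarith
  qed
qed (use w in \<open>simp add: weak_gradient_def\<close>)

text \<open>Tonelli's theorem.\<close>

lemma AE_finite_slice:
  fixes F :: "real \<times> (real^3) \<Rightarrow> 'b::euclidean_space"
  assumes F: "in_Lp (space_time T) 2 F"
  shows "AE t\<in>{0<..<T} in lborel. (\<integral>\<^sup>+x. ennreal ((norm (F (t, x)))\<^sup>2) \<partial>lborel) < \<infinity>"
proof -
  let ?S = "{0<..<T} \<times> (UNIV :: (real^3) set)"
  define h where "h z = ennreal ((norm (F z))\<^sup>2) * indicator ?S z" for z
  have S: "?S \<inter> space lborel \<in> sets lborel" by (simp add: borel_open open_Times)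
  have m: "F \<in> borel_measurable (space_time T)" using F by (simp add: in_Lp_def)
  have m2: "(\<lambda>z. ennreal ((norm (F z))\<^sup>2)) \<in> borel_measurable (restrict_space lborel ?S)"
    using m unfolding space_time_def by measurable
  have "h \<in> borel_measurable lborel"
    unfolding h_def[abs_def] by (rule borel_measurable_restrict_space_iff_ennreal[OF S, THEN iffD1, OF m2])
  then have h: "h \<in> borel_measurable (lborel \<Otimes>\<^sub>M lborel)" by (simp add: lborel_prod)
  have "(\<integral>\<^sup>+t. \<integral>\<^sup>+x. h (t, x) \<partial>lborel \<partial>lborel) = (\<integral>\<^sup>+z. h z \<partial>lborel)"
    using lborel.nn_integral_fst[OF h] by (simp add: lborel_prod)
  also have "\<dots> = (\<integral>\<^sup>+z. ennreal ((norm (F z))\<^sup>2) \<partial>space_time T)"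
    unfolding space_time_def h_def by (rule nn_integral_restrict_space[OF S, symmetric])
  also have "\<dots> < \<infinity>"
    using F by (simp add: in_Lp_def powr_numeral)
  finally have "AE t in lborel. (\<integral>\<^sup>+x. h (t, x) \<partial>lborel) \<noteq> \<infinity>"
    by (intro nn_integral_PInf_AE lborel.borel_measurable_nn_integral_fst h) auto
  then show ?thesis
  proof eventually_elim
    case (elim t)
    show ?case
    proof
      assume t: "t \<in> {0<..<T}"
      have "h (t, x) = ennreal ((norm (F (t, x)))\<^sup>2)" for x
        using t by (simp add: h_def)
      with elim show "(\<integral>\<^sup>+x. ennreal ((norm (F (t, x)))\<^sup>2) \<partial>lborel) < \<infinity>"
        by (simp add: less_top)
    qed
  qed
qed

lemma slice_estimate:
  assumes w: "suitable_weak_solution \<nu> T v p" and axi: "AE t\<in>{0<..<T} in lborel. axisymmetric (v t)"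
    and \<omega>: "vorticity T v \<omega>"
  shows "AE t\<in>{0<..<T} in lborel. (\<integral>\<^sup>+x. ennreal ((comp_r (v t) x)\<^sup>2 / (cyl_r x) ^ 3) \<partial>lborel)
    \<le> (\<integral>\<^sup>+x. ennreal ((comp_phi (\<omega> t) x)\<^sup>2 / cyl_r x) \<partial>lborel)"
proof -
  obtain G where G: "energy_class T v G" using w by (auto simp: suitable_weak_solution_def)
  then obtain C :: real where C: "AE t\<in>{0<..<T} in lborel. (\<integral>\<^sup>+x. ennreal ((norm (v t x))\<^sup>2) \<partial>lborel) \<le> ennreal C"
    and grad: "AE t\<in>{0<..<T} in lborel. weak_gradient (v t) (G t)"
    and G2: "in_Lp (space_time T) 2 (\<lambda>(t, x). G t x)"
    by (auto simp: energy_class_def)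
  have div: "AE t\<in>{0<..<T} in lborel. weakly_divergence_free (v t)"
    using w by (simp add: suitable_weak_solution_def)
  have curl: "AE t\<in>{0<..<T} in lborel. weak_curl (v t) (\<omega> t)"
    using \<omega> by (simp add: vorticity_def)
  show ?thesis
    using C grad AE_finite_slice[OF G2] div curl axi
  proof eventually_elim
    case (elim t)
    show ?case
    proof
      assume t: "t \<in> {0<..<T}"
      have "(\<integral>\<^sup>+x. ennreal ((norm (v t x))\<^sup>2) \<partial>lborel) < \<infinity>"
        using elim(1) t by (auto intro: le_less_trans)
      then interpret weak_field "v t" "G t"
        using elim(2,3) t by (intro weak_fieldI) auto
      show "(\<integral>\<^sup>+x. ennreal ((comp_r (v t) x)\<^sup>2 / (cyl_r x) ^ 3) \<partial>lborel)
        \<le> (\<integral>\<^sup>+x. ennreal ((comp_phi (\<omega> t) x)\<^sup>2 / cyl_r x) \<partial>lborel)"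
        using elim(4-6) t by (intro static_estimate) (auto simp: weakly_divergence_free_def)
    qed
  qed
qed

theorem theorem2:
  fixes \<nu> T :: real
  assumes "\<nu> > 0" and "T > 0"
  shows "\<exists>c\<^sub>3::real. c\<^sub>3 \<ge> 0 \<and>
    (\<forall>(v :: real \<Rightarrow> real^3 \<Rightarrow> real^3) (p :: real \<Rightarrow> real^3 \<Rightarrow> real)
       (\<omega> :: real \<Rightarrow> real^3 \<Rightarrow> real^3) (s :: real) (c\<^sub>2 :: ennreal).
      suitable_weak_solution \<nu> T v p \<longrightarrow>
      (AE t\<in>{0<..<T} in lborel. axisymmetric (v t)) \<longrightarrow>
      axisymmetric (v 0) \<longrightarrow>
      weakly_divergence_free (v 0) \<longrightarrow>
      vorticity T v \<omega> \<longrightarrow>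
      in_Lp lborel 2 (\<lambda>x. (comp_phi (v 0) x)\<^sup>2 / cyl_r x) \<longrightarrow>
      in_Lp lborel 2 (\<lambda>x. comp_phi (\<omega> 0) x / cyl_r x) \<longrightarrow>
      in_Lp lborel 2 (\<lambda>x. comp_r (\<omega> 0) x / cyl_r x) \<longrightarrow>
      in_Lp lborel 2 (\<lambda>x. comp_z (\<omega> 0) x) \<longrightarrow>
      in_Linfty lborel (\<lambda>x. cyl_r x * comp_phi (v 0) x) \<longrightarrow>
      s \<ge> 3 \<longrightarrow>
      in_Lp lborel s (\<lambda>x. cyl_r x * comp_phi (v 0) x) \<longrightarrow>
      (\<integral>\<^sup>+t\<in>{0<..<T}. (\<integral>\<^sup>+x. ennreal ((comp_phi (\<omega> t) x)\<^sup>2 / cyl_r x) \<partial>lborel) \<partial>lborel) \<le> c\<^sub>2 \<longrightarrow>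
      c\<^sub>2 < \<infinity> \<longrightarrow>
      (\<integral>\<^sup>+t\<in>{0<..<T}. (\<integral>\<^sup>+x. ennreal ((comp_r (v t) x)\<^sup>2 / (cyl_r x) ^ 3) \<partial>lborel) \<partial>lborel)
        \<le> ennreal c\<^sub>3 *
          (\<integral>\<^sup>+t\<in>{0<..<T}. (\<integral>\<^sup>+x. ennreal ((comp_phi (\<omega> t) x)\<^sup>2 / cyl_r x) \<partial>lborel) \<partial>lborel) \<and>
      ennreal c\<^sub>3 *
          (\<integral>\<^sup>+t\<in>{0<..<T}. (\<integral>\<^sup>+x. ennreal ((comp_phi (\<omega> t) x)\<^sup>2 / cyl_r x) \<partial>lborel) \<partial>lborel)
        \<le> ennreal c\<^sub>3 * c\<^sub>2)"
proof (intro exI[of _ "1::real"] conjI allI impI)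
  show "(0::real) \<le> 1" by simp
next
  fix v :: "real \<Rightarrow> real^3 \<Rightarrow> real^3" and p :: "real \<Rightarrow> real^3 \<Rightarrow> real" and \<omega> :: "real \<Rightarrow> real^3 \<Rightarrow> real^3"
  assume "suitable_weak_solution \<nu> T v p" "AE t\<in>{0<..<T} in lborel. axisymmetric (v t)" "vorticity T v \<omega>"
  note slice = slice_estimate[OF this]
  have "(\<integral>\<^sup>+t\<in>{0<..<T}. (\<integral>\<^sup>+x. ennreal ((comp_r (v t) x)\<^sup>2 / (cyl_r x) ^ 3) \<partial>lborel) \<partial>lborel)
      \<le> (\<integral>\<^sup>+t\<in>{0<..<T}. (\<integral>\<^sup>+x. ennreal ((comp_phi (\<omega> t) x)\<^sup>2 / cyl_r x) \<partial>lborel) \<partial>lborel)"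
    using slice by (intro nn_integral_mono_AE, eventually_elim) (auto simp: indicator_def)
  then show "(\<integral>\<^sup>+t\<in>{0<..<T}. (\<integral>\<^sup>+x. ennreal ((comp_r (v t) x)\<^sup>2 / (cyl_r x) ^ 3) \<partial>lborel) \<partial>lborel)
      \<le> ennreal 1 * (\<integral>\<^sup>+t\<in>{0<..<T}. (\<integral>\<^sup>+x. ennreal ((comp_phi (\<omega> t) x)\<^sup>2 / cyl_r x) \<partial>lborel) \<partial>lborel)"
    by simp
next
  fix \<omega> :: "real \<Rightarrow> real^3 \<Rightarrow> real^3" and c\<^sub>2 :: ennreal
  assume "(\<integral>\<^sup>+t\<in>{0<..<T}. (\<integral>\<^sup>+x. ennreal ((comp_phi (\<omega> t) x)\<^sup>2 / cyl_r x) \<partial>lborel) \<partial>lborel) \<le> c\<^sub>2"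
  then show "ennreal 1 * (\<integral>\<^sup>+t\<in>{0<..<T}. (\<integral>\<^sup>+x. ennreal ((comp_phi (\<omega> t) x)\<^sup>2 / cyl_r x) \<partial>lborel) \<partial>lborel)
      \<le> ennreal 1 * c\<^sub>2"
    by (intro mult_left_mono) simp_all
qed

end
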